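(* Fix $\lambda>0$ and $z>0$. The process $\xi^{\lambda,z}$ is a semimartingale and $$\xi^{\lambda,z}_t=b^{\lambda,z}_t+\lambda\int_0^{t\wedge\sigma_z^\lambda}\operatorname{sgn}(z-\xi^{\lambda,z}_s)\,\mathrm{d}s,\qquad t\ge 0,$$ where $b^{\lambda,z}$ is an $\mathbb{F}^{\xi^{\lambda,z}}$-Brownian motion stopped at $\sigma_z^\lambda$. Here $\operatorname{sgn}(x)=-1$ for $x<0$, $\operatorname{sgn}(0)=0$, and $\operatorname{sgn}(x)=1$ for $x>0$.
   Context: Let $B=(B_t)_{t\ge 0}$ be a standard Brownian motion started at $0$ on a complete probability space $(\Omega,\mathcal{F},\mathbb{P})$. For $\lambda>0$, $z>0$, put $B^\lambda_t=B_t+\lambda t$, $\sigma_z^\lambda=\sup\{t>0: B^\lambda_t=z\}$ (almost surely finite), and $\xi^{\lambda,z}_t=B^\lambda_{t\wedge\sigma_z^\lambda}$, $t\ge 0$, with natural filtration $\mathbb{F}^{\xi^{\lambda,z}}$, $\mathcal{F}^{\xi^{\lambda,z}}_t=\sigma(\xi^{\lambda,z}_s,\,s\le t)$ (understood up to $\mathbb{P}$-null sets). The random time $\sigma_z^\lambda$ is a stopping time of the completed filtration, since $\mathbb{P}(\{\xi^{\lambda,z}_t=z\}\,\triangle\,\{\sigma_z^\lambda\le t\})=0$ for all $t>0$. "Brownian motion stopped at $\sigma_z^\lambda$" with respect to a filtration means a continuous martingale $b$ of that filtration with $b_0=0$ and quadratic variation $\langle b\rangle_t=t\wedge\sigma_z^\lambda$.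 *)

theory Defs
  imports "HOL-Probability.Probability"
begin

text \<open>
  Processes are indexed by real time; only the times \<open>t \<ge> 0\<close> matter. Path properties
  are required almost surely, so every notion is invariant under indistinguishability.
\<close>

definition ae_continuous :: "'w measure \<Rightarrow> (real \<Rightarrow> 'w \<Rightarrow> real) \<Rightarrow> bool"
  where "ae_continuous M X \<longleftrightarrow> (AE \<omega> in M. continuous_on {0..} (\<lambda>t. X t \<omega>))"

definition ae_cadlag :: "'w measure \<Rightarrow> (real \<Rightarrow> 'w \<Rightarrow> real) \<Rightarrow> bool"
  where "ae_cadlag M X \<longleftrightarrow>
    (AE \<omega> in M. (\<forall>t\<ge>0. continuous (at_right t) (\<lambda>s. X s \<omega>)) \<and>
                (\<forall>t>0. \<exists>l. ((\<lambda>s. X s \<omega>) \<longlongrightarrow> l) (at_left t)))"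

definition standard_brownian_motion :: "'w measure \<Rightarrow> (real \<Rightarrow> 'w \<Rightarrow> real) \<Rightarrow> bool"
  where "standard_brownian_motion M B \<longleftrightarrow>
    (\<forall>t\<ge>0. B t \<in> borel_measurable M) \<and>
    (AE \<omega> in M. B 0 \<omega> = 0) \<and>
    (\<forall>(n::nat) t. 0 \<le> t 0 \<and> (\<forall>i<n. t i < t (Suc i)) \<longrightarrow>
       prob_space.indep_vars M (\<lambda>_. borel) (\<lambda>i \<omega>. B (t (Suc i)) \<omega> - B (t i) \<omega>) {..<n}) \<and>
    (\<forall>s t. 0 \<le> s \<and> s < t \<longrightarrow>
       distributed M lborel (\<lambda>\<omega>. B t \<omega> - B s \<omega>) (normal_density 0 (sqrt (t - s)))) \<and>
    ae_continuous M B"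

text \<open>
  The natural filtration augmented by all null sets. The result carries only a sigma-algebra:
  its measure is the dummy one of \<^const>\<open>sigma\<close>, and probabilities are always taken under \<open>M\<close>.
\<close>

definition natural_filtration :: "'w measure \<Rightarrow> (real \<Rightarrow> 'w \<Rightarrow> real) \<Rightarrow> real \<Rightarrow> 'w measure"
  where "natural_filtration M X t =
    sigma (space M) ({X s -` A \<inter> space M | s A. 0 \<le> s \<and> s \<le> t \<and> A \<in> sets borel} \<union> null_sets M)"

definition adapted :: "(real \<Rightarrow> 'w measure) \<Rightarrow> (real \<Rightarrow> 'w \<Rightarrow> real) \<Rightarrow> bool"
  where "adapted F X \<longleftrightarrow> (\<forall>t\<ge>0. X t \<in> borel_measurable (F t))"

definition martingale :: "'w measure \<Rightarrow> (real \<Rightarrow> 'w measure) \<Rightarrow> (real \<Rightarrow> 'w \<Rightarrow> real) \<Rightarrow> bool"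
  where "martingale M F X \<longleftrightarrow>
    filtration (space M) F \<and> (\<forall>t. subalgebra M (F t)) \<and>
    adapted F X \<and> (\<forall>t\<ge>0. integrable M (X t)) \<and>
    (\<forall>s t. 0 \<le> s \<and> s \<le> t \<longrightarrow> (AE \<omega> in M. real_cond_exp M (F s) (X t) \<omega> = X s \<omega>))"

text \<open>
  Real-valued localizing times lose no generality: an extended-valued localizing sequence
  \<open>\<tau>\<close> may be replaced by \<open>min (\<tau> n) n\<close>.
\<close>

definition local_martingale :: "'w measure \<Rightarrow> (real \<Rightarrow> 'w measure) \<Rightarrow> (real \<Rightarrow> 'w \<Rightarrow> real) \<Rightarrow> bool"
  where "local_martingale M F X \<longleftrightarrow>
    adapted F X \<and>
    (\<exists>\<tau> :: nat \<Rightarrow> 'w \<Rightarrow> real.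
       (\<forall>n. stopping_time F (\<tau> n) \<and> (\<forall>\<omega>\<in>space M. 0 \<le> \<tau> n \<omega>)) \<and>
       (AE \<omega> in M. incseq (\<lambda>n. \<tau> n \<omega>) \<and> filterlim (\<lambda>n. \<tau> n \<omega>) at_top sequentially) \<and>
       (\<forall>n. martingale M F (\<lambda>t \<omega>. X (min t (\<tau> n \<omega>)) \<omega> - X 0 \<omega>)))"

definition bounded_variation_upto :: "(real \<Rightarrow> real) \<Rightarrow> real \<Rightarrow> bool"
  where "bounded_variation_upto f T \<longleftrightarrow>
    (\<exists>C. \<forall>(n::nat) t. 0 \<le> t 0 \<and> (\<forall>i<n. t i \<le> t (Suc i)) \<and> t n \<le> T \<longrightarrow>
       (\<Sum>i<n. \<bar>f (t (Suc i)) - f (t i)\<bar>) \<le> C)"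

definition finite_variation_process ::
    "'w measure \<Rightarrow> (real \<Rightarrow> 'w measure) \<Rightarrow> (real \<Rightarrow> 'w \<Rightarrow> real) \<Rightarrow> bool"
  where "finite_variation_process M F A \<longleftrightarrow>
    adapted F A \<and> ae_cadlag M A \<and> (AE \<omega> in M. \<forall>T\<ge>0. bounded_variation_upto (\<lambda>t. A t \<omega>) T)"

definition semimartingale :: "'w measure \<Rightarrow> (real \<Rightarrow> 'w measure) \<Rightarrow> (real \<Rightarrow> 'w \<Rightarrow> real) \<Rightarrow> bool"
  where "semimartingale M F X \<longleftrightarrow>
    adapted F X \<and>
    (\<exists>N A. local_martingale M F N \<and> ae_cadlag M N \<and> finite_variation_process M F A \<and>
       (AE \<omega> in M. \<forall>t\<ge>0. X t \<omega> = N t \<omega> + A t \<omega>))"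

text \<open>
  \<open>A\<close> is (a version of) the angle bracket of the continuous local martingale \<open>X\<close>: the process,
  unique up to indistinguishability, that is continuous, nondecreasing, null at \<open>0\<close>, adapted,
  and compensates \<open>X\<^sup>2\<close>.
\<close>

definition quadratic_variation ::
    "'w measure \<Rightarrow> (real \<Rightarrow> 'w measure) \<Rightarrow> (real \<Rightarrow> 'w \<Rightarrow> real) \<Rightarrow> (real \<Rightarrow> 'w \<Rightarrow> real) \<Rightarrow> bool"
  where "quadratic_variation M F X A \<longleftrightarrow>
    local_martingale M F X \<and> ae_continuous M X \<and>
    adapted F A \<and> ae_continuous M A \<and>
    (AE \<omega> in M. A 0 \<omega> = 0 \<and> mono_on {0..} (\<lambda>t. A t \<omega>)) \<and>
    local_martingale M F (\<lambda>t \<omega>. (X t \<omega>)\<^sup>2 - A t \<omega>)"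

text \<open>The time \<open>t \<and> \<sigma>\<close>, for a random time with values in \<open>[0,\<infinity>]\<close>.\<close>

definition stop_at :: "real \<Rightarrow> ennreal \<Rightarrow> real"
  where "stop_at t \<sigma> = enn2real (min (ennreal t) \<sigma>)"

definition stopped_brownian_motion ::
    "'w measure \<Rightarrow> (real \<Rightarrow> 'w measure) \<Rightarrow> ('w \<Rightarrow> ennreal) \<Rightarrow> (real \<Rightarrow> 'w \<Rightarrow> real) \<Rightarrow> bool"
  where "stopped_brownian_motion M F \<sigma> b \<longleftrightarrow>
    martingale M F b \<and> ae_continuous M b \<and> (AE \<omega> in M. b 0 \<omega> = 0) \<and>
    quadratic_variation M F b (\<lambda>t \<omega>. stop_at t (\<sigma> \<omega>))"

definition drifted :: "(real \<Rightarrow> 'w \<Rightarrow> real) \<Rightarrow> real \<Rightarrow> real \<Rightarrow> 'w \<Rightarrow> real"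
  where "drifted B lam t \<omega> = B t \<omega> + lam * t"

text \<open>
  Last passage time at level \<open>z\<close>. With values in \<^typ>\<open>ennreal\<close> it is \<open>0\<close> if the level is never
  attained and \<open>\<infinity>\<close> if it is attained at arbitrarily large times.
\<close>

definition last_passage :: "(real \<Rightarrow> 'w \<Rightarrow> real) \<Rightarrow> real \<Rightarrow> 'w \<Rightarrow> ennreal"
  where "last_passage X z \<omega> = (SUP t\<in>{t. 0 < t \<and> X t \<omega> = z}. ennreal t)"

definition stopped_at_last_passage :: "(real \<Rightarrow> 'w \<Rightarrow> real) \<Rightarrow> real \<Rightarrow> real \<Rightarrow> 'w \<Rightarrow> real"
  where "stopped_at_last_passage X z t \<omega> = X (stop_at t (last_passage X z \<omega>)) \<omega>"

end

theory Submission
  imports Defs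
begin

text \<open>
  Write \<open>X\<close> for the Brownian motion with drift. Given the past of \<open>X\<close> up to time \<open>u\<close>, the level
  \<open>z\<close> is visited after \<open>u\<close> with probability \<open>h (X u)\<close>, where \<open>h x = min 1 (exp (-2 lam (x - z)))\<close>;
  this is optional stopping of the exponential martingale on finite time grids. Hence, for
  suitable \<open>k\<close>, the conditional expectation of \<open>k (X t)\<close> on the event \<open>\<sigma> > t\<close> is that of
  \<open>(k h) (X t)\<close>. For \<open>k x = x - z\<close> and \<open>k x = (x - z)\<^sup>2\<close> the product \<open>k h\<close> is continuously
  differentiable across \<open>z\<close>, and applying the generator \<open>f''/2 + lam f'\<close> of \<open>X\<close> to it gives
  \<open>lam sgn (z - x) h x\<close> and \<open>(1 - 2 lam \<bar>x - z\<bar>) h x\<close>. Dynkin's formula therefore produces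
  two martingales: the compensated \<open>\<xi>\<close> itself, and a compensated square. On \<open>\<sigma> > s\<close> the
  filtrations of \<open>\<xi>\<close> and \<open>X\<close> have the same trace up to time \<open>s\<close>, and nothing moves
  on \<open>\<sigma> \<le> s\<close>, so both are martingales of the filtration of \<open>\<xi>\<close>. Integration by parts with the
  absolutely continuous drift turns the second one into the square of the first minus \<open>t \<and> \<sigma>\<close>.
\<close>

section \<open>Gaussian integrals\<close>

text \<open>The shift by \<open>z\<close> avoids this: \<open>\<xi> - z\<close> is
  \<open>X - z\<close> times the indicator of \<open>\<sigma> > t\<close>, so only fixed times and
  the function \<open>h\<close> enter. Above \<open>z\<close> the function \<open>h\<close> is
  harmonic for the generator of \<open>X\<close>, and applying the generator to \<open>k h\<close>
  gives \<open>h (k''/2 + lam k' + (h'/h) k')\<close> with \<open>h'/h = -2 lam\<close>. The drift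
  thus turns from \<open>lam\<close> into \<open>-lam\<close> above \<open>z\<close>, as in a Doob
  h-transform. For the square the same rule produces \<open>1 + 2 (x - z) lam sgn (z - x)\<close>,
  which explains the second integrand. By itself \<open>h\<close> has a kink at \<open>z\<close>
  that would bring in local time; a factor \<open>k\<close> vanishing at \<open>z\<close> leaves at
  most a jump of the second derivative. Stochastic integrals are avoided throughout: Dynkin's
  formula comes from Gaussian integrals, and the mixed term of the square is a pathwise time
  integral.\<close>

abbreviation "\<N> \<equiv> std_normal_distribution"

lemma prob_space_std_normal: "prob_space \<N>"
  by (rule prob_space_normal_density) simp

lemma integrable_std_normal_quadratic:
  fixes f :: "real \<Rightarrow> real"
  assumes [measurable]: "f \<in> borel_measurable borel" and "\<And>y. \<bar>f y\<bar> \<le> a + b * y\<^sup>2"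
  shows "integrable \<N> f"
proof (rule Bochner_Integration.integrable_bound)
  interpret prob_space \<N> by (rule prob_space_std_normal)
  show "integrable \<N> (\<lambda>y. a + b * y\<^sup>2)"
    using integrable_std_normal_distribution_moment[of 2] by simp
  show "AE y in \<N>. norm (f y) \<le> norm (a + b * y\<^sup>2)"
    using assms(2) by (auto intro!: AE_I2 order_trans[OF _ abs_ge_self])
qed simp

lemma abs_le_1_plus_square: "\<bar>y\<bar> \<le> 1 + (y :: real)\<^sup>2"
proof -
  have "0 \<le> (\<bar>y\<bar> - 1)\<^sup>2" by simp
  then have "2 * \<bar>y\<bar> \<le> 1 + y\<^sup>2" by (simp add: power2_eq_square algebra_simps)
  then show ?thesis by simp
qed

lemma integrable_std_normal_linear:
  fixes f :: "real \<Rightarrow> real"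
  assumes "f \<in> borel_measurable borel" and f: "\<And>y. \<bar>f y\<bar> \<le> a + b * \<bar>y\<bar>"
  shows "integrable \<N> f"
proof (rule integrable_std_normal_quadratic[OF assms(1)])
  fix y :: real
  have "\<bar>y\<bar> \<le> 1 + y\<^sup>2" by (rule abs_le_1_plus_square)
  then have "b * \<bar>y\<bar> \<le> \<bar>b\<bar> * (1 + y\<^sup>2)"
    by (meson abs_ge_self abs_ge_zero mult_mono' mult_left_mono mult_right_mono order_trans)
  with f[of y] show "\<bar>f y\<bar> \<le> (a + \<bar>b\<bar>) + \<bar>b\<bar> * y\<^sup>2" by (simp add: algebra_simps)
qed

lemma DERIV_std_normal_density:
  "(std_normal_density has_real_derivative - y * std_normal_density y) (at y)"
  unfolding std_normal_density_def
  by (auto intro!: derivative_eq_intros simp: field_simps power2_eq_square)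

text \<open>From \<open>1 + x \<le> exp x\<close>. This crude rational bound suffices: multiplied by
  a function of linear growth it still decays like \<open>1 / \<bar>y\<bar>\<close>, which kills the
  boundary terms of the integration by parts.\<close>

lemma std_normal_density_le: "std_normal_density y \<le> 1 / (1 + y\<^sup>2 / 2)"
proof -
  have "exp (- y\<^sup>2 / 2) \<le> 1 / (1 + y\<^sup>2 / 2)"
    using exp_ge_add_one_self[of "y\<^sup>2 / 2"]
    by (simp add: exp_minus field_simps add_pos_nonneg)
  moreover have "1 / sqrt (2 * pi) \<le> 1"
    using pi_gt3 by simp
  ultimately have "1 / sqrt (2 * pi) * exp (- y\<^sup>2 / 2) \<le> 1 * (1 / (1 + y\<^sup>2 / 2))"
    by (intro mult_mono) auto
  then show ?thesis by (simp add: std_normal_density_def)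
qed

text \<open>Stein's identity. The derivative of \<open>std_normal_density y * f y\<close> is
  \<open>std_normal_density y * (f' y - y * f y)\<close>, and the boundary terms over
  \<open>{- k..k}\<close> tend to 0. The exceptional set \<open>S\<close> admits functions whose
  derivative jumps, as \<open>g'\<close> does in Dynkin's formula.\<close>

lemma std_normal_integration_by_parts:
  fixes f f' :: "real \<Rightarrow> real"
  assumes S: "finite S" and f: "continuous_on UNIV f"
    and f': "\<And>y. y \<notin> S \<Longrightarrow> (f has_real_derivative f' y) (at y)"
    and [measurable]: "f' \<in> borel_measurable borel"
    and f'_bound: "\<And>y. \<bar>f' y\<bar> \<le> K" and f_bound: "\<And>y. \<bar>f y\<bar> \<le> a + b * \<bar>y\<bar>"
  shows "(\<integral>y. y * f y \<partial>\<N>) = (\<integral>y. f' y \<partial>\<N>)"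
proof -
  have [measurable]: "f \<in> borel_measurable borel"
    using f by (rule borel_measurable_continuous_onI)
  define b' where "b' = \<bar>a\<bar> + \<bar>b\<bar>"
  have b': "\<bar>f y\<bar> \<le> b' * (1 + \<bar>y\<bar>)" for y
  proof -
    have "a \<le> \<bar>a\<bar>" "b * \<bar>y\<bar> \<le> \<bar>b\<bar> * \<bar>y\<bar>" "0 \<le> \<bar>a\<bar> * \<bar>y\<bar>" by (auto intro: mult_right_mono)
    moreover have "0 \<le> \<bar>b\<bar>" by simp
    moreover have "b' * (1 + \<bar>y\<bar>) = \<bar>a\<bar> + \<bar>b\<bar> + \<bar>a\<bar> * \<bar>y\<bar> + \<bar>b\<bar> * \<bar>y\<bar>"
      by (simp add: b'_def algebra_simps)
    ultimately show ?thesis using f_bound[of y] by linarith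
  qed
  have b'_nn: "0 \<le> b'" by (simp add: b'_def)
  have int1: "integrable \<N> f'"
    by (rule integrable_std_normal_linear[where a = K and b = 0]) (use f'_bound in auto)
  have int2: "integrable \<N> (\<lambda>y. y * f y)"
  proof (rule integrable_std_normal_quadratic)
    fix y :: real
    have *: "\<bar>y\<bar> \<le> 1 + y\<^sup>2" by (rule abs_le_1_plus_square)
    have "\<bar>y * f y\<bar> \<le> \<bar>y\<bar> * (b' * (1 + \<bar>y\<bar>))"
      unfolding abs_mult using b' by (intro mult_left_mono) auto
    also have "\<dots> = b' * (\<bar>y\<bar> + y\<^sup>2)" by (simp add: algebra_simps power2_eq_square)
    also have "\<dots> \<le> b' * (1 + y\<^sup>2 + y\<^sup>2)" using * b'_nn by (intro mult_left_mono) auto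
    finally show "\<bar>y * f y\<bar> \<le> b' + (2 * b') * y\<^sup>2" by (simp add: algebra_simps)
  qed simp
  define G where "G y = std_normal_density y * (f' y - y * f y)" for y
  have G: "integrable lborel G"
    using Bochner_Integration.integrable_diff[OF int1 int2] by (simp add: integrable_density G_def[abs_def])
  define F where "F y = std_normal_density y * f y" for y
  have Ik: "(\<integral>y. indicator {- real k..real k} y *\<^sub>R G y \<partial>lborel) = F (real k) - F (- real k)" for k
  proof -
    have "(G has_integral (F (real k) - F (- real k))) {- real k..real k}"
    proof (rule fundamental_theorem_of_calculus_interior_strong[OF S])
      fix y assume "y \<in> {- real k<..<real k} - S"
      then have "(f has_real_derivative f' y) (at y)" by (auto intro: f')
      then have "(F has_real_derivative G y) (at y)"
        unfolding F_def
        by (rule DERIV_cong[OF DERIV_mult[OF DERIV_std_normal_density]])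
           (simp add: G_def algebra_simps)
      then show "(F has_vector_derivative G y) (at y)"
        by (simp add: has_real_derivative_iff_has_vector_derivative)
    next
      show "continuous_on {- real k..real k} F"
        unfolding F_def[abs_def]
        by (intro continuous_on_mult continuous_on_subset[OF f] continuous_at_imp_continuous_on)
           (auto intro: DERIV_isCont[OF DERIV_std_normal_density])
    qed simp
    moreover have "set_integrable lborel {- real k..real k} G"
      unfolding set_integrable_def using G by (intro integrable_mult_indicator) auto
    ultimately show ?thesis
      using set_borel_integral_eq_integral(2)[of "{- real k..real k}" G]
      by (simp add: integral_unique set_lebesgue_integral_def)
  qed
  have "(\<lambda>k. \<integral>y. indicator {- real k..real k} y *\<^sub>R G y \<partial>lborel) \<longlonglongrightarrow> (\<integral>y. G y \<partial>lborel)"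
  proof (rule integral_dominated_convergence[where w = "\<lambda>y. norm (G y)"])
    show "AE y in lborel. (\<lambda>k. indicator {- real k..real k} y *\<^sub>R G y) \<longlonglongrightarrow> G y"
    proof (rule AE_I2)
      fix y :: real
      have "eventually (\<lambda>k. indicator {- real k..real k} y *\<^sub>R G y = G y) sequentially"
        using eventually_ge_at_top[of "nat \<lceil>\<bar>y\<bar>\<rceil>"]
      proof eventually_elim
        case (elim k)
        then have "\<bar>y\<bar> \<le> real k" by linarith
        then show ?case by (auto simp: indicator_def abs_le_iff)
      qed
      then show "(\<lambda>k. indicator {- real k..real k} y *\<^sub>R G y) \<longlonglongrightarrow> G y"
        by (rule tendsto_eventually)
    qed
  qed (use G in \<open>auto simp: indicator_def intro!: AE_I2 borel_measurable_integrable\<close>)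
  moreover have "(\<lambda>k. \<integral>y. indicator {- real k..real k} y *\<^sub>R G y \<partial>lborel) \<longlonglongrightarrow> 0"
    unfolding Ik
  proof (rule Lim_null_comparison)
    \<comment> \<open>For \<open>1 \<le> \<bar>y\<bar>\<close> one has
      \<open>\<bar>y\<bar> \<le> y\<^sup>2\<close>, so
      \<open>(1 + \<bar>y\<bar>) * \<bar>y\<bar> \<le> 2 * y\<^sup>2\<close>. This gives the 4; the
      two endpoints make it the 8 below.\<close>
    have F: "\<bar>F y\<bar> \<le> 4 * b' / \<bar>y\<bar>" if y: "1 \<le> \<bar>y\<bar>" for y
    proof -
      have "\<bar>F y\<bar> \<le> 1 / (1 + y\<^sup>2 / 2) * (b' * (1 + \<bar>y\<bar>))"
        unfolding F_def abs_mult using std_normal_density_le[of y] b'[of y]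
        by (intro mult_mono) auto
      also have "\<dots> = b' * ((1 + \<bar>y\<bar>) / (1 + y\<^sup>2 / 2))" by simp
      also have "(1 + \<bar>y\<bar>) / (1 + y\<^sup>2 / 2) \<le> 4 / \<bar>y\<bar>"
      proof -
        have "\<bar>y\<bar> * 1 \<le> \<bar>y\<bar> * \<bar>y\<bar>" using y by (intro mult_left_mono) auto
        then have "\<bar>y\<bar> \<le> y\<^sup>2" by (simp add: power2_eq_square)
        then have "(1 + \<bar>y\<bar>) * \<bar>y\<bar> \<le> 4 * (1 + y\<^sup>2 / 2)" by (simp add: algebra_simps power2_eq_square)
        moreover have "0 < 1 + y\<^sup>2 / 2" by (intro add_pos_nonneg) auto
        ultimately show ?thesis using y by (auto simp: divide_simps algebra_simps)
      qed
      finally have "\<bar>F y\<bar> \<le> b' * (4 / \<bar>y\<bar>)" using b'_nn by (simp add: mult_left_mono)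
      then show ?thesis by (simp add: mult.commute)
    qed
    show "eventually (\<lambda>k. norm (F (real k) - F (- real k)) \<le> 8 * b' / real k) sequentially"
      using eventually_ge_at_top[of 1]
    proof eventually_elim
      case (elim k)
      then show ?case using F[of "real k"] F[of "- real k"] by simp
    qed
    show "(\<lambda>k. 8 * b' / real k) \<longlonglongrightarrow> 0"
      by (rule lim_const_over_n)
  qed
  ultimately have "(\<integral>y. G y \<partial>lborel) = 0"
    by (rule LIMSEQ_unique)
  then have "(\<integral>y. f' y - y * f y \<partial>\<N>) = 0"
    by (simp add: integral_density G_def[abs_def])
  then show ?thesis using int1 int2 by simp
qed

section \<open>Dynkin's formula for Gaussian averages\<close>

lemma (in pair_sigma_finite) integrable_product:
  fixes f :: "'a \<Rightarrow> real" and g :: "'b \<Rightarrow> real"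
  assumes f: "integrable M1 f" and g: "integrable M2 g"
  shows "integrable (M1 \<Otimes>\<^sub>M M2) (\<lambda>(x, y). f x * g y)"
proof (rule Fubini_integrable)
  have [measurable]: "f \<in> borel_measurable M1" "g \<in> borel_measurable M2" using f g by auto
  show "(\<lambda>(x, y). f x * g y) \<in> borel_measurable (M1 \<Otimes>\<^sub>M M2)" by measurable
  show "integrable M1 (\<lambda>x. \<integral>y. norm (case (x, y) of (x, y) \<Rightarrow> f x * g y) \<partial>M2)"
    using f by (simp add: abs_mult)
  show "AE x in M1. integrable M2 (\<lambda>y. case (x, y) of (x, y) \<Rightarrow> f x * g y)"
    using g by simp
qed

text \<open>The singularity at 0 is harmless because the antiderivative \<open>sqrt\<close> is
  continuous up to 0. This is the factor left behind by differentiating \<open>sqrt u * y\<close> in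
  \<open>u\<close>.\<close>

lemma integrable_inverse_sqrt:
  assumes "0 \<le> t"
  shows "integrable lborel (\<lambda>u. indicator {0..t} u * (1 / (2 * sqrt u)))"
proof (rule integrableI_nonneg)
  have "((\<lambda>u. 1 / (2 * sqrt u)) has_integral (sqrt t - sqrt 0)) {0..t}"
    using assms
    by (intro fundamental_theorem_of_calculus_interior)
       (auto intro!: continuous_intros derivative_eq_intros
          simp: has_real_derivative_iff_has_vector_derivative[symmetric] field_simps)
  then have "((\<lambda>u. indicator {0..t} u * (1 / (2 * sqrt u))) has_integral sqrt t) UNIV"
  proof -
    have "(\<lambda>u. indicator {0..t} u * (1 / (2 * sqrt u))) = (\<lambda>u. if u \<in> {0..t} then 1 / (2 * sqrt u) else 0)"
      by (auto simp: fun_eq_iff)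
    then show "((\<lambda>u. 1 / (2 * sqrt u)) has_integral (sqrt t - sqrt 0)) {0..t} \<Longrightarrow> ?thesis"
      by (simp only: has_integral_restrict_UNIV) simp
  qed
  then have "(\<integral>\<^sup>+u. ennreal (indicator {0..t} u * (1 / (2 * sqrt u))) \<partial>lborel) = sqrt t"
    by (intro nn_integral_has_integral_lborel) (auto simp: indicator_def)
  then show "(\<integral>\<^sup>+u. ennreal (indicator {0..t} u * (1 / (2 * sqrt u))) \<partial>lborel) < \<infinity>"
    by simp
qed (auto intro!: AE_I2 simp: indicator_def)

text \<open>For fixed \<open>y\<close> this is the fundamental theorem of calculus in \<open>u\<close>; Gaussian integration by
  parts then absorbs the singular factor \<open>y / (2 * sqrt u)\<close> into a second derivative.\<close>

theorem dynkin_gaussian: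
  fixes g g' g'' :: "real \<Rightarrow> real" and lam t x z :: real
  assumes g: "\<And>w. (g has_real_derivative g' w) (at w)" and g'_cont: "continuous_on UNIV g'"
    and g': "\<And>w. w \<noteq> z \<Longrightarrow> (g' has_real_derivative g'' w) (at w)"
    and g''_meas[measurable]: "g'' \<in> borel_measurable borel" and g''_bound: "\<And>w. \<bar>g'' w\<bar> \<le> K"
    and g'_bound: "\<And>w. \<bar>g' w\<bar> \<le> a + b * \<bar>w\<bar>" and t: "0 \<le> t"
  shows "integrable \<N> (\<lambda>y. g (x + lam * t + sqrt t * y))"
    and "(\<integral>y. g (x + lam * t + sqrt t * y) \<partial>\<N>) = g x +
      (\<integral>u. indicator {0..t} u *
        (\<integral>y. g'' (x + lam * u + sqrt u * y) / 2 + lam * g' (x + lam * u + sqrt u * y) \<partial>\<N>) \<partial>lborel)"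
proof -
  interpret N: prob_space \<N> by (rule prob_space_std_normal)
  interpret pair_sigma_finite \<N> lborel ..
  define \<psi> where "\<psi> u y = x + lam * u + sqrt u * y" for u y :: real
  have [measurable]: "g' \<in> borel_measurable borel"
    using g'_cont by (rule borel_measurable_continuous_onI)
  have [measurable]: "case_prod \<psi> \<in> borel_measurable (borel \<Otimes>\<^sub>M borel)"
    unfolding \<psi>_def[abs_def] by measurable
  have g_cont: "continuous_on UNIV g"
    by (intro continuous_at_imp_continuous_on ballI DERIV_isCont[OF g])
  \<comment> \<open>For \<open>0 < u < t\<close> this is the derivative of
    \<open>g (\<psi> u y)\<close> in \<open>u\<close>. At \<open>u = 0\<close> division by zero
    drops the singular term, on a null set.\<close>
  define H where "H y u = indicator {0..t} u * (g' (\<psi> u y) * (lam + y / (2 * sqrt u)))" for y u :: real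
  \<comment> \<open>\<open>b0 + b1 * \<bar>y\<bar>\<close> will bound \<open>g' (\<psi> u y)\<close>
    for all \<open>u\<close> in \<open>{0..t}\<close> at once: insert
    \<open>\<bar>x\<bar> + \<bar>lam\<bar> * t + sqrt t * \<bar>y\<bar>\<close> for
    \<open>\<bar>\<psi> u y\<bar>\<close> in the linear bound on \<open>g'\<close>.\<close>
  define b0 where "b0 = \<bar>a\<bar> + \<bar>b\<bar> * (\<bar>x\<bar> + \<bar>lam\<bar> * t)"
  define b1 where "b1 = \<bar>b\<bar> * sqrt t"
  have b01: "0 \<le> b0" "0 \<le> b1" using t by (auto simp: b0_def b1_def)
  have g'_le: "\<bar>g' (\<psi> u y)\<bar> \<le> b0 + b1 * \<bar>y\<bar>" if u: "0 \<le> u" "u \<le> t" for u y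
  proof -
    have "\<bar>\<psi> u y\<bar> \<le> \<bar>x\<bar> + \<bar>lam\<bar> * u + sqrt u * \<bar>y\<bar>"
      unfolding \<psi>_def using u abs_triangle_ineq[of "x + lam * u" "sqrt u * y"] abs_triangle_ineq[of x "lam * u"]
      by (simp add: abs_mult)
    also have "\<dots> \<le> \<bar>x\<bar> + \<bar>lam\<bar> * t + sqrt t * \<bar>y\<bar>"
      using u by (intro add_mono mult_mono) auto
    finally have 1: "\<bar>\<psi> u y\<bar> \<le> \<bar>x\<bar> + \<bar>lam\<bar> * t + sqrt t * \<bar>y\<bar>" .
    have "\<bar>g' (\<psi> u y)\<bar> \<le> \<bar>a\<bar> + \<bar>b\<bar> * \<bar>\<psi> u y\<bar>"
      by (rule order_trans[OF g'_bound]) (auto intro!: add_mono mult_right_mono)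
    also have "\<dots> \<le> \<bar>a\<bar> + \<bar>b\<bar> * (\<bar>x\<bar> + \<bar>lam\<bar> * t + sqrt t * \<bar>y\<bar>)"
      using 1 by (intro add_mono mult_left_mono) auto
    finally show ?thesis by (simp add: b0_def b1_def algebra_simps)
  qed
  define q where "q u = indicator {0..t} u * (1 / (2 * sqrt u))" for u :: real
  have q: "integrable lborel q" unfolding q_def[abs_def] by (rule integrable_inverse_sqrt[OF t])
  have ind: "integrable lborel (indicator {0..t} :: real \<Rightarrow> real)"
    by (rule integrable_real_indicator) (use t in auto)
  have c1: "integrable \<N> (\<lambda>y. (b0 + b1 * \<bar>y\<bar>) * \<bar>lam\<bar>)"
    by (rule integrable_std_normal_linear[where a = "b0 * \<bar>lam\<bar>" and b = "b1 * \<bar>lam\<bar>"])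
       (use b01 in \<open>auto simp: abs_mult algebra_simps\<close>)
  have c2: "integrable \<N> (\<lambda>y. (b0 + b1 * \<bar>y\<bar>) * \<bar>y\<bar>)"
  proof (rule integrable_std_normal_quadratic[where a = b0 and b = "b0 + b1"])
    fix y :: real
    have "\<bar>y\<bar> \<le> 1 + y\<^sup>2" by (rule abs_le_1_plus_square)
    then have "b0 * \<bar>y\<bar> \<le> b0 * (1 + y\<^sup>2)" using b01 by (intro mult_left_mono) auto
    then show "\<bar>(b0 + b1 * \<bar>y\<bar>) * \<bar>y\<bar>\<bar> \<le> b0 + (b0 + b1) * y\<^sup>2"
      using b01 by (simp add: abs_mult algebra_simps power2_eq_square)
  qed simp
  \<comment> \<open>Each summand is a function of \<open>y\<close> times a function of
    \<open>u\<close>, the form covered by \<open>integrable_product\<close>; this yields the joint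
    integrability required for Fubini.\<close>
  have H_bound: "\<bar>H y u\<bar> \<le> (b0 + b1 * \<bar>y\<bar>) * \<bar>lam\<bar> * indicator {0..t} u + (b0 + b1 * \<bar>y\<bar>) * \<bar>y\<bar> * q u"
    for y u
  proof (cases "u \<in> {0..t}")
    case True
    then have "\<bar>H y u\<bar> = \<bar>g' (\<psi> u y)\<bar> * \<bar>lam + y / (2 * sqrt u)\<bar>"
      by (simp add: H_def abs_mult)
    also have "\<dots> \<le> (b0 + b1 * \<bar>y\<bar>) * (\<bar>lam\<bar> + \<bar>y\<bar> * q u)"
      using True b01
      by (intro mult_mono g'_le order_trans[OF abs_triangle_ineq]) (auto simp: q_def abs_mult)
    also have "\<dots> = (b0 + b1 * \<bar>y\<bar>) * \<bar>lam\<bar> * 1 + (b0 + b1 * \<bar>y\<bar>) * \<bar>y\<bar> * q u"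
      by (simp only: distrib_left mult.assoc mult_1_right)
    finally show ?thesis using True by simp
  qed (simp add: H_def q_def)
  have [measurable]: "case_prod H \<in> borel_measurable (borel \<Otimes>\<^sub>M borel)"
    unfolding H_def[abs_def] by measurable
  have H_int: "integrable (\<N> \<Otimes>\<^sub>M lborel) (case_prod H)"
  proof (rule Bochner_Integration.integrable_bound)
    show "integrable (\<N> \<Otimes>\<^sub>M lborel) (\<lambda>p. (case p of (y, u) \<Rightarrow> (b0 + b1 * \<bar>y\<bar>) * \<bar>lam\<bar> * indicator {0..t} u)
      + (case p of (y, u) \<Rightarrow> (b0 + b1 * \<bar>y\<bar>) * \<bar>y\<bar> * q u))"
      by (intro Bochner_Integration.integrable_add integrable_product[OF c1 ind] integrable_product[OF c2 q])
    show "AE p in \<N> \<Otimes>\<^sub>M lborel. norm (case_prod H p) \<le> norm ((case p of (y, u) \<Rightarrow> (b0 + b1 * \<bar>y\<bar>) * \<bar>lam\<bar> * indicator {0..t} u)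
      + (case p of (y, u) \<Rightarrow> (b0 + b1 * \<bar>y\<bar>) * \<bar>y\<bar> * q u))"
      using H_bound by (auto intro!: AE_I2 order_trans[OF _ abs_ge_self])
  qed measurable
  have path: "(\<integral>u. H y u \<partial>lborel) = g (\<psi> t y) - g x" for y
  proof -
    have "set_integrable lborel {0..t} (\<lambda>u. g' (\<psi> u y) * (lam + y / (2 * sqrt u)))"
      unfolding set_integrable_def
    proof (rule Bochner_Integration.integrable_bound)
      show "integrable lborel (\<lambda>u. (b0 + b1 * \<bar>y\<bar>) * \<bar>lam\<bar> * indicator {0..t} u + (b0 + b1 * \<bar>y\<bar>) * \<bar>y\<bar> * q u)"
        using ind q by (intro Bochner_Integration.integrable_add integrable_mult_right)
      show "AE u in lborel. norm (indicat_real {0..t} u *\<^sub>R (g' (\<psi> u y) * (lam + y / (2 * sqrt u))))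
          \<le> norm ((b0 + b1 * \<bar>y\<bar>) * \<bar>lam\<bar> * indicator {0..t} u + (b0 + b1 * \<bar>y\<bar>) * \<bar>y\<bar> * q u)"
        using H_bound[of y] by (auto intro!: AE_I2 order_trans[OF _ abs_ge_self] simp: H_def)
    qed (simp add: \<psi>_def)
    then have "(\<integral>u. H y u \<partial>lborel) = integral {0..t} (\<lambda>u. g' (\<psi> u y) * (lam + y / (2 * sqrt u)))"
      by (subst set_borel_integral_eq_integral(2)[symmetric]) (simp_all add: set_lebesgue_integral_def H_def[abs_def])
    also have "\<dots> = g (\<psi> t y) - g (\<psi> 0 y)"
    proof (intro integral_unique fundamental_theorem_of_calculus_interior t)
      show "continuous_on {0..t} (\<lambda>u. g (\<psi> u y))"
        unfolding \<psi>_def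
        by (intro continuous_on_compose2[OF g_cont] continuous_intros) auto
      fix u assume u: "u \<in> {0<..<t}"
      have "((\<lambda>u. \<psi> u y) has_real_derivative lam + y / (2 * sqrt u)) (at u)"
        unfolding \<psi>_def using u by (auto intro!: derivative_eq_intros simp: field_simps)
      from DERIV_chain2[OF g this]
      show "((\<lambda>u. g (\<psi> u y)) has_vector_derivative g' (\<psi> u y) * (lam + y / (2 * sqrt u))) (at u)"
        by (simp add: has_real_derivative_iff_has_vector_derivative)
    qed
    finally show ?thesis by (simp add: \<psi>_def)
  qed
  have "integrable \<N> (\<lambda>y. (\<integral>u. H y u \<partial>lborel))"
    using integrable_fst'[OF H_int] by simp
  then have "integrable \<N> (\<lambda>y. (g (\<psi> t y) - g x) + g x)"
    unfolding path by (rule Bochner_Integration.integrable_add) simp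
  then have int_g: "integrable \<N> (\<lambda>y. g (\<psi> t y))" by simp
  then show "integrable \<N> (\<lambda>y. g (x + lam * t + sqrt t * y))" by (simp add: \<psi>_def)
  \<comment> \<open>The computation divides by \<open>sqrt u\<close>; the omitted time 0 is a null
    set.\<close>
  have inner: "(\<integral>y. H y u \<partial>\<N>) = indicator {0..t} u * (\<integral>y. g'' (\<psi> u y) / 2 + lam * g' (\<psi> u y) \<partial>\<N>)"
    if "u \<noteq> 0" for u
  proof (cases "u \<in> {0..t}")
    case True
    with that have u: "0 < u" "u \<le> t" by auto
    have int1: "integrable \<N> (\<lambda>y. g' (\<psi> u y))"
      by (rule integrable_std_normal_linear[OF _ g'_le]) (use u in auto)
    have int2: "integrable \<N> (\<lambda>y. y * g' (\<psi> u y))"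
    proof (rule Bochner_Integration.integrable_bound[OF c2])
      show "AE y in \<N>. norm (y * g' (\<psi> u y)) \<le> norm ((b0 + b1 * \<bar>y\<bar>) * \<bar>y\<bar>)"
        using u b01
        by (auto intro!: AE_I2 mult_right_mono order_trans[OF g'_le] simp: abs_mult mult.commute[of "\<bar>_\<bar>" "\<bar>g' _\<bar>"])
    qed simp
    have int3: "integrable \<N> (\<lambda>y. g'' (\<psi> u y))"
      by (rule integrable_std_normal_linear[where a = K and b = 0]) (use g''_bound in auto)
    have "(\<integral>y. y * g' (\<psi> u y) \<partial>\<N>) = (\<integral>y. sqrt u * g'' (\<psi> u y) \<partial>\<N>)"
    \<comment> \<open>The exceptional point solves \<open>\<psi> u y = z\<close>; there
      \<open>g'\<close> may fail to be differentiable.\<close>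
    proof (rule std_normal_integration_by_parts[where S = "{(z - x - lam * u) / sqrt u}" and K = "sqrt u * K"])
      show "continuous_on UNIV (\<lambda>y. g' (\<psi> u y))"
        unfolding \<psi>_def by (intro continuous_on_compose2[OF g'_cont] continuous_intros) auto
      fix y assume "y \<notin> {(z - x - lam * u) / sqrt u}"
      then have "\<psi> u y \<noteq> z" using u by (auto simp: \<psi>_def field_simps)
      moreover have "((\<lambda>y. \<psi> u y) has_real_derivative sqrt u) (at y)"
        unfolding \<psi>_def by (auto intro!: derivative_eq_intros)
      ultimately show "((\<lambda>y. g' (\<psi> u y)) has_real_derivative sqrt u * g'' (\<psi> u y)) (at y)"
        using DERIV_chain2[OF g'] by (metis mult.commute)
    next
      show "\<bar>sqrt u * g'' (\<psi> u y)\<bar> \<le> sqrt u * K" for y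
        using g''_bound[of "\<psi> u y"] u by (simp add: abs_mult)
      show "\<bar>g' (\<psi> u y)\<bar> \<le> b0 + b1 * \<bar>y\<bar>" for y using g'_le u by simp
    qed auto
    then have stein: "(\<integral>y. y * g' (\<psi> u y) \<partial>\<N>) = sqrt u * (\<integral>y. g'' (\<psi> u y) \<partial>\<N>)" by simp
    have "(\<integral>y. H y u \<partial>\<N>) = (\<integral>y. lam * g' (\<psi> u y) + 1 / (2 * sqrt u) * (y * g' (\<psi> u y)) \<partial>\<N>)"
      using True by (intro Bochner_Integration.integral_cong) (auto simp: H_def algebra_simps)
    also have "\<dots> = lam * (\<integral>y. g' (\<psi> u y) \<partial>\<N>) + 1 / (2 * sqrt u) * (\<integral>y. y * g' (\<psi> u y) \<partial>\<N>)"
      using int1 int2 by simp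
    also have "\<dots> = (\<integral>y. g'' (\<psi> u y) / 2 + lam * g' (\<psi> u y) \<partial>\<N>)"
      using int1 int3 u unfolding stein by simp
    finally show ?thesis using True by simp
  qed (simp add: H_def)
  have "(\<integral>y. g (\<psi> t y) \<partial>\<N>) - g x = (\<integral>y. g (\<psi> t y) - g x \<partial>\<N>)"
    using int_g by (simp add: N.prob_space[simplified])
  also have "\<dots> = (\<integral>y. (\<integral>u. H y u \<partial>lborel) \<partial>\<N>)" by (simp add: path)
  also have "\<dots> = (\<integral>u. (\<integral>y. H y u \<partial>\<N>) \<partial>lborel)"
    using Fubini_integral[OF H_int] by simp
  also have "\<dots> = (\<integral>u. indicator {0..t} u * (\<integral>y. g'' (\<psi> u y) / 2 + lam * g' (\<psi> u y) \<partial>\<N>) \<partial>lborel)"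
    using inner by (intro integral_cong_AE AE_mp[OF AE_lborel_singleton[of 0] AE_I2]) auto
  finally show "(\<integral>y. g (x + lam * t + sqrt t * y) \<partial>\<N>) = g x +
      (\<integral>u. indicator {0..t} u *
        (\<integral>y. g'' (x + lam * u + sqrt u * y) / 2 + lam * g' (x + lam * u + sqrt u * y) \<partial>\<N>) \<partial>lborel)"
    by (simp add: \<psi>_def)
qed

section \<open>Brownian paths with drift\<close>

lemma space_natural_filtration [simp]: "space (natural_filtration M X t) = space M"
  unfolding natural_filtration_def by (rule space_measure_of) (auto dest: sets.sets_into_space null_setsD2)

lemma sets_natural_filtration:
  "sets (natural_filtration M X t) = sigma_sets (space M)
    ({X s -` A \<inter> space M | s A. 0 \<le> s \<and> s \<le> t \<and> A \<in> sets borel} \<union> null_sets M)"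
  unfolding natural_filtration_def by (rule sets_measure_of) (auto dest: sets.sets_into_space null_setsD2)

text \<open>Path properties are required at every point of the space and at all real times, so
  pathwise arguments carry no exceptional sets; the given motion is compared with such a version
  only at the very end. The assumption \<open>hits\<close> excludes the case in which
  \<open>last_passage\<close> takes its default value 0, which would freeze the path at 0 instead of
  \<open>z\<close>.\<close>

locale drifted_paths = prob_space M for M :: "'w measure" +
  fixes X :: "real \<Rightarrow> 'w \<Rightarrow> real" and lam z :: real
  assumes lam_pos: "0 < lam" and z_pos: "0 < z"
    and X_measurable [measurable]: "\<And>t. X t \<in> borel_measurable M"
    and X_cont: "\<And>\<omega>. \<omega> \<in> space M \<Longrightarrow> continuous_on UNIV (\<lambda>t. X t \<omega>)"
    and X_0: "\<And>\<omega>. \<omega> \<in> space M \<Longrightarrow> X 0 \<omega> = 0"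
    and hits: "\<And>\<omega>. \<omega> \<in> space M \<Longrightarrow> \<exists>t>0. X t \<omega> = z"
    and indep_increment: "\<And>s t C E. \<lbrakk>0 \<le> s; s < t; C \<in> sets (natural_filtration M X s); E \<in> sets borel\<rbrakk> \<Longrightarrow>
      prob (C \<inter> {\<omega> \<in> space M. X t \<omega> - X s \<omega> \<in> E}) = prob C * measure \<N> {y. lam * (t - s) + sqrt (t - s) * y \<in> E}"

text \<open>Factor the sequence as \<open>sqrt n * (lam * sqrt n + y)\<close>: once
  \<open>sqrt n\<close> passes \<open>m\<close>, the second factor is at least
  \<open>\<bar>Z\<bar>\<close> and the first at least 1.\<close>

lemma filterlim_drift_at_top:
  fixes lam y :: real
  assumes "0 < lam"
  shows "filterlim (\<lambda>n. lam * real n + sqrt (real n) * y) at_top sequentially"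
  unfolding filterlim_at_top
proof
  fix Z :: real
  define m where "m = max 1 ((\<bar>y\<bar> + \<bar>Z\<bar>) / lam)"
  show "eventually (\<lambda>n. Z \<le> lam * real n + sqrt (real n) * y) sequentially"
    using eventually_ge_at_top[of "nat \<lceil>m\<^sup>2\<rceil>"]
  proof eventually_elim
    case (elim n)
    then have "m\<^sup>2 \<le> real n" by linarith
    then have m: "m \<le> sqrt (real n)" by (rule real_le_rsqrt)
    then have "(\<bar>y\<bar> + \<bar>Z\<bar>) / lam \<le> sqrt (real n)" and 1: "1 \<le> sqrt (real n)" by (auto simp: m_def)
    then have "\<bar>y\<bar> + \<bar>Z\<bar> \<le> lam * sqrt (real n)" using assms by (simp add: field_simps)
    then have "1 * \<bar>Z\<bar> \<le> sqrt (real n) * (lam * sqrt (real n) + y)"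
      using 1 by (intro mult_mono) auto
    moreover have "sqrt (real n) * (lam * sqrt (real n) + y) = lam * real n + sqrt (real n) * y"
      by (simp add: algebra_simps)
    ultimately show ?case by linarith
  qed
qed

lemma standard_brownian_motion_increment:
  assumes "prob_space M" and B: "standard_brownian_motion M B" and st: "0 \<le> s" "s < t"
    and [measurable]: "E \<in> sets borel"
  shows "measure M {\<omega> \<in> space M. B t \<omega> - B s \<omega> \<in> E} = measure \<N> {y. sqrt (t - s) * y \<in> E}"
proof -
  interpret prob_space M by fact
  have pos: "0 < sqrt (t - s)" using st by simp
  have [measurable]: "B t \<in> borel_measurable M" "B s \<in> borel_measurable M"
    using B st by (auto simp: standard_brownian_motion_def)
  have "distributed M lborel (\<lambda>\<omega>. B t \<omega> - B s \<omega>) (normal_density 0 (sqrt (t - s)))"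
    using B st by (auto simp: standard_brownian_motion_def)
  then have "distributed M lborel (\<lambda>\<omega>. (B t \<omega> - B s \<omega>) / sqrt (t - s)) std_normal_density"
    using normal_standard_normal_convert[OF pos, of "\<lambda>\<omega>. B t \<omega> - B s \<omega>" 0] by simp
  then have "measure \<N> {y. sqrt (t - s) * y \<in> E} =
      measure (distr M lborel (\<lambda>\<omega>. (B t \<omega> - B s \<omega>) / sqrt (t - s))) {y. sqrt (t - s) * y \<in> E}"
    by (simp add: distributed_def)
  also have "\<dots> = measure M ((\<lambda>\<omega>. (B t \<omega> - B s \<omega>) / sqrt (t - s)) -` {y. sqrt (t - s) * y \<in> E} \<inter> space M)"
    by (rule measure_distr) auto
  also have "(\<lambda>\<omega>. (B t \<omega> - B s \<omega>) / sqrt (t - s)) -` {y. sqrt (t - s) * y \<in> E} \<inter> space M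
      = {\<omega> \<in> space M. B t \<omega> - B s \<omega> \<in> E}"
    using pos by auto
  finally show ?thesis by simp
qed

text \<open>Independence is given only for increments along finite grids. Cylinder events over
  \<open>{0..s}\<close> are functions of such increments up to null sets. Together with the null
  sets they are stable under intersection, so independence extends to the augmented sigma-algebra
  they generate.\<close>

lemma standard_brownian_motion_indep:
  assumes "prob_space M" and B: "standard_brownian_motion M B" and st: "0 \<le> s" "s < t"
    and X: "\<And>r. 0 \<le> r \<Longrightarrow> X r \<in> borel_measurable M"
    and XB: "AE \<omega> in M. \<forall>r\<ge>0. X r \<omega> = drifted B lam r \<omega>"
    and C: "C \<in> sets (natural_filtration M X s)" and E[measurable]: "E \<in> sets borel"
  shows "measure M (C \<inter> {\<omega> \<in> space M. B t \<omega> - B s \<omega> \<in> E})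
    = measure M C * measure M {\<omega> \<in> space M. B t \<omega> - B s \<omega> \<in> E}"
proof -
  interpret prob_space M by fact
  have [measurable]: "\<And>r. 0 \<le> r \<Longrightarrow> B r \<in> borel_measurable M"
    using B by (auto simp: standard_brownian_motion_def)
  have [measurable]: "B t \<in> borel_measurable M" "B s \<in> borel_measurable M" using st by auto
  define cyl where "cyl J A = {\<omega> \<in> space M. \<forall>r\<in>J. X r \<omega> \<in> A r}" for J and A :: "real \<Rightarrow> real set"
  define Pi where "Pi = {cyl J A | J A. finite J \<and> J \<subseteq> {0..s} \<and> (\<forall>r. A r \<in> sets borel)} \<union> null_sets M"
  define D where "D = {{\<omega> \<in> space M. B t \<omega> - B s \<omega> \<in> E} | E. E \<in> sets borel}"
  have cyl_sets: "cyl J A \<in> sets M" if "finite J" "J \<subseteq> {0..s}" "\<And>r. A r \<in> sets borel" for J A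
  proof -
    have "cyl J A = space M \<inter> (\<Inter>r\<in>J. {\<omega> \<in> space M. X r \<omega> \<in> A r})" by (auto simp: cyl_def)
    moreover have "{\<omega> \<in> space M. X r \<omega> \<in> A r} \<in> sets M" if "r \<in> J" for r
      using measurable_sets[OF X, of r "A r"] \<open>r \<in> J\<close> \<open>J \<subseteq> _\<close> \<open>\<And>r. A r \<in> _\<close>
      by (auto simp: vimage_def Int_def conj_commute)
    ultimately show ?thesis
      using that(1) by (cases "J = {}") (auto intro!: sets.Int sets.finite_INT)
  qed
  have main: "prob (cyl J A \<inter> {\<omega> \<in> space M. B t \<omega> - B s \<omega> \<in> E})
      = prob (cyl J A) * prob {\<omega> \<in> space M. B t \<omega> - B s \<omega> \<in> E}"
    if J: "finite J" "J \<subseteq> {0..s}" and A[measurable]: "\<And>r. A r \<in> sets borel" and E[measurable]: "E \<in> sets borel" for J A E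
  proof -
    \<comment> \<open>The point 0 lets partial sums of increments recover the values of
      \<open>X\<close>; the point \<open>s\<close> separates past increments from
      \<open>B t - B s\<close>.\<close>
    define l where "l = sorted_list_of_set (insert 0 (insert s J))"
    have set_l: "set l = insert 0 (insert s J)" unfolding l_def by (rule set_sorted_list_of_set) (simp add: J)
    have sort_l: "sorted_wrt (<) l" unfolding l_def by (rule strict_sorted_list_of_set)
    define n where "n = length l - 1"
    have "l \<noteq> []" using set_l by auto
    then have len: "length l = Suc n" by (simp add: n_def)
    \<comment> \<open>The grid continued by \<open>t\<close>. Since \<open>l ! n = s\<close>, the
      increment with index \<open>n\<close> is the future one and those with smaller index belong to
      the past.\<close>
    define \<tau> where "\<tau> i = (if i \<le> n then l ! i else t)" for i
    have l_le: "0 \<le> l ! i" "l ! i \<le> s" if "i \<le> n" for i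
    proof -
      have "l ! i \<in> set l" using that len by simp
      then show "0 \<le> l ! i" "l ! i \<le> s" unfolding set_l using J st by auto
    qed
    have mono: "l ! i < l ! j" if "i < j" "j \<le> n" for i j
      using sort_l that len by (simp add: sorted_wrt_iff_nth_less)
    have l0: "l ! 0 = 0"
    proof -
      obtain i where i: "i \<le> n" "l ! i = 0" using set_l len by (metis in_set_conv_nth insertI1 less_Suc_eq_le)
      then show ?thesis using mono[of 0 i] l_le[of 0] by (cases "i = 0") auto
    qed
    have ln: "l ! n = s"
    proof -
      obtain i where i: "i \<le> n" "l ! i = s" using set_l len by (metis in_set_conv_nth insertI1 insertI2 less_Suc_eq_le)
      then show ?thesis using mono[of i n] l_le[of n] by (cases "i = n") auto
    qed
    have \<tau>: "0 \<le> \<tau> 0 \<and> (\<forall>i<Suc n. \<tau> i < \<tau> (Suc i))"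
      using l0 mono ln st by (auto simp: \<tau>_def not_le less_Suc_eq_le le_less_Suc_eq)
    have nonneg: "0 \<le> \<tau> i" for i using l_le(1)[of i] st by (auto simp: \<tau>_def)
    define \<Delta> where "\<Delta> i \<omega> = B (\<tau> (Suc i)) \<omega> - B (\<tau> i) \<omega>" for i \<omega>
    have "indep_vars (\<lambda>_. borel) \<Delta> {..<Suc n}"
      using B \<tau> unfolding standard_brownian_motion_def \<Delta>_def[abs_def] by blast
    then have ind: "indep_var (PiM {..<n} (\<lambda>_. borel)) (\<lambda>\<omega>. restrict (\<lambda>i. \<Delta> i \<omega>) {..<n})
        (PiM {n} (\<lambda>_. borel)) (\<lambda>\<omega>. restrict (\<lambda>i. \<Delta> i \<omega>) {n})"
      by (rule indep_var_restrict) auto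
    \<comment> \<open>The cylinder \<open>cyl J A\<close> rewritten as a condition on past
      increments; the first \<open>k\<close> of them lead from time 0 to
      \<open>l ! k\<close>.\<close>
    define U where "U = {f \<in> space (PiM {..<n} (\<lambda>_. borel :: real measure)).
      \<forall>k\<in>{k. k \<le> n \<and> l ! k \<in> J}. (\<Sum>i<k. f i) + lam * (l ! k) \<in> A (l ! k)}"
    define V where "V = {f \<in> space (PiM {n} (\<lambda>_. borel :: real measure)). f n \<in> E}"
    have U: "U \<in> sets (PiM {..<n} (\<lambda>_. borel))"
      unfolding U_def
    proof (rule sets.sets_Collect_finite_All)
      show "{f \<in> space (PiM {..<n} (\<lambda>_. borel)). (\<Sum>i<k. f i) + lam * l ! k \<in> A (l ! k)} \<in> sets (PiM {..<n} (\<lambda>_. borel))"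
        if "k \<in> {k. k \<le> n \<and> l ! k \<in> J}" for k
      proof -
        have "(\<lambda>f. (\<Sum>i<k. f i) + lam * l ! k) \<in> borel_measurable (PiM {..<n} (\<lambda>_. borel))"
          using that by (intro borel_measurable_add borel_measurable_sum measurable_component_singleton) auto
        from measurable_sets[OF this A[of "l ! k"]] show ?thesis
          by (simp add: vimage_def Int_def conj_commute)
      qed
      show "finite {k. k \<le> n \<and> l ! k \<in> J}" by simp
    qed
    have V: "V \<in> sets (PiM {n} (\<lambda>_. borel))" unfolding V_def by measurable
    define C0 where "C0 = (\<lambda>\<omega>. restrict (\<lambda>i. \<Delta> i \<omega>) {..<n}) -` U \<inter> space M"
    have C0: "C0 \<in> sets M" unfolding C0_def using indep_var_rv1[OF ind] U by (rule measurable_sets)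
    have V_eq: "(\<lambda>\<omega>. restrict (\<lambda>i. \<Delta> i \<omega>) {n}) -` V \<inter> space M = {\<omega> \<in> space M. B t \<omega> - B s \<omega> \<in> E}"
      by (auto simp: V_def \<Delta>_def \<tau>_def ln space_PiM)
    have "AE \<omega> in M. B 0 \<omega> = 0" using B by (auto simp: standard_brownian_motion_def)
    with XB have C0_eq: "AE \<omega> in M. \<omega> \<in> cyl J A \<longleftrightarrow> \<omega> \<in> C0"
    proof eventually_elim
      case (elim \<omega>)
      have sum: "(\<Sum>i<k. \<Delta> i \<omega>) + lam * l ! k = X (l ! k) \<omega>" if "k \<le> n" for k
      proof -
        have "(\<Sum>i<k. \<Delta> i \<omega>) = B (\<tau> k) \<omega> - B (\<tau> 0) \<omega>"
          unfolding \<Delta>_def by (rule sum_lessThan_telescope)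
        then show ?thesis using elim l_le[of k] that l0 by (simp add: \<tau>_def drifted_def)
      qed
      have J_eq: "J = (\<lambda>k. l ! k) ` {k. k \<le> n \<and> l ! k \<in> J}"
        using set_l len by (auto simp: in_set_conv_nth image_iff) (metis in_set_conv_nth insertI2 len less_Suc_eq_le set_l)
      have "(\<forall>r\<in>J. X r \<omega> \<in> A r) \<longleftrightarrow> (\<forall>k\<in>{k. k \<le> n \<and> l ! k \<in> J}. (\<Sum>i<k. \<Delta> i \<omega>) + lam * l ! k \<in> A (l ! k))"
        by (subst J_eq) (simp add: sum)
      moreover have "(\<Sum>i<k. restrict (\<lambda>i. \<Delta> i \<omega>) {..<n} i) = (\<Sum>i<k. \<Delta> i \<omega>)" if "k \<le> n" for k
        using that by (intro sum.cong) auto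
      ultimately show ?case
        by (auto simp: cyl_def C0_def U_def space_PiM)
    qed
    have "prob (C0 \<inter> {\<omega> \<in> space M. B t \<omega> - B s \<omega> \<in> E}) = prob C0 * prob {\<omega> \<in> space M. B t \<omega> - B s \<omega> \<in> E}"
      using indep_varD[OF ind U V] unfolding C0_def V_eq[symmetric]
      by (simp add: vimage_Times Int_assoc[symmetric] Int_commute Int_left_commute vimage_def Int_def conj_ac)
    moreover have "prob (cyl J A) = prob C0"
      using C0_eq cyl_sets[OF J A] C0 by (intro measure_eq_AE) auto
    moreover have "prob (cyl J A \<inter> {\<omega> \<in> space M. B t \<omega> - B s \<omega> \<in> E}) = prob (C0 \<inter> {\<omega> \<in> space M. B t \<omega> - B s \<omega> \<in> E})"
      using C0_eq cyl_sets[OF J A] C0 by (intro measure_eq_AE) auto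
    ultimately show ?thesis by simp
  qed
  have "indep_set Pi D"
  proof (rule indep_setI)
    show "Pi \<subseteq> events" by (auto simp: Pi_def intro: cyl_sets)
    show "D \<subseteq> events" by (auto simp: D_def)
    fix a b assume "a \<in> Pi" "b \<in> D"
    then obtain E where b: "b = {\<omega> \<in> space M. B t \<omega> - B s \<omega> \<in> E}" "E \<in> sets borel"
      by (auto simp: D_def)
    from \<open>a \<in> Pi\<close> show "prob (a \<inter> b) = prob a * prob b"
      unfolding Pi_def
    proof
      assume "a \<in> null_sets M"
      moreover have "b \<in> sets M" using \<open>b \<in> D\<close> \<open>D \<subseteq> events\<close> by auto
      ultimately show ?thesis using null_set_Int2[of a M b] by (simp add: measure_eq_0_null_sets null_set_Int1)
    qed (use main b in auto)
  qed
  moreover have "Int_stable Pi"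
  proof (rule Int_stableI)
    fix a b assume ab: "a \<in> Pi" "b \<in> Pi"
    show "a \<inter> b \<in> Pi"
    proof (cases "a \<in> null_sets M \<or> b \<in> null_sets M")
      case True
      moreover have "a \<in> sets M" "b \<in> sets M" using ab by (auto simp: Pi_def intro: cyl_sets)
      ultimately show ?thesis by (auto simp: Pi_def intro: null_set_Int1 null_set_Int2)
    next
      case False
      with ab obtain J1 A1 J2 A2 where *: "a = cyl J1 A1" "finite J1" "J1 \<subseteq> {0..s}" "\<forall>r. A1 r \<in> sets borel"
        "b = cyl J2 A2" "finite J2" "J2 \<subseteq> {0..s}" "\<forall>r. A2 r \<in> sets borel"
        by (auto simp: Pi_def)
      define A where "A r = (if r \<in> J1 then A1 r else UNIV) \<inter> (if r \<in> J2 then A2 r else UNIV)" for r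
      have "a \<inter> b = cyl (J1 \<union> J2) A" by (auto simp: * cyl_def A_def split: if_splits)
      moreover have "\<forall>r. A r \<in> sets borel" using * by (auto simp: A_def)
      ultimately show ?thesis using * by (auto simp: Pi_def intro!: exI[of _ "J1 \<union> J2"] exI[of _ A])
    qed
  qed
  moreover have "Int_stable D"
  proof (rule Int_stableI)
    fix a b assume "a \<in> D" "b \<in> D"
    then obtain E1 E2 where "E1 \<in> sets borel" "E2 \<in> sets borel"
      "a = {\<omega> \<in> space M. B t \<omega> - B s \<omega> \<in> E1}" "b = {\<omega> \<in> space M. B t \<omega> - B s \<omega> \<in> E2}"
      by (auto simp: D_def)
    then show "a \<inter> b \<in> D" by (auto simp: D_def intro!: exI[of _ "E1 \<inter> E2"])
  qed
  ultimately have "indep_set (sigma_sets (space M) Pi) (sigma_sets (space M) D)"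
    by (rule indep_set_sigma_sets)
  moreover have "C \<in> sigma_sets (space M) Pi"
  proof -
    have "X r -` A \<inter> space M \<in> Pi" if "0 \<le> r" "r \<le> s" "A \<in> sets borel" for r A
      using that unfolding Pi_def
      by (intro UnI1 CollectI exI[of _ "{r}"] exI[of _ "\<lambda>_. A"]) (auto simp: cyl_def)
    then have "sigma_sets (space M) ({X r -` A \<inter> space M | r A. 0 \<le> r \<and> r \<le> s \<and> A \<in> sets borel} \<union> null_sets M)
        \<subseteq> sigma_sets (space M) Pi"
      by (intro sigma_sets_mono) (auto simp: Pi_def intro: sigma_sets.Basic)
    then show ?thesis using C by (auto simp: sets_natural_filtration)
  qed
  moreover have "{\<omega> \<in> space M. B t \<omega> - B s \<omega> \<in> E} \<in> sigma_sets (space M) D"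
    using E unfolding D_def by (intro sigma_sets.Basic) auto
  ultimately show ?thesis by (rule indep_setD)
qed

text \<open>At time \<open>n\<close> the motion has the law of \<open>lam * n + sqrt n * y\<close>
  for a standard normal \<open>y\<close>, which tends to infinity for each fixed \<open>y\<close>.
  By dominated convergence the probability of being below \<open>z\<close> at time \<open>n\<close>
  tends to 0, and it dominates the probability of being below \<open>z\<close> at all integer
  times.\<close>

lemma drifted_brownian_motion_hits:
  assumes "prob_space M" and B: "standard_brownian_motion M B" and lam: "0 < lam"
  shows "AE \<omega> in M. \<exists>n::nat. z \<le> B (real n) \<omega> + lam * real n"
proof -
  interpret prob_space M by fact
  interpret N: prob_space \<N> by (rule prob_space_std_normal)
  have [measurable]: "\<And>r. 0 \<le> r \<Longrightarrow> B r \<in> borel_measurable M"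
    using B by (auto simp: standard_brownian_motion_def)
  have [measurable]: "B (real n) \<in> borel_measurable M" for n by simp
  have [measurable]: "B 0 \<in> borel_measurable M" by simp
  define Q where "Q n = {\<omega> \<in> space M. B (real n) \<omega> - B 0 \<omega> \<in> {x. x + lam * real n < z}}" for n
  have [measurable]: "Q n \<in> sets M" for n unfolding Q_def by measurable
  have prob_Q: "prob (Q n) = (\<integral>y. indicat_real {y. lam * real n + sqrt (real n) * y < z} y \<partial>\<N>)"
    if "0 < n" for n
    unfolding Q_def using that
    by (subst standard_brownian_motion_increment[OF \<open>prob_space M\<close> B]) (auto simp: add.commute)
  have "(\<lambda>n. \<integral>y. indicat_real {y. lam * real n + sqrt (real n) * y < z} y \<partial>\<N>) \<longlonglongrightarrow> (\<integral>y. 0 \<partial>\<N>)"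
  proof (rule integral_dominated_convergence[where w = "\<lambda>_. 1"])
    show "AE y in \<N>. (\<lambda>n. indicat_real {y. lam * real n + sqrt (real n) * y < z} y) \<longlonglongrightarrow> 0"
    proof (rule AE_I2)
      fix y :: real
      have "eventually (\<lambda>n. z \<le> lam * real n + sqrt (real n) * y) sequentially"
        using filterlim_drift_at_top[OF lam, of y] by (simp add: filterlim_at_top)
      then show "(\<lambda>n. indicat_real {y. lam * real n + sqrt (real n) * y < z} y) \<longlonglongrightarrow> 0"
        by (intro tendsto_eventually) (auto elim: eventually_mono)
    qed
  qed (auto simp: indicator_def)
  moreover have "eventually (\<lambda>n. (\<integral>y. indicat_real {y. lam * real n + sqrt (real n) * y < z} y \<partial>\<N>) = prob (Q n)) sequentially"
    using eventually_gt_at_top[of 0] by eventually_elim (rule prob_Q[symmetric])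
  ultimately have lim: "(\<lambda>n. prob (Q n)) \<longlonglongrightarrow> 0"
    using Lim_transform_eventually by fastforce
  have "prob (\<Inter>n. Q n) \<le> 0"
    by (rule LIMSEQ_le_const[OF lim]) (auto intro!: finite_measure_mono)
  then have "prob (\<Inter>n. Q n) = 0" using measure_nonneg[of M "\<Inter>n. Q n"] by linarith
  then have "(\<Inter>n. Q n) \<in> null_sets M"
    by (intro null_setsI) (simp_all add: emeasure_eq_measure)
  then have "AE \<omega> in M. \<omega> \<notin> (\<Inter>n. Q n)" by (rule AE_not_in)
  moreover have "AE \<omega> in M. B 0 \<omega> = 0" using B by (auto simp: standard_brownian_motion_def)
  ultimately show ?thesis
    using AE_space
  proof eventually_elim
    case (elim \<omega>)
    then obtain n where "\<omega> \<notin> Q n" by auto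
    with elim have "z \<le> B (real n) \<omega> + lam * real n" by (simp add: Q_def not_less)
    then show ?case ..
  qed
qed

proposition drifted_paths_modification:
  fixes M :: "'w measure"
  assumes M: "prob_space M" and B: "standard_brownian_motion M B" and lam: "0 < lam" and z: "0 < z"
  obtains X where "drifted_paths M X lam z" "AE \<omega> in M. \<forall>t\<ge>0. X t \<omega> = drifted B lam t \<omega>"
proof -
  interpret prob_space M by fact
  have [measurable]: "\<And>r. 0 \<le> r \<Longrightarrow> B r \<in> borel_measurable M"
    using B by (auto simp: standard_brownian_motion_def)
  have [measurable]: "B (max 0 t) \<in> borel_measurable M" for t by simp
  have "AE \<omega> in M. continuous_on {0..} (\<lambda>t. B t \<omega>)" "AE \<omega> in M. B 0 \<omega> = 0"
    using B by (auto simp: standard_brownian_motion_def ae_continuous_def)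
  with drifted_brownian_motion_hits[OF M B lam, of z]
  have "AE \<omega> in M. continuous_on {0..} (\<lambda>t. B t \<omega>) \<and> B 0 \<omega> = 0 \<and> (\<exists>n::nat. z \<le> B (real n) \<omega> + lam * real n)"
    by eventually_elim auto
  then obtain N where
    good: "\<And>\<omega>. \<omega> \<in> space M - N \<Longrightarrow> continuous_on {0..} (\<lambda>t. B t \<omega>) \<and> B 0 \<omega> = 0 \<and> (\<exists>n::nat. z \<le> B (real n) \<omega> + lam * real n)"
    and N: "N \<in> null_sets M"
    by (rule AE_E3) blast
  have [measurable]: "N \<in> sets M" using N by auto
  \<comment> \<open>On the null set \<open>N\<close> the path becomes \<open>lam * t\<close>, which
    is continuous, starts at 0 and attains \<open>z\<close> at time \<open>z / lam\<close>. The
    \<open>max\<close> freezes the Brownian part at negative times.\<close>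
  define X where "X t \<omega> = (if \<omega> \<in> N then 0 else B (max 0 t) \<omega>) + lam * t" for t \<omega>
  have X[measurable]: "X t \<in> borel_measurable M" for t unfolding X_def by measurable
  have cont: "continuous_on UNIV (\<lambda>t. X t \<omega>)" if "\<omega> \<in> space M" for \<omega>
  proof (cases "\<omega> \<in> N")
    case False
    with good that have "continuous_on {0..} (\<lambda>t. B t \<omega>)" by auto
    then have "continuous_on UNIV (\<lambda>t. B (max 0 t) \<omega>)"
      by (rule continuous_on_compose2) (auto intro!: continuous_intros)
    with False show ?thesis unfolding X_def by (auto intro!: continuous_intros)
  qed (auto simp: X_def intro!: continuous_intros)
  have AE_X: "AE \<omega> in M. \<forall>t\<ge>0. X t \<omega> = drifted B lam t \<omega>"
    using AE_not_in[OF N] by eventually_elim (auto simp: X_def drifted_def)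
  have "drifted_paths M X lam z"
  proof
    show "continuous_on UNIV (\<lambda>t. X t \<omega>)" if "\<omega> \<in> space M" for \<omega> using cont that .
    show X0: "X 0 \<omega> = 0" if "\<omega> \<in> space M" for \<omega>
      using good that by (auto simp: X_def)
    show "\<exists>t>0. X t \<omega> = z" if "\<omega> \<in> space M" for \<omega>
    proof -
      have "\<exists>s>0. z \<le> X s \<omega>"
      proof (cases "\<omega> \<in> N")
        case True
        then show ?thesis using lam z by (intro exI[of _ "z / lam"]) (auto simp: X_def)
      next
        case False
        with good that obtain n :: nat where n: "z \<le> B (real n) \<omega> + lam * real n" "B 0 \<omega> = 0" by auto
        then have "n \<noteq> 0" using z by (cases "n = 0") auto
        then show ?thesis using n False by (intro exI[of _ "real n"]) (auto simp: X_def)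
      qed
      then obtain s where s: "0 < s" "z \<le> X s \<omega>" by auto
      have "\<exists>t\<ge>0. t \<le> s \<and> X t \<omega> = z"
        using s z X0[OF that] continuous_on_subset[OF cont[OF that]] by (intro IVT') auto
      then obtain t where "0 \<le> t" "X t \<omega> = z" by auto
      moreover then have "t \<noteq> 0" using X0[OF that] z by auto
      ultimately show ?thesis by (intro exI[of _ t]) auto
    qed
    fix s t :: real and C :: "'w set" and E :: "real set" assume st: "0 \<le> s" "s < t" and C: "C \<in> sets (natural_filtration M X s)" and [measurable]: "E \<in> sets borel"
    have [measurable]: "B t \<in> borel_measurable M" "B s \<in> borel_measurable M" using st by auto
    have "C \<in> sets M"
    proof -
      have "sets (natural_filtration M X s) \<subseteq> sets M"
        unfolding sets_natural_filtration by (rule sets.sigma_sets_subset) (auto intro: measurable_sets[OF X])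
      with C show ?thesis by auto
    qed
    have "AE \<omega> in M. X t \<omega> - X s \<omega> = lam * (t - s) + (B t \<omega> - B s \<omega>)"
      using AE_X by eventually_elim (use st in \<open>simp add: drifted_def algebra_simps\<close>)
    with \<open>C \<in> sets M\<close> have "prob (C \<inter> {\<omega> \<in> space M. X t \<omega> - X s \<omega> \<in> E})
        = prob (C \<inter> {\<omega> \<in> space M. B t \<omega> - B s \<omega> \<in> {x. lam * (t - s) + x \<in> E}})"
      by (intro measure_eq_AE) (auto elim!: eventually_mono)
    also have "\<dots> = prob C * prob {\<omega> \<in> space M. B t \<omega> - B s \<omega> \<in> {x. lam * (t - s) + x \<in> E}}"
      by (rule standard_brownian_motion_indep[OF M B st _ AE_X C]) auto
    also have "prob {\<omega> \<in> space M. B t \<omega> - B s \<omega> \<in> {x. lam * (t - s) + x \<in> E}}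
        = measure \<N> {y. lam * (t - s) + sqrt (t - s) * y \<in> E}"
      by (subst standard_brownian_motion_increment[OF M B st]) auto
    finally show "prob (C \<inter> {\<omega> \<in> space M. X t \<omega> - X s \<omega> \<in> E}) = prob C * measure \<N> {y. lam * (t - s) + sqrt (t - s) * y \<in> E}" .
  qed (use lam z X in auto)
  then show thesis using AE_X that by blast
qed

section \<open>The Markov property\<close>

context
  fixes M :: "'w measure" and X :: "real \<Rightarrow> 'w \<Rightarrow> real"
  assumes X: "\<And>t. 0 \<le> t \<Longrightarrow> X t \<in> borel_measurable M"
begin

lemma sets_natural_filtration_subset: "sets (natural_filtration M X t) \<subseteq> sets M"
  unfolding sets_natural_filtration
proof (intro sets.sigma_sets_subset Un_least subsetI)
  fix a assume "a \<in> {X s -` A \<inter> space M |s A. 0 \<le> s \<and> s \<le> t \<and> A \<in> sets borel}"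
  then obtain s A where "a = X s -` A \<inter> space M" "0 \<le> s" "A \<in> sets borel" by blast
  then show "a \<in> sets M" using measurable_sets[OF X] by simp
qed auto

lemma subalgebra_natural_filtration: "subalgebra M (natural_filtration M X t)"
  unfolding subalgebra_def by (intro conjI sets_natural_filtration_subset) simp

end

lemma null_sets_natural_filtration: "null_sets M \<subseteq> sets (natural_filtration M X t)"
  unfolding sets_natural_filtration by (auto intro: sigma_sets.Basic)

lemma natural_filtration_mono:
  "s \<le> t \<Longrightarrow> sets (natural_filtration M X s) \<subseteq> sets (natural_filtration M X t)"
  unfolding sets_natural_filtration
  by (intro sigma_sets_mono' Un_mono Collect_mono impI order_refl) (blast intro: order_trans)

lemma filtration_natural_filtration: "filtration (space M) (natural_filtration M X)"
  by standard (simp_all add: natural_filtration_mono)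

lemma measurable_natural_filtration:
  "0 \<le> s \<Longrightarrow> s \<le> t \<Longrightarrow> X s \<in> borel_measurable (natural_filtration M X t)"
  by (rule measurableI) (auto simp: sets_natural_filtration intro!: sigma_sets.Basic)

text \<open>With time rounded down to a multiple of \<open>1 / Suc n\<close>, only countably many
  coordinates of the process occur, which gives joint measurability; continuity passes it to the
  limit. \<open>N\<close> is left arbitrary so that it can also be a member of a filtration, where
  the result expresses progressive measurability.\<close>

lemma pair_measurable_continuous_process:
  fixes X :: "real \<Rightarrow> 'w \<Rightarrow> real"
  assumes [measurable]: "\<And>t. X t \<in> borel_measurable N"
    and cont: "\<And>\<omega>. \<omega> \<in> space N \<Longrightarrow> continuous_on UNIV (\<lambda>t. X t \<omega>)"
  shows "(\<lambda>(t, \<omega>). X t \<omega>) \<in> borel_measurable (borel \<Otimes>\<^sub>M N)"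
proof (rule borel_measurable_LIMSEQ_real)
  define d where "d n t = real_of_int \<lfloor>t * real (Suc n)\<rfloor> / real (Suc n)" for n and t :: real
  show "(\<lambda>n. case p of (t, \<omega>) \<Rightarrow> X (d n t) \<omega>) \<longlonglongrightarrow> (case p of (t, \<omega>) \<Rightarrow> X t \<omega>)"
    if "p \<in> space (borel \<Otimes>\<^sub>M N)" for p
  proof -
    obtain t \<omega> where p: "p = (t, \<omega>)" "\<omega> \<in> space N" using \<open>p \<in> _\<close> by (auto simp: space_pair_measure)
    have "(\<lambda>n. d n t) \<longlonglongrightarrow> t"
    proof (rule LIM_zero_cancel, rule Lim_null_comparison)
      show "(\<lambda>n. 1 / real (Suc n)) \<longlonglongrightarrow> 0" by (rule LIMSEQ_Suc[OF lim_1_over_n])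
      show "eventually (\<lambda>n. norm (d n t - t) \<le> 1 / real (Suc n)) sequentially"
      proof (rule always_eventually, rule allI)
        fix n
        have "d n t - t = (real_of_int \<lfloor>t * real (Suc n)\<rfloor> - t * real (Suc n)) / real (Suc n)"
          by (simp add: d_def field_simps)
        moreover have "\<bar>real_of_int \<lfloor>t * real (Suc n)\<rfloor> - t * real (Suc n)\<bar> \<le> 1" by linarith
        ultimately show "norm (d n t - t) \<le> 1 / real (Suc n)"
          by (simp add: abs_divide divide_right_mono del: of_nat_Suc)
      qed
    qed
    moreover have "isCont (\<lambda>t. X t \<omega>) t" using cont[OF p(2)] by (simp add: continuous_on_eq_continuous_at)
    ultimately have "(\<lambda>n. X (d n t) \<omega>) \<longlonglongrightarrow> X t \<omega>"
      using isCont_tendsto_compose[of t "\<lambda>t. X t \<omega>" "\<lambda>n. d n t"] by simp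
    then show ?thesis using p by simp
  qed
  show "(\<lambda>p. case p of (t, \<omega>) \<Rightarrow> X (d n t) \<omega>) \<in> borel_measurable (borel \<Otimes>\<^sub>M N)" for n
  proof -
    have "(\<lambda>p. X (real_of_int \<lfloor>fst p * real (Suc n)\<rfloor> / real (Suc n)) (snd p)) \<in> borel_measurable (borel \<Otimes>\<^sub>M N)"
      by (rule measurable_compose_countable[where f = "\<lambda>i p. X (real_of_int i / real (Suc n)) (snd p)"
            and g = "\<lambda>p. \<lfloor>fst p * real (Suc n)\<rfloor>"]) measurable
    then show ?thesis by (simp add: d_def split_beta)
  qed
qed

context drifted_paths
begin

abbreviation "FX \<equiv> natural_filtration M X"

lemma FX_subset: "C \<in> sets (FX t) \<Longrightarrow> C \<in> events"
  using sets_natural_filtration_subset[of X M t] X_measurable by auto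

lemma FX_mono: "C \<in> sets (FX s) \<Longrightarrow> s \<le> t \<Longrightarrow> C \<in> sets (FX t)"
  using natural_filtration_mono[of s t M X] by auto

lemma X_pair_measurable [measurable]: "(\<lambda>(t, \<omega>). X t \<omega>) \<in> borel_measurable (borel \<Otimes>\<^sub>M M)"
  by (rule pair_measurable_continuous_process) (auto simp: X_cont)

lemma distr_increment:
  assumes st: "0 \<le> s" "s < t"
  shows "distr M borel (\<lambda>\<omega>. X t \<omega> - X s \<omega>) = distr \<N> borel (\<lambda>y. lam * (t - s) + sqrt (t - s) * y)"
proof (rule measure_eqI)
  interpret N: prob_space \<N> by (rule prob_space_std_normal)
  fix E assume "E \<in> sets (distr M borel (\<lambda>\<omega>. X t \<omega> - X s \<omega>))"
  then have [measurable]: "E \<in> sets borel" by simp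
  have "space M \<in> sets (FX s)" using sets.top[of "FX s"] by simp
  from indep_increment[OF st this, of E]
  have "prob {\<omega> \<in> space M. X t \<omega> - X s \<omega> \<in> E} = measure \<N> {y. lam * (t - s) + sqrt (t - s) * y \<in> E}"
    by (simp add: prob_space Int_def)
  then show "emeasure (distr M borel (\<lambda>\<omega>. X t \<omega> - X s \<omega>)) E
      = emeasure (distr \<N> borel (\<lambda>y. lam * (t - s) + sqrt (t - s) * y)) E"
    by (simp add: emeasure_distr emeasure_eq_measure N.emeasure_eq_measure vimage_def Int_def conj_commute)
qed simp

lemma
  assumes t: "0 \<le> t" and k[measurable]: "k \<in> borel_measurable borel"
  shows integrable_X_iff: "integrable M (\<lambda>\<omega>. k (X t \<omega>) :: real) \<longleftrightarrow> integrable \<N> (\<lambda>y. k (lam * t + sqrt t * y))"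
    and expectation_X: "expectation (\<lambda>\<omega>. k (X t \<omega>)) = (\<integral>y. k (lam * t + sqrt t * y) \<partial>\<N>)"
proof -
  interpret N: prob_space \<N> by (rule prob_space_std_normal)
  have *: "integrable M (\<lambda>\<omega>. k (X t \<omega>)) \<longleftrightarrow> integrable M (\<lambda>\<omega>. k (X t \<omega> - X 0 \<omega>))"
    "expectation (\<lambda>\<omega>. k (X t \<omega>)) = expectation (\<lambda>\<omega>. k (X t \<omega> - X 0 \<omega>))"
    by (auto simp: X_0 intro!: Bochner_Integration.integrable_cong Bochner_Integration.integral_cong)
  have "(integrable M (\<lambda>\<omega>. k (X t \<omega>)) \<longleftrightarrow> integrable \<N> (\<lambda>y. k (lam * t + sqrt t * y))) \<and>
    expectation (\<lambda>\<omega>. k (X t \<omega>)) = (\<integral>y. k (lam * t + sqrt t * y) \<partial>\<N>)"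
  \<comment> \<open>The increment law is available only for strictly ordered times; at time 0 both
    sides reduce to \<open>k 0\<close>.\<close>
  proof (cases "t = 0")
    case True
    then show ?thesis unfolding * by (simp add: N.prob_space[simplified] prob_space)
  next
    case False
    with t have "0 < t" by simp
    note d = distr_increment[OF order_refl this]
    have "integrable M (\<lambda>\<omega>. k (X t \<omega> - X 0 \<omega>)) \<longleftrightarrow> integrable (distr M borel (\<lambda>\<omega>. X t \<omega> - X 0 \<omega>)) k"
      by (subst integrable_distr_eq) auto
    moreover have "expectation (\<lambda>\<omega>. k (X t \<omega> - X 0 \<omega>)) = integral\<^sup>L (distr M borel (\<lambda>\<omega>. X t \<omega> - X 0 \<omega>)) k"
      by (subst integral_distr) auto
    ultimately show ?thesis unfolding * d by (simp add: integrable_distr_eq integral_distr)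
  qed
  then show "integrable M (\<lambda>\<omega>. k (X t \<omega>)) \<longleftrightarrow> integrable \<N> (\<lambda>y. k (lam * t + sqrt t * y))"
    "expectation (\<lambda>\<omega>. k (X t \<omega>)) = (\<integral>y. k (lam * t + sqrt t * y) \<partial>\<N>)" by auto
qed

lemma integrable_X_quadratic:
  assumes "0 \<le> t" and k[measurable]: "k \<in> borel_measurable borel" and b: "\<And>x. \<bar>k x\<bar> \<le> a + b * x\<^sup>2"
  shows "integrable M (\<lambda>\<omega>. k (X t \<omega>))"
  unfolding integrable_X_iff[OF assms(1) k]
proof (rule integrable_std_normal_quadratic)
  fix y :: real
  have "0 \<le> (lam * t - sqrt t * y)\<^sup>2" by simp
  then have "(lam * t + sqrt t * y)\<^sup>2 \<le> 2 * (lam * t)\<^sup>2 + 2 * (sqrt t * y)\<^sup>2"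
    by (simp add: power2_eq_square algebra_simps)
  also have "(sqrt t * y)\<^sup>2 = t * y\<^sup>2" using \<open>0 \<le> t\<close> by (simp add: power_mult_distrib)
  finally have "\<bar>b\<bar> * (lam * t + sqrt t * y)\<^sup>2 \<le> \<bar>b\<bar> * (2 * (lam * t)\<^sup>2 + 2 * (t * y\<^sup>2))"
    by (intro mult_left_mono) auto
  moreover have "\<bar>k (lam * t + sqrt t * y)\<bar> \<le> a + \<bar>b\<bar> * (lam * t + sqrt t * y)\<^sup>2"
    by (rule order_trans[OF b]) (auto intro: mult_right_mono)
  ultimately show "\<bar>k (lam * t + sqrt t * y)\<bar> \<le> (a + \<bar>b\<bar> * (2 * (lam * t)\<^sup>2)) + (\<bar>b\<bar> * 2 * t) * y\<^sup>2"
    by (simp add: algebra_simps)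
qed simp

lemma integrable_X: "0 \<le> t \<Longrightarrow> integrable M (X t)"
proof -
  assume t: "0 \<le> t"
  have "\<bar>x\<bar> \<le> 1 + 1 * x\<^sup>2" for x :: real using abs_le_1_plus_square[of x] by simp
  from integrable_X_quadratic[OF t _ this] show ?thesis by simp
qed

text \<open>The bound does not depend on \<open>u\<close>, which is what integrability over a time
  interval requires.\<close>

lemma expectation_abs_X_le:
  assumes "0 \<le> u" "u \<le> t"
  shows "expectation (\<lambda>\<omega>. \<bar>X u \<omega>\<bar>) \<le> lam * t + sqrt t * (\<integral>y. \<bar>y\<bar> \<partial>\<N>)"
proof -
  interpret N: prob_space \<N> by (rule prob_space_std_normal)
  have i: "integrable \<N> (\<lambda>y. \<bar>y\<bar>)" by (rule integrable_std_normal_linear[where a = 0 and b = 1]) auto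
  have "expectation (\<lambda>\<omega>. \<bar>X u \<omega>\<bar>) = (\<integral>y. \<bar>lam * u + sqrt u * y\<bar> \<partial>\<N>)"
    using assms by (subst expectation_X) auto
  also have "\<dots> \<le> (\<integral>y. lam * t + sqrt t * \<bar>y\<bar> \<partial>\<N>)"
  proof (rule integral_mono)
    show "integrable \<N> (\<lambda>y. \<bar>lam * u + sqrt u * y\<bar>)"
      by (rule integrable_std_normal_linear[where a = "\<bar>lam * u\<bar>" and b = "\<bar>sqrt u\<bar>"])
         (auto intro: order_trans[OF abs_triangle_ineq] simp: abs_mult)
    fix y
    have "\<bar>lam * u + sqrt u * y\<bar> \<le> \<bar>lam * u\<bar> + \<bar>sqrt u * y\<bar>" by (rule abs_triangle_ineq)
    also have "\<dots> = lam * u + sqrt u * \<bar>y\<bar>" using assms lam_pos by (simp add: abs_mult)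
    also have "\<dots> \<le> lam * t + sqrt t * \<bar>y\<bar>"
      using assms lam_pos by (intro add_mono mult_mono) auto
    finally show "\<bar>lam * u + sqrt u * y\<bar> \<le> lam * t + sqrt t * \<bar>y\<bar>" .
  qed (use i in auto)
  also have "\<dots> = lam * t + sqrt t * (\<integral>y. \<bar>y\<bar> \<partial>\<N>)" using i by (simp add: N.prob_space[simplified])
  finally show ?thesis .
qed

text \<open>Justifies exchanging a time integral with an expectation: linear growth in
  \<open>X u\<close> and the uniform first moment bound make the absolute expectations bounded over
  \<open>{s..t}\<close>.\<close>

lemma integrable_time_space:
  assumes s: "0 \<le> s" and [measurable]: "(\<lambda>(u, \<omega>). \<phi> u \<omega>) \<in> borel_measurable (borel \<Otimes>\<^sub>M M)"
    and bound: "\<And>u \<omega>. s \<le> u \<Longrightarrow> u \<le> t \<Longrightarrow> \<omega> \<in> space M \<Longrightarrow> \<bar>\<phi> u \<omega>\<bar> \<le> a + b * \<bar>X u \<omega>\<bar>"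
  shows "integrable (lborel \<Otimes>\<^sub>M M) (\<lambda>(u, \<omega>). indicator {s..t} u * \<phi> u \<omega> :: real)"
proof -
  interpret pair_sigma_finite lborel M ..
  define c where "c = \<bar>a\<bar> + \<bar>b\<bar> * (lam * t + sqrt t * (\<integral>y. \<bar>y\<bar> \<partial>\<N>))"
  have int: "integrable M (\<phi> u)" if u: "u \<in> {s..t}" for u
  proof (rule Bochner_Integration.integrable_bound)
    show "integrable M (\<lambda>\<omega>. a + b * \<bar>X u \<omega>\<bar>)" using integrable_X[of u] s u by auto
    show "AE \<omega> in M. norm (\<phi> u \<omega>) \<le> norm (a + b * \<bar>X u \<omega>\<bar>)"
      using bound u by (auto intro!: AE_I2 order_trans[OF _ abs_ge_self])
  qed measurable
  have le: "(\<integral>\<omega>. \<bar>\<phi> u \<omega>\<bar> \<partial>M) \<le> c" if u: "u \<in> {s..t}" for u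
  proof -
    have "(\<integral>\<omega>. \<bar>\<phi> u \<omega>\<bar> \<partial>M) \<le> (\<integral>\<omega>. \<bar>a\<bar> + \<bar>b\<bar> * \<bar>X u \<omega>\<bar> \<partial>M)"
    proof (rule integral_mono)
      fix \<omega> assume "\<omega> \<in> space M"
      then have "\<bar>\<phi> u \<omega>\<bar> \<le> a + b * \<bar>X u \<omega>\<bar>" using bound u by auto
      also have "\<dots> \<le> \<bar>a\<bar> + \<bar>b\<bar> * \<bar>X u \<omega>\<bar>" by (intro add_mono mult_right_mono) auto
      finally show "\<bar>\<phi> u \<omega>\<bar> \<le> \<bar>a\<bar> + \<bar>b\<bar> * \<bar>X u \<omega>\<bar>" .
    qed (use int[OF u] integrable_X[of u] s u in auto)
    also have "\<dots> = \<bar>a\<bar> + \<bar>b\<bar> * expectation (\<lambda>\<omega>. \<bar>X u \<omega>\<bar>)"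
      using integrable_X[of u] s u by (simp add: prob_space)
    also have "\<dots> \<le> c"
      unfolding c_def using expectation_abs_X_le[of u t] s u by (auto intro!: add_left_mono mult_left_mono)
    finally show ?thesis .
  qed
  show ?thesis
  proof (rule Fubini_integrable)
    show "integrable lborel (\<lambda>u. \<integral>\<omega>. norm (case (u, \<omega>) of (u, \<omega>) \<Rightarrow> indicator {s..t} u * \<phi> u \<omega>) \<partial>M)"
    proof (rule Bochner_Integration.integrable_bound)
      show "integrable lborel (\<lambda>u. c * indicat_real {s..t} u)"
        by (intro integrable_mult_right integrable_real_indicator) (auto simp: emeasure_lborel_Icc_eq)
      show "AE u in lborel. norm (\<integral>\<omega>. norm (case (u, \<omega>) of (u, \<omega>) \<Rightarrow> indicator {s..t} u * \<phi> u \<omega>) \<partial>M) \<le> norm (c * indicat_real {s..t} u)"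
        using le by (intro AE_I2) (auto simp: indicator_def intro: order_trans[OF _ abs_ge_self])
    qed measurable
    show "AE u in lborel. integrable M (\<lambda>\<omega>. case (u, \<omega>) of (u, \<omega>) \<Rightarrow> indicator {s..t} u * \<phi> u \<omega>)"
      using int by (intro AE_I2) (auto simp: indicator_def)
  qed measurable
qed

text \<open>The pair of \<open>indicator C\<close> and \<open>X s\<close> is measurable for the
  past, hence independent of \<open>X t - X s\<close>, and the joint law is a product. Fubini then
  integrates out the increment.\<close>

lemma
  assumes st: "0 \<le> s" "s \<le> t" and C: "C \<in> sets (FX s)" and [measurable]: "k \<in> borel_measurable borel"
    and int: "integrable M (\<lambda>\<omega>. k (X t \<omega>) :: real)"
  shows markov: "(\<integral>\<omega>. indicator C \<omega> * k (X t \<omega>) \<partial>M)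
      = (\<integral>\<omega>. indicator C \<omega> * (\<integral>y. k (X s \<omega> + lam * (t - s) + sqrt (t - s) * y) \<partial>\<N>) \<partial>M)"
    and markov_integrable: "integrable M (\<lambda>\<omega>. indicator C \<omega> * (\<integral>y. k (X s \<omega> + lam * (t - s) + sqrt (t - s) * y) \<partial>\<N>))"
proof -
  interpret N: prob_space \<N> by (rule prob_space_std_normal)
  have C_M[measurable]: "C \<in> events" using C by (rule FX_subset)
  have intC: "integrable M (\<lambda>\<omega>. indicator C \<omega> * k (X t \<omega>))"
    using integrable_mult_indicator[OF C_M int] by simp
  have "(\<integral>\<omega>. indicator C \<omega> * k (X t \<omega>) \<partial>M)
      = (\<integral>\<omega>. indicator C \<omega> * (\<integral>y. k (X s \<omega> + lam * (t - s) + sqrt (t - s) * y) \<partial>\<N>) \<partial>M) \<and>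
    integrable M (\<lambda>\<omega>. indicator C \<omega> * (\<integral>y. k (X s \<omega> + lam * (t - s) + sqrt (t - s) * y) \<partial>\<N>))"
  proof (cases "s = t")
    case True
    then show ?thesis using intC by (simp add: N.prob_space[simplified])
  next
    case False
    with st have "s < t" by simp
    \<comment> \<open>Carrying the indicator of \<open>C\<close> as a coordinate turns conditioning
      on the past into an integral over a product of two laws.\<close>
    define Z where "Z \<omega> = (indicat_real C \<omega>, X s \<omega>)" for \<omega>
    define \<Delta> where "\<Delta> \<omega> = X t \<omega> - X s \<omega>" for \<omega>
    have Z[measurable]: "Z \<in> M \<rightarrow>\<^sub>M borel \<Otimes>\<^sub>M borel" unfolding Z_def by measurable
    have \<Delta>[measurable]: "\<Delta> \<in> borel_measurable M" unfolding \<Delta>_def by measurable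
    have Z_FX: "Z \<in> FX s \<rightarrow>\<^sub>M borel \<Otimes>\<^sub>M borel"
    proof -
      have [measurable]: "X s \<in> borel_measurable (FX s)" using st by (intro measurable_natural_filtration) auto
      have [measurable]: "C \<in> sets (FX s)" by fact
      show ?thesis unfolding Z_def by measurable
    qed
    have law: "distr M borel \<Delta> = distr \<N> borel (\<lambda>y. lam * (t - s) + sqrt (t - s) * y)"
      unfolding \<Delta>_def by (rule distr_increment) fact+
    interpret LZ: prob_space "distr M (borel \<Otimes>\<^sub>M borel) Z" by (rule prob_space_distr) simp
    interpret L\<Delta>: prob_space "distr M borel \<Delta>" by (rule prob_space_distr) simp
    have joint: "distr M (borel \<Otimes>\<^sub>M borel) Z \<Otimes>\<^sub>M distr M borel \<Delta>
        = distr M ((borel \<Otimes>\<^sub>M borel) \<Otimes>\<^sub>M borel) (\<lambda>\<omega>. (Z \<omega>, \<Delta> \<omega>))"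
    proof (rule pair_measure_eqI)
      fix A E assume "A \<in> sets (distr M (borel \<Otimes>\<^sub>M borel) Z)" "E \<in> sets (distr M borel \<Delta>)"
      then have A[measurable]: "A \<in> sets (borel \<Otimes>\<^sub>M borel)" and E[measurable]: "E \<in> sets borel" by auto
      have a: "Z -` A \<inter> space M \<in> sets (FX s)" using measurable_sets[OF Z_FX A] by simp
      have "prob (\<Delta> -` E \<inter> space M) = measure \<N> {y. lam * (t - s) + sqrt (t - s) * y \<in> E}"
        using indep_increment[OF st(1) \<open>s < t\<close> _ E, of "space M"] sets.top[of "FX s"]
        by (simp add: prob_space \<Delta>_def vimage_def Int_def conj_commute)
      then have "prob ((Z -` A \<inter> space M) \<inter> (\<Delta> -` E \<inter> space M)) = prob (Z -` A \<inter> space M) * prob (\<Delta> -` E \<inter> space M)"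
        using indep_increment[OF st(1) \<open>s < t\<close> a E]
        by (simp add: \<Delta>_def vimage_def Int_def conj_commute)
      moreover have "(\<lambda>\<omega>. (Z \<omega>, \<Delta> \<omega>)) -` (A \<times> E) \<inter> space M = (Z -` A \<inter> space M) \<inter> (\<Delta> -` E \<inter> space M)"
        by auto
      ultimately show "emeasure (distr M (borel \<Otimes>\<^sub>M borel) Z) A * emeasure (distr M borel \<Delta>) E
          = emeasure (distr M ((borel \<Otimes>\<^sub>M borel) \<Otimes>\<^sub>M borel) (\<lambda>\<omega>. (Z \<omega>, \<Delta> \<omega>))) (A \<times> E)"
        by (simp add: emeasure_distr emeasure_eq_measure ennreal_mult'[symmetric])
    qed (auto intro!: LZ.sigma_finite_measure L\<Delta>.sigma_finite_measure)
    interpret P: pair_sigma_finite "distr M (borel \<Otimes>\<^sub>M borel) Z" "distr M borel \<Delta>" ..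
    define g where "g p = (case p of ((c, x), d) \<Rightarrow> c * k (x + d))" for p :: "(real \<times> real) \<times> real"
    have g[measurable]: "g \<in> borel_measurable ((borel \<Otimes>\<^sub>M borel) \<Otimes>\<^sub>M borel)" unfolding g_def by measurable
    have g_eq: "g (Z \<omega>, \<Delta> \<omega>) = indicator C \<omega> * k (X t \<omega>)" for \<omega> by (simp add: g_def Z_def \<Delta>_def)
    have int_g: "integrable (distr M (borel \<Otimes>\<^sub>M borel) Z \<Otimes>\<^sub>M distr M borel \<Delta>) g"
      unfolding joint using intC by (subst integrable_distr_eq) (auto simp: g_eq)
    have inner: "(\<integral>d. g (Z \<omega>, d) \<partial>distr M borel \<Delta>)
        = indicator C \<omega> * (\<integral>y. k (X s \<omega> + lam * (t - s) + sqrt (t - s) * y) \<partial>\<N>)" for \<omega>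
      unfolding law by (subst integral_distr) (auto simp: g_def Z_def add.assoc)
    have "integrable (distr M (borel \<Otimes>\<^sub>M borel) Z) (\<lambda>q. \<integral>d. g (q, d) \<partial>distr M borel \<Delta>)"
      using P.integrable_fst'[OF int_g] by simp
    then have 1: "integrable M (\<lambda>\<omega>. \<integral>d. g (Z \<omega>, d) \<partial>distr M borel \<Delta>)"
      by (subst (asm) integrable_distr_eq) auto
    have "(\<integral>\<omega>. indicator C \<omega> * k (X t \<omega>) \<partial>M) = integral\<^sup>L (distr M (borel \<Otimes>\<^sub>M borel) Z \<Otimes>\<^sub>M distr M borel \<Delta>) g"
      unfolding joint by (subst integral_distr) (auto simp: g_eq)
    also have "\<dots> = (\<integral>q. (\<integral>d. g (q, d) \<partial>distr M borel \<Delta>) \<partial>distr M (borel \<Otimes>\<^sub>M borel) Z)"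
      using P.integral_fst'[OF int_g] by simp
    also have "\<dots> = (\<integral>\<omega>. (\<integral>d. g (Z \<omega>, d) \<partial>distr M borel \<Delta>) \<partial>M)"
      by (subst integral_distr) auto
    finally show ?thesis using 1 by (simp add: inner)
  qed
  then show "(\<integral>\<omega>. indicator C \<omega> * k (X t \<omega>) \<partial>M)
      = (\<integral>\<omega>. indicator C \<omega> * (\<integral>y. k (X s \<omega> + lam * (t - s) + sqrt (t - s) * y) \<partial>\<N>) \<partial>M)"
    "integrable M (\<lambda>\<omega>. indicator C \<omega> * (\<integral>y. k (X s \<omega> + lam * (t - s) + sqrt (t - s) * y) \<partial>\<N>))"
    by auto
qed

end

section \<open>The probability of a later visit\<close>

text \<open>Completing the square turns the weighted density into \<open>exp (c\<^sup>2 / 2)\<close>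
  times the normal density with mean \<open>c\<close>.\<close>

lemma
  shows integrable_exp_std_normal: "integrable \<N> (\<lambda>y. exp (c * y))"
    and integral_exp_std_normal: "(\<integral>y. exp (c * y) \<partial>\<N>) = exp (c\<^sup>2 / 2)"
proof -
  have *: "std_normal_density y * exp (c * y) = exp (c\<^sup>2 / 2) * normal_density c 1 y" for y
  proof -
    have "- y\<^sup>2 / 2 + c * y = c\<^sup>2 / 2 + - (y - c)\<^sup>2 / 2" by (simp add: power2_eq_square field_simps)
    then have "exp (- y\<^sup>2 / 2) * exp (c * y) = exp (c\<^sup>2 / 2) * exp (- (y - c)\<^sup>2 / 2)"
      by (simp only: exp_add[symmetric])
    then show ?thesis by (simp add: normal_density_def)
  qed
  show "integrable \<N> (\<lambda>y. exp (c * y))"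
    by (simp add: integrable_density *)
  show "(\<integral>y. exp (c * y) \<partial>\<N>) = exp (c\<^sup>2 / 2)"
    by (simp add: integral_density *)
qed

context drifted_paths
begin

text \<open>The exponential that is harmonic for \<open>f''/2 + lam f'\<close>, normalised to the
  value 1 at \<open>c\<close>. The level is a parameter because the upper bound is first obtained
  for levels above \<open>z\<close>.\<close>

definition scale_fun :: "real \<Rightarrow> real \<Rightarrow> real"
  where "scale_fun c x = exp (- 2 * lam * (x - c))"

lemma scale_measurable [measurable]: "scale_fun c \<in> borel_measurable borel"
  unfolding scale_fun_def by measurable

lemma scale_pos: "0 < scale_fun c x" by (simp add: scale_fun_def)

lemma scale_ge_1_iff: "1 \<le> scale_fun c x \<longleftrightarrow> x \<le> c"
  unfolding scale_fun_def using lam_pos by (simp add: mult_le_0_iff)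

lemma scale_split: "scale_fun c (x + r + v * y) = scale_fun c (x + r) * exp ((- 2 * lam * v) * y)"
  unfolding scale_fun_def by (simp add: exp_add[symmetric] algebra_simps)

lemma integrable_scale: "0 \<le> t \<Longrightarrow> integrable M (\<lambda>\<omega>. scale_fun c (X t \<omega>))"
proof -
  have "integrable \<N> (\<lambda>y. scale_fun c (0 + lam * t + sqrt t * y))"
    unfolding scale_split by (intro integrable_mult_right integrable_exp_std_normal)
  then show "0 \<le> t \<Longrightarrow> ?thesis" by (subst integrable_X_iff) auto
qed

lemma integrable_indicator_scale:
  "0 \<le> t \<Longrightarrow> A \<in> events \<Longrightarrow> integrable M (\<lambda>\<omega>. indicator A \<omega> * scale_fun c (X t \<omega>))"
  using integrable_mult_indicator[OF _ integrable_scale, of A t c] by simp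

text \<open>The Gaussian exponential moment contributes
  \<open>exp (2 * lam * (lam * (t - s)))\<close>, which cancels exactly against the effect of the
  drift on the exponent.\<close>

lemma scale_martingale:
  assumes "0 \<le> s" "s \<le> t" "C \<in> sets (FX s)"
  shows "(\<integral>\<omega>. indicator C \<omega> * scale_fun c (X t \<omega>) \<partial>M) = (\<integral>\<omega>. indicator C \<omega> * scale_fun c (X s \<omega>) \<partial>M)"
proof -
  have "(\<integral>y. scale_fun c (x + lam * (t - s) + sqrt (t - s) * y) \<partial>\<N>) = scale_fun c x" for x
  proof -
    have "(\<integral>y. scale_fun c (x + lam * (t - s) + sqrt (t - s) * y) \<partial>\<N>)
        = scale_fun c (x + lam * (t - s)) * exp ((- 2 * lam * sqrt (t - s))\<^sup>2 / 2)"
      unfolding scale_split by (simp only: integral_mult_right_zero integral_exp_std_normal)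
    also have "(- 2 * lam * sqrt (t - s))\<^sup>2 / 2 = 2 * lam * (lam * (t - s))"
      using assms by (simp add: power_mult_distrib power2_eq_square[of lam])
    also have "scale_fun c (x + lam * (t - s)) * exp (2 * lam * (lam * (t - s))) = scale_fun c x"
      unfolding scale_fun_def by (simp add: exp_add[symmetric] algebra_simps)
    finally show ?thesis .
  qed
  with markov[OF assms, of "scale_fun c"] integrable_scale[of t c] assms show ?thesis by simp
qed

text \<open>Summing the martingale property over finitely many disjoint pieces is optional stopping
  for the stopping time equal to \<open>t k\<close> on \<open>D k\<close>.\<close>

lemma
  fixes t :: "nat \<Rightarrow> real" and K :: nat
  assumes t: "\<And>k. k \<le> K \<Longrightarrow> 0 \<le> t k" "\<And>k. k \<le> K \<Longrightarrow> t k \<le> T"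
    and D: "\<And>k. k \<le> K \<Longrightarrow> D k \<in> sets (FX (t k))" and disj: "disjoint_family_on D {..K}"
  shows scale_stopping_le: "(\<And>k \<omega>. k \<le> K \<Longrightarrow> \<omega> \<in> D k \<Longrightarrow> scale_fun c (X (t k) \<omega>) \<le> b) \<Longrightarrow>
      (\<integral>\<omega>. indicator (\<Union>k\<le>K. D k) \<omega> * scale_fun c (X T \<omega>) \<partial>M) \<le> b * prob (\<Union>k\<le>K. D k)"
    and scale_stopping_ge: "(\<And>k \<omega>. k \<le> K \<Longrightarrow> \<omega> \<in> D k \<Longrightarrow> a \<le> scale_fun c (X (t k) \<omega>)) \<Longrightarrow>
      a * prob (\<Union>k\<le>K. D k) \<le> (\<integral>\<omega>. indicator (\<Union>k\<le>K. D k) \<omega> * scale_fun c (X T \<omega>) \<partial>M)"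
proof -
  have T: "0 \<le> T" using t(1)[of 0] t(2)[of 0] by simp
  have D_M[measurable]: "D k \<in> events" if "k \<le> K" for k using D[OF that] by (rule FX_subset)
  have "(\<integral>\<omega>. indicator (\<Union>k\<le>K. D k) \<omega> * scale_fun c (X T \<omega>) \<partial>M)
      = (\<integral>\<omega>. (\<Sum>k\<le>K. indicator (D k) \<omega> * scale_fun c (X T \<omega>)) \<partial>M)"
    by (intro Bochner_Integration.integral_cong refl)
       (simp add: indicator_UN_disjoint[OF finite_atMost disj] sum_distrib_right)
  also have "\<dots> = (\<Sum>k\<le>K. \<integral>\<omega>. indicator (D k) \<omega> * scale_fun c (X T \<omega>) \<partial>M)"
    using T D_M by (intro Bochner_Integration.integral_sum integrable_indicator_scale) auto
  also have "\<dots> = (\<Sum>k\<le>K. \<integral>\<omega>. indicator (D k) \<omega> * scale_fun c (X (t k) \<omega>) \<partial>M)"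
    using t D by (intro sum.cong refl scale_martingale) auto
  finally have eq: "(\<integral>\<omega>. indicator (\<Union>k\<le>K. D k) \<omega> * scale_fun c (X T \<omega>) \<partial>M)
      = (\<Sum>k\<le>K. \<integral>\<omega>. indicator (D k) \<omega> * scale_fun c (X (t k) \<omega>) \<partial>M)" .
  have P: "prob (\<Union>k\<le>K. D k) = (\<Sum>k\<le>K. prob (D k))"
    using D_M disj by (intro finite_measure_finite_Union) auto
  show "(\<integral>\<omega>. indicator (\<Union>k\<le>K. D k) \<omega> * scale_fun c (X T \<omega>) \<partial>M) \<le> b * prob (\<Union>k\<le>K. D k)"
    if b: "\<And>k \<omega>. k \<le> K \<Longrightarrow> \<omega> \<in> D k \<Longrightarrow> scale_fun c (X (t k) \<omega>) \<le> b"
    unfolding eq P sum_distrib_left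
  proof (rule sum_mono)
    fix k assume k: "k \<in> {..K}"
    have "(\<integral>\<omega>. indicator (D k) \<omega> * scale_fun c (X (t k) \<omega>) \<partial>M) \<le> (\<integral>\<omega>. b * indicator (D k) \<omega> \<partial>M)"
      using k t D_M b
      by (intro integral_mono integrable_mult_right integrable_real_indicator integrable_indicator_scale)
         (auto simp: indicator_def emeasure_eq_measure)
    then show "(\<integral>\<omega>. indicator (D k) \<omega> * scale_fun c (X (t k) \<omega>) \<partial>M) \<le> b * prob (D k)"
      using k D_M by simp
  qed
  show "a * prob (\<Union>k\<le>K. D k) \<le> (\<integral>\<omega>. indicator (\<Union>k\<le>K. D k) \<omega> * scale_fun c (X T \<omega>) \<partial>M)"
    if a: "\<And>k \<omega>. k \<le> K \<Longrightarrow> \<omega> \<in> D k \<Longrightarrow> a \<le> scale_fun c (X (t k) \<omega>)"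
    unfolding eq P sum_distrib_left
  proof (rule sum_mono)
    fix k assume k: "k \<in> {..K}"
    have "(\<integral>\<omega>. a * indicator (D k) \<omega> \<partial>M) \<le> (\<integral>\<omega>. indicator (D k) \<omega> * scale_fun c (X (t k) \<omega>) \<partial>M)"
      using k t D_M a
      by (intro integral_mono integrable_mult_right integrable_real_indicator integrable_indicator_scale)
         (auto simp: indicator_def emeasure_eq_measure)
    then show "a * prob (D k) \<le> (\<integral>\<omega>. indicator (D k) \<omega> * scale_fun c (X (t k) \<omega>) \<partial>M)"
      using k D_M by simp
  qed
qed

lemma X_sets_FX:
  assumes "0 \<le> s" "s \<le> t" and [measurable]: "A \<in> sets borel"
  shows "{\<omega> \<in> space M. X s \<omega> \<in> A} \<in> sets (FX t)"
proof -
  have "X s -` A \<inter> space (FX t) \<in> sets (FX t)"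
    by (rule measurable_sets[OF measurable_natural_filtration]) (use assms in auto)
  then show ?thesis by (simp add: vimage_def Int_def conj_commute)
qed

lemma X_eps_delta:
  assumes "\<omega> \<in> space M" "0 < e"
  obtains d where "0 < d" "\<And>s. \<bar>s - t\<bar> < d \<Longrightarrow> \<bar>X s \<omega> - X t \<omega>\<bar> < e"
proof -
  have "isCont (\<lambda>t. X t \<omega>) t" using X_cont[OF assms(1)] by (simp add: continuous_on_eq_continuous_at)
  then have "\<forall>e>0. \<exists>d>0. \<forall>s. \<bar>s - t\<bar> < d \<longrightarrow> \<bar>X s \<omega> - X t \<omega>\<bar> < e"
    by (simp add: continuous_at_eps_delta dist_real_def)
  then show thesis using that assms(2) by blast
qed

lemma first_hit_sets:
  fixes t :: "nat \<Rightarrow> real"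
  assumes t: "\<And>j. 0 \<le> t j" "mono t" and C: "C \<in> sets (FX (t 0))" and [measurable]: "A \<in> sets borel"
  shows "C \<inter> {\<omega> \<in> space M. (\<forall>j<k. c < X (t j) \<omega>) \<and> X (t k) \<omega> \<in> A} \<in> sets (FX (t k))"
proof -
  have "C \<in> sets (FX (t k))" by (rule FX_mono[OF C monoD[OF t(2)]]) simp
  moreover have "{\<omega> \<in> space (FX (t k)). (\<forall>j<k. c < X (t j) \<omega>) \<and> X (t k) \<omega> \<in> A} \<in> sets (FX (t k))"
  proof (rule sets.sets_Collect_conj)
    have "{\<omega> \<in> space (FX (t k)). \<forall>j\<in>{..<k}. c < X (t j) \<omega>} \<in> sets (FX (t k))"
    proof (rule sets.sets_Collect_finite_All)
      fix j assume "j \<in> {..<k}"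
      then show "{\<omega> \<in> space (FX (t k)). c < X (t j) \<omega>} \<in> sets (FX (t k))"
        using X_sets_FX[OF t(1) monoD[OF t(2), of j k], of "{c<..}"] by simp
    qed simp
    then show "{\<omega> \<in> space (FX (t k)). \<forall>j<k. c < X (t j) \<omega>} \<in> sets (FX (t k))"
      by (simp only: Ball_def lessThan_iff)
    show "{\<omega> \<in> space (FX (t k)). X (t k) \<omega> \<in> A} \<in> sets (FX (t k))"
      using X_sets_FX[OF t(1) order_refl assms(4)] by simp
  qed
  ultimately show ?thesis unfolding space_natural_filtration by (rule sets.Int)
qed

text \<open>Each set fixes \<open>k\<close> as the first grid index at which the path is at most
  \<open>c\<close>, and a path has only one such index.\<close>

lemma first_hit_disjoint: "disjoint_family_on (\<lambda>k. C \<inter> {\<omega> \<in> space M. (\<forall>j<k. c < X (t j) \<omega>) \<and> X (t k) \<omega> \<in> A \<inter> {..c}}) {..K::nat}"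
  unfolding disjoint_family_on_def
proof (intro ballI impI)
  fix m n :: nat assume "m \<noteq> n"
  then have "m < n \<or> n < m" by auto
  then show "C \<inter> {\<omega> \<in> space M. (\<forall>j<m. c < X (t j) \<omega>) \<and> X (t m) \<omega> \<in> A \<inter> {..c}} \<inter>
      (C \<inter> {\<omega> \<in> space M. (\<forall>j<n. c < X (t j) \<omega>) \<and> X (t n) \<omega> \<in> A \<inter> {..c}}) = {}"
    by (elim disjE) (fastforce dest: leD)+
qed

lemma first_hit_exists:
  assumes "k \<le> (K::nat)" "X (t k) \<omega> \<le> c"
  shows "\<exists>m\<le>K. (\<forall>j<m. c < X (t j) \<omega>) \<and> X (t m) \<omega> \<le> c"
proof -
  define m where "m = (LEAST m. X (t m) \<omega> \<le> c)"
  have "X (t m) \<omega> \<le> c" unfolding m_def using assms(2) by (rule LeastI)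
  moreover have "m \<le> k" unfolding m_def using assms(2) by (rule Least_le)
  moreover have "c < X (t j) \<omega>" if "j < m" for j
    using not_less_Least[OF that[unfolded m_def]] by simp
  ultimately show ?thesis using assms(1) by (intro exI[of _ m]) auto
qed

text \<open>The event \<open>\<sigma> > u\<close>, phrased through the path (see
  \<open>less_sigma_iff\<close>). Strictness makes it the union of \<open>later q\<close> over
  rational \<open>q > u\<close>, which gives measurability jointly in time.\<close>

definition later :: "real \<Rightarrow> 'w set"
  where "later u = {\<omega> \<in> space M. \<exists>t>u. X t \<omega> = z}"

text \<open>A grid cannot see an exact visit to \<open>z\<close>, but a continuous path visiting
  \<open>z\<close> stays below \<open>c\<close> for a while, and a fine grid detects that. At the
  first grid value at most \<open>c\<close> the exponential normalised at \<open>c\<close> is at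
  least 1, so optional stopping bounds the probability of detection.\<close>

lemma hit_upper_aux:
  assumes u: "0 \<le> u" and C: "C \<in> sets (FX u)" and c: "z < c"
  shows "prob (C \<inter> later u) \<le> (\<integral>\<omega>. indicator C \<omega> * scale_fun c (X u \<omega>) \<partial>M)"
proof -
  have C_M[measurable]: "C \<in> events" using C by (rule FX_subset)
  \<comment> \<open>Mesh \<open>1 / 2 ^ n\<close> and horizon \<open>u + n\<close> improve together;
    dyadic nesting makes the events \<open>H n\<close> increase.\<close>
  define \<tau> where "\<tau> n k = u + real k / 2 ^ n" for n k :: nat
  define H where "H n = C \<inter> {\<omega> \<in> space M. \<exists>k\<le>n * 2 ^ n. X (\<tau> n k) \<omega> \<le> c}" for n
  have H_M[measurable]: "H n \<in> events" for n unfolding H_def by measurable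
  have le: "prob (H n) \<le> (\<integral>\<omega>. indicator C \<omega> * scale_fun c (X u \<omega>) \<partial>M)" for n
  proof -
    define D where "D k = C \<inter> {\<omega> \<in> space M. (\<forall>j<k. c < X (\<tau> n j) \<omega>) \<and> X (\<tau> n k) \<omega> \<in> UNIV \<inter> {..c}}" for k
    have H_eq: "H n = (\<Union>k\<le>n * 2 ^ n. D k)"
    proof (intro equalityI subsetI)
      fix \<omega> assume "\<omega> \<in> H n"
      then obtain k where k: "\<omega> \<in> C" "\<omega> \<in> space M" "k \<le> n * 2 ^ n" "X (\<tau> n k) \<omega> \<le> c"
        by (auto simp: H_def)
      obtain m where "m \<le> n * 2 ^ n" "\<forall>j<m. c < X (\<tau> n j) \<omega>" "X (\<tau> n m) \<omega> \<le> c"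
        using first_hit_exists[of k "n * 2 ^ n" "\<tau> n" \<omega> c] k by blast
      with k show "\<omega> \<in> (\<Union>k\<le>n * 2 ^ n. D k)" by (intro UN_I[of m]) (simp_all add: D_def)
    next
      fix \<omega> assume "\<omega> \<in> (\<Union>k\<le>n * 2 ^ n. D k)"
      then obtain m where "m \<le> n * 2 ^ n" "\<omega> \<in> D m" by blast
      then show "\<omega> \<in> H n" unfolding H_def D_def by blast
    qed
    have \<tau>: "0 \<le> \<tau> n k" "mono (\<tau> n)" "\<tau> n 0 = u" for k
      using u by (auto simp: \<tau>_def mono_def divide_right_mono)
    have \<tau>_le: "\<tau> n k \<le> u + real n" if "k \<le> n * 2 ^ n" for k
    proof -
      have "real k \<le> real (n * 2 ^ n)" using that by (simp only: of_nat_le_iff)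
      then show ?thesis by (simp add: \<tau>_def divide_le_eq)
    qed
    have "1 * prob (\<Union>k\<le>n * 2 ^ n. D k) \<le> (\<integral>\<omega>. indicator (\<Union>k\<le>n * 2 ^ n. D k) \<omega> * scale_fun c (X (u + real n) \<omega>) \<partial>M)"
    proof (rule scale_stopping_ge[where t = "\<tau> n"])
      show "D k \<in> sets (FX (\<tau> n k))" for k
        unfolding D_def using \<tau> C by (intro first_hit_sets) auto
      show "disjoint_family_on D {..n * 2 ^ n}" unfolding D_def by (rule first_hit_disjoint)
    qed (use \<tau> \<tau>_le in \<open>auto simp: D_def scale_ge_1_iff\<close>)
    also have "\<dots> \<le> (\<integral>\<omega>. indicator C \<omega> * scale_fun c (X (u + real n) \<omega>) \<partial>M)"
      unfolding H_eq[symmetric] using u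
      by (intro integral_mono integrable_indicator_scale) (auto simp: H_def indicator_def less_imp_le[OF scale_pos])
    also have "\<dots> = (\<integral>\<omega>. indicator C \<omega> * scale_fun c (X u \<omega>) \<partial>M)"
      using u C by (intro scale_martingale) auto
    finally show ?thesis by (simp add: H_eq)
  qed
  have "incseq H"
  proof (rule incseq_SucI)
    fix n show "H n \<le> H (Suc n)"
    proof
      fix \<omega> assume "\<omega> \<in> H n"
      then obtain k where k: "\<omega> \<in> C" "\<omega> \<in> space M" "k \<le> n * 2 ^ n" "X (\<tau> n k) \<omega> \<le> c" by (auto simp: H_def)
      \<comment> \<open>Halving the mesh doubles the index of the same time.\<close>
      have "\<tau> (Suc n) (2 * k) = \<tau> n k" by (simp add: \<tau>_def)
      moreover have "2 * k \<le> Suc n * 2 ^ Suc n" using k(3) by simp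
      ultimately show "\<omega> \<in> H (Suc n)" using k unfolding H_def by (auto intro!: exI[of _ "2 * k"])
    qed
  qed
  then have "(\<lambda>n. prob (H n)) \<longlonglongrightarrow> prob (\<Union>n. H n)" by (intro finite_Lim_measure_incseq) auto
  then have "prob (\<Union>n. H n) \<le> (\<integral>\<omega>. indicator C \<omega> * scale_fun c (X u \<omega>) \<partial>M)"
    by (rule LIMSEQ_le_const2) (use le in auto)
  moreover have "C \<inter> later u \<subseteq> (\<Union>n. H n)"
  proof
    fix \<omega> assume \<omega>: "\<omega> \<in> C \<inter> later u"
    then obtain t where t: "\<omega> \<in> space M" "u < t" "X t \<omega> = z" by (auto simp: later_def)
    obtain d where d: "0 < d" "\<And>s. \<bar>s - t\<bar> < d \<Longrightarrow> \<bar>X s \<omega> - X t \<omega>\<bar> < c - z"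
      using X_eps_delta[OF t(1), of "c - z" t] c by auto
    obtain n1 where n1: "1 / 2 ^ n1 < d" using real_arch_pow_inv[of d "1/2"] d(1) by (auto simp: power_one_over)
    \<comment> \<open>Fine enough for the modulus \<open>d\<close> and long enough to reach
      \<open>t\<close>.\<close>
    define n where "n = max n1 (nat \<lceil>t - u\<rceil>)"
    have "1 / 2 ^ n \<le> (1 :: real) / 2 ^ n1" by (simp add: n_def field_simps)
    with n1 have n: "1 / 2 ^ n < d" by simp
    define k where "k = nat \<lfloor>(t - u) * 2 ^ n\<rfloor>"
    have k0: "real k = of_int \<lfloor>(t - u) * 2 ^ n\<rfloor>" unfolding k_def using t(2) by simp
    then have k1: "real k \<le> (t - u) * 2 ^ n" "(t - u) * 2 ^ n < real k + 1" by linarith+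
    have "t - u \<le> real n" by (simp add: n_def le_max_iff_disj) linarith
    then have "(t - u) * 2 ^ n \<le> real n * 2 ^ n" by (intro mult_right_mono) auto
    from order_trans[OF k1(1) this] have "real k \<le> real (n * 2 ^ n)" by simp
    then have k2: "k \<le> n * 2 ^ n" by (simp only: of_nat_le_iff)
    have "\<tau> n k - t = (real k - (t - u) * 2 ^ n) / 2 ^ n" by (simp add: \<tau>_def field_simps)
    then have "\<bar>\<tau> n k - t\<bar> = \<bar>real k - (t - u) * 2 ^ n\<bar> / 2 ^ n" by simp
    also have "\<dots> \<le> 1 / 2 ^ n" using k1 by (intro divide_right_mono) auto
    finally have "\<bar>X (\<tau> n k) \<omega> - X t \<omega>\<bar> < c - z" using n by (intro d(2)) simp
    then have "X (\<tau> n k) \<omega> \<le> c" using t(3) by linarith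
    with k2 t(1) \<omega> have "\<omega> \<in> H n" by (auto simp: H_def)
    then show "\<omega> \<in> (\<Union>n. H n)" by blast
  qed
  then have "prob (C \<inter> later u) \<le> prob (\<Union>n. H n)" by (intro finite_measure_mono) auto
  ultimately show ?thesis by linarith
qed

text \<open>Raising the level from \<open>z\<close> to \<open>z + \<delta>\<close> multiplies the
  exponential by \<open>exp (2 * lam * \<delta>)\<close>, which tends to 1 as
  \<open>\<delta>\<close> tends to 0.\<close>

lemma hit_upper:
  assumes u: "0 \<le> u" and C: "C \<in> sets (FX u)"
  shows "prob (C \<inter> later u) \<le> (\<integral>\<omega>. indicator C \<omega> * scale_fun z (X u \<omega>) \<partial>M)"
proof -
  let ?I = "\<integral>\<omega>. indicator C \<omega> * scale_fun z (X u \<omega>) \<partial>M"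
  have "(\<lambda>n. exp (2 * lam * (1 / real (Suc n))) * ?I) \<longlonglongrightarrow> exp (2 * lam * 0) * ?I"
    by (intro tendsto_intros LIMSEQ_Suc[OF lim_1_over_n])
  moreover have "prob (C \<inter> later u) \<le> exp (2 * lam * (1 / real (Suc n))) * ?I" for n
  proof -
    have "scale_fun (z + 1 / real (Suc n)) x = exp (2 * lam * (1 / real (Suc n))) * scale_fun z x" for x
      unfolding scale_fun_def by (simp add: exp_add[symmetric] algebra_simps del: of_nat_Suc)
    then have "(\<integral>\<omega>. indicator C \<omega> * scale_fun (z + 1 / real (Suc n)) (X u \<omega>) \<partial>M) = exp (2 * lam * (1 / real (Suc n))) * ?I"
      by (simp add: mult.left_commute[of "indicator C _"] del: of_nat_Suc)
    with hit_upper_aux[OF u C, of "z + 1 / real (Suc n)"] show ?thesis by simp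
  qed
  ultimately show ?thesis
    using LIMSEQ_le_const by fastforce
qed

text \<open>The truncation at 1 is essential: without it the expectation is constant in
  \<open>n\<close>, by the martingale property. With it, dominated convergence applies, as the
  exponential tends to 0 for each fixed normal variable.\<close>

lemma tendsto_expectation_min_scale:
  "(\<lambda>n. expectation (\<lambda>\<omega>. min 1 (scale_fun z (X (real n) \<omega>)))) \<longlonglongrightarrow> 0"
proof -
  interpret N: prob_space \<N> by (rule prob_space_std_normal)
  have "(\<lambda>n. \<integral>y. min 1 (scale_fun z (lam * real n + sqrt (real n) * y)) \<partial>\<N>) \<longlonglongrightarrow> (\<integral>y. (0::real) \<partial>\<N>)"
  proof (rule integral_dominated_convergence[where w = "\<lambda>_. 1"])
    show "AE y in \<N>. (\<lambda>n. min 1 (scale_fun z (lam * real n + sqrt (real n) * y))) \<longlonglongrightarrow> 0"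
    proof (rule AE_I2)
      fix y :: real
      have "filterlim (\<lambda>n. (2 * lam) * (- z + (lam * real n + sqrt (real n) * y))) at_top sequentially"
        using lam_pos
        by (intro filterlim_tendsto_pos_mult_at_top[OF tendsto_const] filterlim_tendsto_add_at_top[OF tendsto_const]
              filterlim_drift_at_top) auto
      then have "filterlim (\<lambda>n. - ((2 * lam) * (- z + (lam * real n + sqrt (real n) * y)))) at_bot sequentially"
        by (simp add: filterlim_uminus_at_bot)
      then have "(\<lambda>n. exp (- ((2 * lam) * (- z + (lam * real n + sqrt (real n) * y))))) \<longlonglongrightarrow> 0"
        by (rule filterlim_compose[OF exp_at_bot])
      then have "(\<lambda>n. scale_fun z (lam * real n + sqrt (real n) * y)) \<longlonglongrightarrow> 0"
        by (simp add: scale_fun_def algebra_simps)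
      then show "(\<lambda>n. min 1 (scale_fun z (lam * real n + sqrt (real n) * y))) \<longlonglongrightarrow> 0"
        using tendsto_min[OF tendsto_const[of "1::real"]] by fastforce
    qed
    show "AE y in \<N>. norm (min 1 (scale_fun z (lam * real n + sqrt (real n) * y))) \<le> 1" for n
      using scale_pos by (intro AE_I2) (simp add: min_def less_imp_le abs_of_pos)
  qed auto
  then show ?thesis by (subst expectation_X) auto
qed

text \<open>Reduction to rational times: on a compact interval
  \<open>\<bar>X t \<omega> - z\<bar>\<close> attains its minimum, so \<open>z\<close> is attained
  exactly when rational times come arbitrarily close to it.\<close>

lemma later_sets [measurable]: "later u \<in> events"
proof -
  have eq: "(\<exists>t\<in>{a..b}. X t \<omega> = z) \<longleftrightarrow> (\<forall>m::nat. \<exists>q\<in>\<rat> \<inter> {a..b}. \<bar>X q \<omega> - z\<bar> < 1 / real (Suc m))"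
    if ab: "a < b" and \<omega>: "\<omega> \<in> space M" for a b \<omega>
  proof
    assume "\<exists>t\<in>{a..b}. X t \<omega> = z"
    then obtain t where t: "a \<le> t" "t \<le> b" "X t \<omega> = z" by auto
    show "\<forall>m::nat. \<exists>q\<in>\<rat> \<inter> {a..b}. \<bar>X q \<omega> - z\<bar> < 1 / real (Suc m)"
    proof
      fix m :: nat
      obtain d where d: "0 < d" "\<And>s. \<bar>s - t\<bar> < d \<Longrightarrow> \<bar>X s \<omega> - X t \<omega>\<bar> < 1 / real (Suc m)"
        using X_eps_delta[OF \<omega>, of "1 / real (Suc m)" t] by auto
      have "max a (t - d) < min b (t + d)" using d(1) t ab by auto
      then obtain q where "q \<in> \<rat>" "max a (t - d) < q" "q < min b (t + d)" using Rats_dense_in_real by blast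
      then show "\<exists>q\<in>\<rat> \<inter> {a..b}. \<bar>X q \<omega> - z\<bar> < 1 / real (Suc m)"
        using d(2)[of q] t(3) by (intro bexI[of _ q]) auto
    qed
  next
    assume *: "\<forall>m::nat. \<exists>q\<in>\<rat> \<inter> {a..b}. \<bar>X q \<omega> - z\<bar> < 1 / real (Suc m)"
    have "\<exists>t\<in>{a..b}. \<forall>s\<in>{a..b}. \<bar>X t \<omega> - z\<bar> \<le> \<bar>X s \<omega> - z\<bar>"
      using ab continuous_on_subset[OF X_cont[OF \<omega>]]
      by (intro continuous_attains_inf) (auto intro!: continuous_intros)
    then obtain t where t: "t \<in> {a..b}" "\<And>s. s \<in> {a..b} \<Longrightarrow> \<bar>X t \<omega> - z\<bar> \<le> \<bar>X s \<omega> - z\<bar>" by blast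
    have "\<bar>X t \<omega> - z\<bar> \<le> 1 / real (Suc m)" for m
    proof -
      obtain q where "q \<in> {a..b}" "\<bar>X q \<omega> - z\<bar> < 1 / real (Suc m)" using * by blast
      with t(2)[of q] show ?thesis by linarith
    qed
    then have "\<bar>X t \<omega> - z\<bar> \<le> 0"
      by (intro LIMSEQ_le_const[OF LIMSEQ_Suc[OF lim_1_over_n]]) auto
    with t(1) show "\<exists>t\<in>{a..b}. X t \<omega> = z" by auto
  qed
  \<comment> \<open>The summand 2 keeps every interval nondegenerate, also for \<open>n = 0\<close>,
    so that its rational points are dense in it.\<close>
  have exh: "(\<exists>t>u. X t \<omega> = z) \<longleftrightarrow> (\<exists>n::nat. \<exists>t\<in>{u + 1 / real (Suc n)..u + real n + 2}. X t \<omega> = z)" for \<omega>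
  proof
    assume "\<exists>t>u. X t \<omega> = z"
    then obtain t where t: "u < t" "X t \<omega> = z" by auto
    obtain n1 where n1: "1 / real (Suc n1) < t - u" using nat_approx_posE[of "t - u"] t(1) by auto
    define n where "n = max n1 (nat \<lceil>t - u\<rceil>)"
    have "1 / real (Suc n) \<le> 1 / real (Suc n1)" by (simp add: n_def field_simps)
    moreover have "t - u \<le> real n" unfolding n_def by linarith
    ultimately show "\<exists>n::nat. \<exists>t\<in>{u + 1 / real (Suc n)..u + real n + 2}. X t \<omega> = z"
      using n1 t by (intro exI[of _ n] bexI[of _ t]) auto
  next
    assume "\<exists>n::nat. \<exists>t\<in>{u + 1 / real (Suc n)..u + real n + 2}. X t \<omega> = z"
    then obtain n :: nat and t where "u + 1 / real (Suc n) \<le> t" "X t \<omega> = z" by auto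
    moreover have "0 < 1 / real (Suc n)" by simp
    ultimately show "\<exists>t>u. X t \<omega> = z" by (intro exI[of _ t]) linarith
  qed
  have "u + 1 / real (Suc n) < u + real n + 2" for n
  proof -
    have "1 / real (Suc n) \<le> 1" by simp
    then show ?thesis by linarith
  qed
  then have "later u = {\<omega> \<in> space M. \<exists>n. \<forall>m::nat. \<exists>q\<in>\<rat> \<inter> {u + 1 / real (Suc n)..u + real n + 2}. \<bar>X q \<omega> - z\<bar> < 1 / real (Suc m)}"
    unfolding later_def exh using eq by (intro Collect_cong conj_cong refl) auto
  also have "\<dots> \<in> events"
  proof (intro sets.sets_Collect_countable_Ex sets.sets_Collect_countable_All sets.sets_Collect_countable_Ex')
    fix n m and q :: real
    show "{\<omega> \<in> space M. \<bar>X q \<omega> - z\<bar> < 1 / real (Suc m)} \<in> events" by measurable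
    show "countable (\<rat> \<inter> {u + 1 / real (Suc n)..u + real n + 2})" using countable_rat by blast
  qed
  finally show ?thesis .
qed

text \<open>On a fine grid the martingale exceeds \<open>1 + \<epsilon>\<close> at its first visit above \<open>1\<close> only on the event
  \<open>G n\<close>, which is eventually left by every continuous path.\<close>

lemma hit_lower:
  assumes u: "0 \<le> u" and C: "C \<in> sets (FX u)" and above: "\<And>\<omega>. \<omega> \<in> C \<Longrightarrow> z < X u \<omega>"
  shows "(\<integral>\<omega>. indicator C \<omega> * scale_fun z (X u \<omega>) \<partial>M) \<le> prob (C \<inter> later u)"
proof -
  let ?I = "\<integral>\<omega>. indicator C \<omega> * scale_fun z (X u \<omega>) \<partial>M"
  let ?P = "prob (C \<inter> later u)"
  have C_M[measurable]: "C \<in> events" using C by (rule FX_subset)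
  have bound: "?I \<le> (1 + \<epsilon>) * ?P + expectation (\<lambda>\<omega>. min 1 (scale_fun z (X (real N) \<omega>)))"
    if \<epsilon>: "0 < \<epsilon>" and N: "u < real N" for \<epsilon> and N :: nat
  proof -
    define \<tau> where "\<tau> n k = u + real k * ((real N - u) / real (Suc n))" for n k :: nat
    have \<tau>: "0 \<le> \<tau> n k" "mono (\<tau> n)" "\<tau> n 0 = u" "\<tau> n (Suc n) = real N" for n k
      using u N by (auto simp: \<tau>_def mono_def intro!: divide_right_mono mult_right_mono)
    have \<tau>_le: "\<tau> n k \<le> real N" if "k \<le> Suc n" for n k
      using monoD[OF \<tau>(2)[of n] that] \<tau>(4)[of n] by simp
    define D where "D A n k = C \<inter> {\<omega> \<in> space M. (\<forall>j<k. z < X (\<tau> n j) \<omega>) \<and> X (\<tau> n k) \<omega> \<in> A \<inter> {..z}}" for A n k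
    have D_FX: "D A n k \<in> sets (FX (\<tau> n k))" if [measurable]: "A \<in> sets borel" for A n k
      unfolding D_def using \<tau> C by (intro first_hit_sets) auto
    have D_M: "D A n k \<in> events" if "A \<in> sets borel" for A n k
      using D_FX[OF that] by (rule FX_subset)
    define near where "near = {x. scale_fun z x \<le> 1 + \<epsilon>}"
    have near[measurable]: "near \<in> sets borel" unfolding near_def by measurable
    define G where "G n = (\<Union>k\<le>Suc n. D (- near) n k)" for n
    have G[measurable]: "G n \<in> events" for n unfolding G_def using D_M by (intro sets.finite_UN) auto
    have main: "?I \<le> (1 + \<epsilon>) * ?P + (\<integral>\<omega>. indicator (G n) \<omega> * scale_fun z (X (real N) \<omega>) \<partial>M)
        + expectation (\<lambda>\<omega>. min 1 (scale_fun z (X (real N) \<omega>)))" for n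
    proof -
      define H where "H = (\<Union>k\<le>Suc n. D near n k)"
      have H[measurable]: "H \<in> events" unfolding H_def using D_M near by (intro sets.finite_UN) auto
      have int_min: "integrable M (\<lambda>\<omega>. min 1 (scale_fun z (X (real N) \<omega>)))"
        using scale_pos by (intro integrable_const_bound[of _ 1]) (auto intro!: AE_I2 simp: min_def less_imp_le)
      note ints = integrable_indicator_scale[OF of_nat_0_le_iff]
      have "?I = (\<integral>\<omega>. indicator C \<omega> * scale_fun z (X (real N) \<omega>) \<partial>M)"
        using u N C by (intro scale_martingale[symmetric]) auto
      also have "\<dots> \<le> (\<integral>\<omega>. indicator H \<omega> * scale_fun z (X (real N) \<omega>) + indicator (G n) \<omega> * scale_fun z (X (real N) \<omega>)
          + min 1 (scale_fun z (X (real N) \<omega>)) \<partial>M)"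
      proof (intro integral_mono Bochner_Integration.integrable_add ints int_min)
        fix \<omega> assume \<omega>: "\<omega> \<in> space M"
        \<comment> \<open>On \<open>C\<close> either the exponential is below 1 at time
          \<open>N\<close>, or a first grid visit exists, with a small overshoot (\<open>H\<close>)
          or a large one (\<open>G n\<close>). The first case is charged to the truncated
          expectation.\<close>
        have "indicator C \<omega> \<le> indicator H \<omega> + indicator (G n) \<omega> + (if scale_fun z (X (real N) \<omega>) < 1 then 1 else 0 :: real)"
        proof (cases "\<omega> \<in> C \<and> 1 \<le> scale_fun z (X (real N) \<omega>)")
          case True
          then have "X (\<tau> n (Suc n)) \<omega> \<le> z" using \<tau>(4)[of n] by (simp add: scale_ge_1_iff)
          then obtain m where m: "m \<le> Suc n" "\<forall>j<m. z < X (\<tau> n j) \<omega>" "X (\<tau> n m) \<omega> \<le> z"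
            using first_hit_exists[of "Suc n" "Suc n" "\<tau> n" \<omega> z] by blast
          then have "\<omega> \<in> D near n m \<or> \<omega> \<in> D (- near) n m" using True \<omega> by (auto simp: D_def)
          then have "\<omega> \<in> H \<or> \<omega> \<in> G n" using m(1) by (auto simp: H_def G_def)
          then show ?thesis by (auto simp: indicator_def)
        qed (auto simp: indicator_def)
        then have "indicator C \<omega> * scale_fun z (X (real N) \<omega>) \<le>
          (indicator H \<omega> + indicator (G n) \<omega> + (if scale_fun z (X (real N) \<omega>) < 1 then 1 else 0 :: real)) * scale_fun z (X (real N) \<omega>)"
          using scale_pos[of z "X (real N) \<omega>"] by (intro mult_right_mono) auto
        also have "\<dots> \<le> indicator H \<omega> * scale_fun z (X (real N) \<omega>) + indicator (G n) \<omega> * scale_fun z (X (real N) \<omega>)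
          + min 1 (scale_fun z (X (real N) \<omega>))"
          using scale_pos[of z "X (real N) \<omega>"] by (auto simp: min_def distrib_right)
        finally show "indicator C \<omega> * scale_fun z (X (real N) \<omega>) \<le>
          indicator H \<omega> * scale_fun z (X (real N) \<omega>) + indicator (G n) \<omega> * scale_fun z (X (real N) \<omega>)
          + min 1 (scale_fun z (X (real N) \<omega>))" .
      qed measurable
      also have "\<dots> = (\<integral>\<omega>. indicator H \<omega> * scale_fun z (X (real N) \<omega>) \<partial>M)
          + (\<integral>\<omega>. indicator (G n) \<omega> * scale_fun z (X (real N) \<omega>) \<partial>M)
          + expectation (\<lambda>\<omega>. min 1 (scale_fun z (X (real N) \<omega>)))"
        using ints[OF H] ints[OF G] int_min by simp
      also have "(\<integral>\<omega>. indicator H \<omega> * scale_fun z (X (real N) \<omega>) \<partial>M) \<le> (1 + \<epsilon>) * prob H"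
        unfolding H_def
      proof (rule scale_stopping_le[where t = "\<tau> n"])
        show "D near n k \<in> sets (FX (\<tau> n k))" for k by (rule D_FX) simp
        show "disjoint_family_on (D near n) {..Suc n}" unfolding D_def by (rule first_hit_disjoint)
      qed (use \<tau> \<tau>_le in \<open>auto simp: D_def near_def\<close>)
      also have "prob H \<le> ?P"
      proof (rule finite_measure_mono)
        show "H \<subseteq> C \<inter> later u"
        proof
          fix \<omega> assume "\<omega> \<in> H"
          then obtain k where k: "\<omega> \<in> C" "\<omega> \<in> space M" "X (\<tau> n k) \<omega> \<le> z" by (auto simp: H_def D_def)
          have uk: "u \<le> \<tau> n k" using monoD[OF \<tau>(2)[of n], of 0 k] \<tau>(3)[of n] by simp
          have "\<exists>s\<ge>u. s \<le> \<tau> n k \<and> X s \<omega> = z"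
            using k above[OF k(1)] uk continuous_on_subset[OF X_cont[OF k(2)]] by (intro IVT2') auto
          then obtain s where s: "u \<le> s" "X s \<omega> = z" by blast
          moreover have "s \<noteq> u" using s above[OF k(1)] by auto
          ultimately show "\<omega> \<in> C \<inter> later u" using k by (auto simp: later_def intro!: exI[of _ s])
        qed
      qed simp
      finally show ?thesis using \<epsilon> by (simp add: mult_left_mono)
    qed
    have "(\<lambda>n. \<integral>\<omega>. indicator (G n) \<omega> * scale_fun z (X (real N) \<omega>) \<partial>M) \<longlonglongrightarrow> (\<integral>\<omega>. 0 \<partial>M)"
    proof (rule integral_dominated_convergence[where w = "\<lambda>\<omega>. scale_fun z (X (real N) \<omega>)"])
      show "AE \<omega> in M. (\<lambda>n. indicator (G n) \<omega> * scale_fun z (X (real N) \<omega>)) \<longlonglongrightarrow> 0"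
      proof (rule AE_I2)
        fix \<omega> assume \<omega>: "\<omega> \<in> space M"
        have "continuous_on {u..real N} (\<lambda>t. scale_fun z (X t \<omega>))"
          unfolding scale_fun_def
          by (intro continuous_intros continuous_on_subset[OF X_cont[OF \<omega>]]) auto
        then have "uniformly_continuous_on {u..real N} (\<lambda>t. scale_fun z (X t \<omega>))"
          by (rule compact_uniformly_continuous) simp
        with \<epsilon> obtain d where d: "0 < d" "\<And>s t. s \<in> {u..real N} \<Longrightarrow> t \<in> {u..real N} \<Longrightarrow> \<bar>t - s\<bar> < d \<Longrightarrow>
            \<bar>scale_fun z (X t \<omega>) - scale_fun z (X s \<omega>)\<bar> < \<epsilon>"
          unfolding uniformly_continuous_on_def dist_real_def by metis
        have "(\<lambda>n. (real N - u) / real (Suc n)) \<longlonglongrightarrow> 0" by (rule LIMSEQ_Suc[OF lim_const_over_n])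
        then have "eventually (\<lambda>n. (real N - u) / real (Suc n) < d) sequentially" by (rule order_tendstoD) fact
        then have "eventually (\<lambda>n. \<omega> \<notin> G n) sequentially"
        proof eventually_elim
          case (elim n)
          show ?case
          proof
            assume "\<omega> \<in> G n"
            then obtain k where k: "k \<le> Suc n" "\<omega> \<in> C" "\<forall>j<k. z < X (\<tau> n j) \<omega>" "X (\<tau> n k) \<omega> \<le> z" "X (\<tau> n k) \<omega> \<notin> near"
              by (auto simp: G_def D_def)
            \<comment> \<open>On \<open>C\<close> the path starts above \<open>z\<close>, so there
              is a previous grid point. There the exponential is below 1 while at \<open>k\<close>
              it exceeds \<open>1 + \<epsilon>\<close>, against uniform continuity.\<close>
            have "k \<noteq> 0" using above[OF k(2)] k(4) \<tau>(3)[of n] by (cases "k = 0") auto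
            then obtain j where j: "k = Suc j" by (cases k) auto
            have "scale_fun z (X (\<tau> n j) \<omega>) < 1" using k(3) j scale_ge_1_iff[of z "X (\<tau> n j) \<omega>"] by (simp add: not_le[symmetric])
            moreover have "1 + \<epsilon> < scale_fun z (X (\<tau> n k) \<omega>)" using k(5) by (simp add: near_def)
            moreover have "\<bar>scale_fun z (X (\<tau> n k) \<omega>) - scale_fun z (X (\<tau> n j) \<omega>)\<bar> < \<epsilon>"
            proof (rule d(2))
              have "u \<le> \<tau> n i" for i using monoD[OF \<tau>(2)[of n], of 0 i] \<tau>(3)[of n] by simp
              then show "\<tau> n j \<in> {u..real N}" "\<tau> n k \<in> {u..real N}" using \<tau>_le[of k n] \<tau>_le[of j n] k(1) j by auto
              have "\<tau> n k - \<tau> n j = (real N - u) / real (Suc n)"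
                unfolding j \<tau>_def of_nat_Suc[of j] distrib_right by simp
              then show "\<bar>\<tau> n k - \<tau> n j\<bar> < d" using elim N by simp
            qed
            ultimately show False by linarith
          qed
        qed
        then show "(\<lambda>n. indicator (G n) \<omega> * scale_fun z (X (real N) \<omega>)) \<longlonglongrightarrow> 0"
          by (intro tendsto_eventually) (auto elim: eventually_mono)
      qed
      show "AE \<omega> in M. norm (indicator (G n) \<omega> * scale_fun z (X (real N) \<omega>)) \<le> scale_fun z (X (real N) \<omega>)" for n
        using less_imp_le[OF scale_pos] by (intro AE_I2) (auto simp: indicator_def)
    qed (use integrable_scale in auto)
    then have "(\<lambda>n. (1 + \<epsilon>) * ?P + (\<integral>\<omega>. indicator (G n) \<omega> * scale_fun z (X (real N) \<omega>) \<partial>M)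
        + expectation (\<lambda>\<omega>. min 1 (scale_fun z (X (real N) \<omega>))))
      \<longlonglongrightarrow> (1 + \<epsilon>) * ?P + 0 + expectation (\<lambda>\<omega>. min 1 (scale_fun z (X (real N) \<omega>)))"
      by (intro tendsto_add tendsto_const) simp
    then show ?thesis
      using LIMSEQ_le_const main by fastforce
  qed
  have "?I \<le> (1 + \<epsilon>) * ?P" if "0 < \<epsilon>" for \<epsilon>
  proof (rule LIMSEQ_le_const)
    show "(\<lambda>n. (1 + \<epsilon>) * ?P + expectation (\<lambda>\<omega>. min 1 (scale_fun z (X (real n) \<omega>)))) \<longlonglongrightarrow> (1 + \<epsilon>) * ?P"
      using tendsto_add[OF tendsto_const tendsto_expectation_min_scale, of "(1 + \<epsilon>) * ?P"] by simp
    have "u < real n" if "nat \<lceil>u\<rceil> + 1 \<le> n" for n using that by linarith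
    then show "\<exists>n0. \<forall>n\<ge>n0. ?I \<le> (1 + \<epsilon>) * ?P + expectation (\<lambda>\<omega>. min 1 (scale_fun z (X (real n) \<omega>)))"
      using bound[OF that] by blast
  qed
  \<comment> \<open>As a probability is at most 1, the relative error becomes an absolute
    one.\<close>
  moreover have "(1 + \<epsilon>) * ?P \<le> ?P + \<epsilon>" if "0 < \<epsilon>" for \<epsilon>
    using that prob_le_1[of "C \<inter> later u"] mult_left_mono[of ?P 1 \<epsilon>] by (simp add: distrib_right)
  ultimately have "?I \<le> ?P + \<epsilon>" if "0 < \<epsilon>" for \<epsilon> using that order_trans by blast
  then show ?thesis by (rule field_le_epsilon)
qed

text \<open>Below \<open>z\<close> the truncated exponential equals 1, so the probability of being
  there at time \<open>n\<close> is at most an expectation tending to 0. It follows that a path at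
  or below \<open>z\<close> almost surely returns to \<open>z\<close>.\<close>

lemma AE_exceeds: "AE \<omega> in M. \<exists>n>m. z \<le> X (real n) \<omega>"
proof -
  define Q where "Q n = {\<omega> \<in> space M. X (real n) \<omega> < z}" for n :: nat
  have [measurable]: "Q n \<in> events" for n unfolding Q_def by measurable
  have "prob (Q n) \<le> expectation (\<lambda>\<omega>. min 1 (scale_fun z (X (real n) \<omega>)))" for n
  proof -
    have "prob (Q n) = expectation (indicator (Q n))" by simp
    also have "\<dots> \<le> expectation (\<lambda>\<omega>. min 1 (scale_fun z (X (real n) \<omega>)))"
    proof (rule integral_mono)
      show "integrable M (\<lambda>\<omega>. min 1 (scale_fun z (X (real n) \<omega>)))"
        using scale_pos by (intro integrable_const_bound[of _ 1]) (auto intro!: AE_I2 simp: min_def less_imp_le)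
      fix \<omega>
      show "indicator (Q n) \<omega> \<le> min 1 (scale_fun z (X (real n) \<omega>))"
        using scale_ge_1_iff[of z "X (real n) \<omega>"] scale_pos[of z "X (real n) \<omega>"]
        by (auto simp: indicator_def Q_def)
    qed (simp add: emeasure_eq_measure)
    finally show ?thesis .
  qed
  moreover have "prob (\<Inter>n\<in>{m<..}. Q n) \<le> prob (Q n)" if "m < n" for n
    using that by (intro finite_measure_mono) auto
  ultimately have "prob (\<Inter>n\<in>{m<..}. Q n) \<le> 0"
    by (intro LIMSEQ_le_const[OF tendsto_expectation_min_scale] exI[of _ "Suc m"])
       (auto intro: order_trans simp: Suc_le_eq)
  then have "prob (\<Inter>n\<in>{m<..}. Q n) = 0" using measure_nonneg[of M "\<Inter>n\<in>{m<..}. Q n"] by linarith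
  then have "(\<Inter>n\<in>{m<..}. Q n) \<in> null_sets M"
    by (intro null_setsI) (auto simp: emeasure_eq_measure)
  then have "AE \<omega> in M. \<omega> \<notin> (\<Inter>n\<in>{m<..}. Q n)" by (rule AE_not_in)
  then show ?thesis
    using AE_space by eventually_elim (auto simp: Q_def not_less)
qed

text \<open>A nondegenerate Gaussian law has no atoms. This is why identities for the generator may
  fail at \<open>z\<close>, and why \<open>\<xi> t \<noteq> z\<close> decides whether a visit is
  still to come.\<close>

lemma AE_X_neq:
  assumes "0 < t"
  shows "AE \<omega> in M. X t \<omega> \<noteq> c"
proof -
  interpret N: prob_space \<N> by (rule prob_space_std_normal)
  have "AE y in lborel. y \<noteq> (c - lam * t) / sqrt t" by (rule AE_lborel_singleton)
  then have "AE y in \<N>. y \<noteq> (c - lam * t) / sqrt t" by (subst AE_density) (auto elim: eventually_mono)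
  then have "AE y in \<N>. indicat_real {c} (lam * t + sqrt t * y) = 0"
    by eventually_elim (use assms in \<open>auto simp: indicator_def field_simps\<close>)
  then have "(\<integral>y. indicat_real {c} (lam * t + sqrt t * y) \<partial>\<N>) = 0"
    by (subst integral_cong_AE[where g = "\<lambda>_. 0"]) auto
  then have "expectation (\<lambda>\<omega>. indicat_real {c} (X t \<omega>)) = 0"
    using assms by (subst expectation_X) auto
  then have "AE \<omega> in M. indicat_real {c} (X t \<omega>) = 0"
    by (subst (asm) integral_nonneg_eq_0_iff_AE) (auto intro!: integrable_const_bound[of _ 1])
  then show ?thesis by eventually_elim (auto simp: indicator_def split: if_splits)
qed

text \<open>\<open>survival (X u)\<close> is the conditional probability of a visit after
  \<open>u\<close>, the Azema supermartingale of the last passage time.\<close>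

definition survival :: "real \<Rightarrow> real"
  where "survival x = min 1 (scale_fun z x)"

lemma survival_measurable [measurable]: "survival \<in> borel_measurable borel"
  unfolding survival_def by measurable

lemma survival_nonneg: "0 \<le> survival x" and survival_le_1: "survival x \<le> 1"
  using scale_pos[of z x] by (auto simp: survival_def)

text \<open>Split \<open>C\<close> by the position at time \<open>u\<close>. At or below
  \<open>z\<close> a later visit is almost sure by the intermediate value theorem; above
  \<open>z\<close> the two optional stopping bounds coincide.\<close>

theorem prob_later:
  assumes u: "0 \<le> u" and C: "C \<in> sets (FX u)"
  shows "prob (C \<inter> later u) = (\<integral>\<omega>. indicator C \<omega> * survival (X u \<omega>) \<partial>M)"
proof -
  define Lo where "Lo = C \<inter> {\<omega> \<in> space M. X u \<omega> \<in> {..z}}"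
  define Hi where "Hi = C \<inter> {\<omega> \<in> space M. X u \<omega> \<in> {z<..}}"
  have C_M[measurable]: "C \<in> events" using C by (rule FX_subset)
  have Lo_FX: "Lo \<in> sets (FX u)" and Hi_FX: "Hi \<in> sets (FX u)"
    unfolding Lo_def Hi_def by (intro sets.Int C X_sets_FX u order_refl; simp)+
  have [measurable]: "Lo \<in> events" "Hi \<in> events" using Lo_FX Hi_FX by (auto dest: FX_subset)
  have C_eq: "C = Lo \<union> Hi" "Lo \<inter> Hi = {}" using sets.sets_into_space[OF C_M] by (auto simp: Lo_def Hi_def)
  have "prob (Lo \<inter> later u) = prob Lo"
  proof (rule measure_eq_AE)
    have "AE \<omega> in M. X u \<omega> \<noteq> z"
    proof (cases "u = 0")
      case True
      then show ?thesis using z_pos by (intro AE_I2) (simp add: X_0)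
    qed (use u AE_X_neq in auto)
    with AE_exceeds[of "nat \<lceil>u\<rceil>"] show "AE \<omega> in M. \<omega> \<in> Lo \<inter> later u \<longleftrightarrow> \<omega> \<in> Lo"
    proof eventually_elim
      case (elim \<omega>)
      show ?case
      proof
        assume Lo: "\<omega> \<in> Lo"
        from elim obtain n where n: "nat \<lceil>u\<rceil> < n" "z \<le> X (real n) \<omega>" by auto
        have un: "u \<le> real n" using n(1) by linarith
        have "\<exists>s\<ge>u. s \<le> real n \<and> X s \<omega> = z"
          using Lo n un continuous_on_subset[OF X_cont[of \<omega>]] by (intro IVT') (auto simp: Lo_def)
        then obtain s where s: "u \<le> s" "X s \<omega> = z" by blast
        \<comment> \<open>\<open>later\<close> asks for a visit strictly after \<open>u\<close>, so
          paths sitting at \<open>z\<close> at time \<open>u\<close> had to be discarded.\<close>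
        moreover have "s \<noteq> u" using s elim by auto
        ultimately show "\<omega> \<in> Lo \<inter> later u" using Lo by (auto simp: Lo_def later_def intro!: exI[of _ s])
      qed auto
    qed
  qed auto
  also have "\<dots> = (\<integral>\<omega>. indicator Lo \<omega> * survival (X u \<omega>) \<partial>M)"
  proof -
    have "prob Lo = expectation (indicator Lo)" by simp
    also have "\<dots> = (\<integral>\<omega>. indicator Lo \<omega> * survival (X u \<omega>) \<partial>M)"
      using scale_ge_1_iff[of z]
      by (intro Bochner_Integration.integral_cong) (auto simp: Lo_def survival_def indicator_def min_def)
    finally show ?thesis .
  qed
  finally have lo: "prob (Lo \<inter> later u) = (\<integral>\<omega>. indicator Lo \<omega> * survival (X u \<omega>) \<partial>M)" .
  have "prob (Hi \<inter> later u) = (\<integral>\<omega>. indicator Hi \<omega> * scale_fun z (X u \<omega>) \<partial>M)"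
    by (rule antisym[OF hit_upper[OF u Hi_FX] hit_lower[OF u Hi_FX]]) (auto simp: Hi_def)
  also have "\<dots> = (\<integral>\<omega>. indicator Hi \<omega> * survival (X u \<omega>) \<partial>M)"
    using scale_ge_1_iff[of z]
    by (intro Bochner_Integration.integral_cong) (auto simp: Hi_def survival_def indicator_def min_def not_le[symmetric])
  finally have hi: "prob (Hi \<inter> later u) = (\<integral>\<omega>. indicator Hi \<omega> * survival (X u \<omega>) \<partial>M)" .
  have int: "integrable M (\<lambda>\<omega>. indicator A \<omega> * survival (X u \<omega>))" if [measurable]: "A \<in> events" for A
    using survival_nonneg survival_le_1
    by (intro integrable_const_bound[of _ 1]) (auto intro!: AE_I2 simp: indicator_def)
  have "C \<inter> later u = (Lo \<inter> later u) \<union> (Hi \<inter> later u)" using C_eq by blast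
  then have "prob (C \<inter> later u) = prob (Lo \<inter> later u) + prob (Hi \<inter> later u)"
    using C_eq by (simp only:) (intro finite_measure_Union, auto)
  also have "\<dots> = (\<integral>\<omega>. indicator Lo \<omega> * survival (X u \<omega>) + indicator Hi \<omega> * survival (X u \<omega>) \<partial>M)"
    unfolding lo hi by (intro Bochner_Integration.integral_add[symmetric] int) auto
  also have "\<dots> = (\<integral>\<omega>. indicator C \<omega> * survival (X u \<omega>) \<partial>M)"
    using C_eq by (intro Bochner_Integration.integral_cong) (auto simp: indicator_def)
  finally show ?thesis .
qed

end

section \<open>The stopped process and its filtration\<close>

text \<open>\<open>ennreal\<close> truncates negative times to 0, hence the \<open>max\<close>; the
  infinite value is separated because \<open>enn2real \<top> = 0\<close>.\<close>

lemma stop_at_eq: "stop_at t c = (if c = \<top> then max 0 t else min (max 0 t) (enn2real c))"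
proof (cases c)
  case (real r)
  then have "min (ennreal t) c = ennreal (min (max 0 t) r)"
    by (auto simp: min_def max_def ennreal_neg ennreal_le_iff)
  then show ?thesis using real by (simp add: stop_at_def)
next
  case top
  then show ?thesis by (simp add: stop_at_def max_def ennreal_neg)
qed

lemma stop_at_nonneg: "0 \<le> stop_at t c"
  by (simp add: stop_at_def)

lemma stop_at_mono: "s \<le> t \<Longrightarrow> stop_at s c \<le> stop_at t c"
  by (auto simp: stop_at_eq)

lemma continuous_on_stop_at: "continuous_on UNIV (\<lambda>t. stop_at t c)"
  by (cases "c = \<top>") (auto simp: stop_at_eq intro!: continuous_intros)

context drifted_paths
begin

definition \<sigma> :: "'w \<Rightarrow> ennreal"
  where "\<sigma> = last_passage X z"

definition \<xi> :: "real \<Rightarrow> 'w \<Rightarrow> real"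
  where "\<xi> = stopped_at_last_passage X z"

lemma later_antimono: "s \<le> t \<Longrightarrow> later t \<subseteq> later s"
  unfolding later_def by force

lemma less_sigma_iff:
  assumes "\<omega> \<in> space M" "0 \<le> u"
  shows "ennreal u < \<sigma> \<omega> \<longleftrightarrow> \<omega> \<in> later u"
  using assms unfolding \<sigma>_def last_passage_def less_SUP_iff later_def
  by (auto simp: ennreal_less_iff intro: less_imp_le order_le_less_trans)

text \<open>All visits lie in \<open>{0..t}\<close> and form a compact set, nonempty by
  \<open>hits\<close>, so the supremum is a maximum. Time 0 is no visit because
  \<open>X 0 \<omega> = 0 < z\<close>.\<close>

lemma sigma_attained:
  assumes \<omega>: "\<omega> \<in> space M" and t: "0 \<le> t" "\<omega> \<notin> later t"
  obtains s where "0 < s" "s \<le> t" "X s \<omega> = z" "\<sigma> \<omega> = ennreal s"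
proof -
  define S where "S = {s \<in> {0..t}. X s \<omega> = z}"
  have S: "0 < s \<and> X s \<omega> = z \<longleftrightarrow> s \<in> S" for s
  proof
    assume s: "0 < s \<and> X s \<omega> = z"
    then show "s \<in> S" using t(2) \<omega> by (auto simp: S_def later_def not_less)
  next
    assume s: "s \<in> S"
    moreover have "s \<noteq> 0" using s X_0[OF \<omega>] z_pos by (auto simp: S_def)
    ultimately show "0 < s \<and> X s \<omega> = z" by (auto simp: S_def)
  qed
  have "closed S"
  proof -
    have "continuous_on {0..t} (\<lambda>s. X s \<omega>)" using continuous_on_subset[OF X_cont[OF \<omega>]] by auto
    then have "closed ({0..t} \<inter> (\<lambda>s. X s \<omega>) -` {z})" by (rule continuous_closed_preimage) auto
    moreover have "S = {0..t} \<inter> (\<lambda>s. X s \<omega>) -` {z}" by (auto simp: S_def)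
    ultimately show ?thesis by simp
  qed
  then have "compact ({0..t} \<inter> S)" by (rule compact_Int_closed[OF compact_Icc])
  moreover have "{0..t} \<inter> S = S" unfolding S_def by blast
  ultimately have "compact S" by simp
  moreover have "S \<noteq> {}" using hits[OF \<omega>] S by blast
  ultimately have "\<exists>s\<in>S. \<forall>r\<in>S. r \<le> s" by (rule compact_attains_sup)
  then obtain s where s: "s \<in> S" "\<And>r. r \<in> S \<Longrightarrow> r \<le> s" by blast
  have "\<sigma> \<omega> = ennreal s"
    unfolding \<sigma>_def last_passage_def S Collect_mem_eq
    by (intro antisym SUP_least SUP_upper ennreal_leI s)
  moreover have "s \<le> t" using s(1) by (simp add: S_def)
  ultimately show thesis using that[of s] S[of s] s(1) by simp
qed

lemma stop_at_later: "\<omega> \<in> later t \<Longrightarrow> 0 \<le> t \<Longrightarrow> stop_at t (\<sigma> \<omega>) = t"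
  using less_sigma_iff[of \<omega> t] by (simp add: stop_at_def later_def min_def less_imp_le)

lemma xi_eq:
  assumes \<omega>: "\<omega> \<in> space M" and t: "0 \<le> t"
  shows "\<xi> t \<omega> = (if \<omega> \<in> later t then X t \<omega> else z)"
proof (cases "\<omega> \<in> later t")
  case True
  then show ?thesis using stop_at_later[OF True t] by (simp add: \<xi>_def stopped_at_last_passage_def \<sigma>_def)
next
  case False
  from \<omega> t False obtain s where "0 < s" "s \<le> t" "X s \<omega> = z" "\<sigma> \<omega> = ennreal s" by (rule sigma_attained)
  then show ?thesis using False t
    by (simp add: \<xi>_def stopped_at_last_passage_def \<sigma>_def stop_at_eq min_def)
qed

lemma xi_0: "\<omega> \<in> space M \<Longrightarrow> \<xi> 0 \<omega> = 0"
  by (simp add: \<xi>_def stopped_at_last_passage_def stop_at_def X_0)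

lemma xi_cont: "\<omega> \<in> space M \<Longrightarrow> continuous_on UNIV (\<lambda>t. \<xi> t \<omega>)"
  unfolding \<xi>_def stopped_at_last_passage_def
  by (rule continuous_on_compose2[OF X_cont continuous_on_stop_at]) auto

lemma xi_neg: "t \<le> 0 \<Longrightarrow> \<xi> t \<omega> = \<xi> 0 \<omega>"
  by (simp add: \<xi>_def stopped_at_last_passage_def stop_at_eq)

lemma xi_measurable_nonneg: "0 \<le> t \<Longrightarrow> \<xi> t \<in> borel_measurable M"
  by (rule measurable_cong[THEN iffD1, of M "\<lambda>\<omega>. if \<omega> \<in> later t then X t \<omega> else z"])
     (auto simp: xi_eq)

lemma xi_measurable [measurable]: "\<xi> t \<in> borel_measurable M"
proof (cases "0 \<le> t")
  case False
  then have "\<xi> t = \<xi> 0" by (intro ext xi_neg) simp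
  then show ?thesis using xi_measurable_nonneg[of 0] by simp
qed (rule xi_measurable_nonneg)

lemma xi_pair_measurable [measurable]: "(\<lambda>(t, \<omega>). \<xi> t \<omega>) \<in> borel_measurable (borel \<Otimes>\<^sub>M M)"
  by (rule pair_measurable_continuous_process) (auto simp: xi_cont)

text \<open>Between \<open>u\<close> and a later visit there is a rational \<open>q\<close>, so the
  set is a countable union of rectangles \<open>{..<q} \<times> later q\<close>.\<close>

lemma later_pair_measurable [measurable]:
  "(\<lambda>(u, \<omega>). indicat_real (later u) \<omega>) \<in> borel_measurable (borel \<Otimes>\<^sub>M M)"
proof -
  have "{p \<in> space (borel \<Otimes>\<^sub>M M). snd p \<in> later (fst p)} = (\<Union>q\<in>\<rat>. {..<q} \<times> later q)"
  proof (intro equalityI subsetI)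
    fix p assume "p \<in> {p \<in> space (borel \<Otimes>\<^sub>M M). snd p \<in> later (fst p)}"
    then obtain t where t: "fst p < t" "X t (snd p) = z" "snd p \<in> space M" by (auto simp: later_def)
    obtain q where "q \<in> \<rat>" "fst p < q" "q < t" using Rats_dense_in_real[OF t(1)] by blast
    with t show "p \<in> (\<Union>q\<in>\<rat>. {..<q} \<times> later q)" by (intro UN_I[of q]) (auto simp: later_def mem_Times_iff)
  next
    fix p assume "p \<in> (\<Union>q\<in>\<rat>. {..<q} \<times> later q)"
    then obtain q where "fst p < q" "snd p \<in> later q" by (auto simp: mem_Times_iff)
    then show "p \<in> {p \<in> space (borel \<Otimes>\<^sub>M M). snd p \<in> later (fst p)}"
      by (auto simp: later_def space_pair_measure mem_Times_iff intro: order_less_trans)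
  qed
  also have "\<dots> \<in> sets (borel \<Otimes>\<^sub>M M)"
    by (intro sets.countable_UN' countable_rat pair_measureI) auto
  finally have [measurable]: "{p \<in> space (borel \<Otimes>\<^sub>M M). snd p \<in> later (fst p)} \<in> sets (borel \<Otimes>\<^sub>M M)" .
  have "(\<lambda>p. indicat_real {p \<in> space (borel \<Otimes>\<^sub>M M). snd p \<in> later (fst p)} p) \<in> borel_measurable (borel \<Otimes>\<^sub>M M)"
    by measurable
  then show ?thesis
    by (rule measurable_cong[THEN iffD1, rotated]) (auto simp: indicator_def)
qed

text \<open>The integrand is 1 before \<open>\<sigma>\<close> and 0 from then on. As a time
  integral, the stopped clock can be merged with the one in the second Dynkin formula.\<close>

lemma stop_at_eq_integral:
  assumes \<omega>: "\<omega> \<in> space M" and t: "0 \<le> t"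
  shows "stop_at t (\<sigma> \<omega>) = (\<integral>u. indicator {0..t} u * indicat_real (later u) \<omega> \<partial>lborel)"
proof (cases "\<omega> \<in> later t")
  case True
  then have eq: "indicat_real {0..t} u * indicat_real (later u) \<omega> = indicator {0..t} u" for u
    using later_antimono[of u t] by (auto simp: indicator_def)
  show ?thesis unfolding eq using True t by (simp add: stop_at_later)
next
  case False
  from \<omega> t False obtain s where s: "0 < s" "s \<le> t" "X s \<omega> = z" "\<sigma> \<omega> = ennreal s" by (rule sigma_attained)
  \<comment> \<open>Half-open because \<open>s\<close> is the last visit: at \<open>u = s\<close> no
    strictly later one is left.\<close>
  have eq: "indicat_real {0..t} u * indicat_real (later u) \<omega> = indicator {0..<s} u" for u
    using less_sigma_iff[OF \<omega>, of u] s by (auto simp: indicator_def ennreal_less_iff)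
  show ?thesis unfolding eq using s t by (simp add: stop_at_eq)
qed

text \<open>The sets with this property form a sigma-algebra. It contains the generators because
  \<open>later s\<close> is contained in \<open>later r\<close> for \<open>r \<le> s\<close>, where
  \<open>\<xi> r\<close> and \<open>X r\<close> agree, and null sets belong to both
  filtrations.\<close>

lemma natural_filtration_xi_trace:
  assumes s: "0 \<le> s" and A: "A \<in> sets (natural_filtration M \<xi> s)"
  shows "\<exists>C\<in>sets (FX s). A \<inter> later s = C \<inter> later s"
  using A unfolding sets_natural_filtration[of M \<xi>]
proof induction
  case (Basic a)
  then show ?case
  proof
    assume "a \<in> {\<xi> r -` E \<inter> space M |r E. 0 \<le> r \<and> r \<le> s \<and> E \<in> sets borel}"
    then obtain r E where a: "a = \<xi> r -` E \<inter> space M" and r: "0 \<le> r" "r \<le> s" and E: "E \<in> sets borel" by blast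
    have "a \<inter> later s = {\<omega> \<in> space M. X r \<omega> \<in> E} \<inter> later s"
      using later_antimono[OF r(2)] r(1) by (auto simp: a xi_eq)
    with X_sets_FX[OF r E] show ?case by blast
  next
    assume "a \<in> null_sets M"
    then show ?case using null_sets_natural_filtration by blast
  qed
next
  case Empty
  then show ?case by auto
next
  case (Compl a)
  then obtain C where "C \<in> sets (FX s)" "a \<inter> later s = C \<inter> later s" by blast
  then show ?case
    using sets.compl_sets[of C "FX s"] by (intro bexI[of _ "space M - C"]) auto
next
  case (Union a)
  then obtain C where "\<And>i. C i \<in> sets (FX s)" "\<And>i. a i \<inter> later s = C i \<inter> later s" by metis
  then show ?case by (intro bexI[of _ "\<Union>i. C i"]) auto
qed

lemma subalgebra_FX: "subalgebra M (FX u)"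
  by (rule subalgebra_natural_filtration) simp

text \<open>Extends \<open>prob_later\<close> from events to integrable weights by reading it as the
  conditional expectation of the indicator of \<open>later u\<close>.\<close>

lemma expectation_later:
  assumes u: "0 \<le> u" and f[measurable]: "f \<in> borel_measurable (FX u)" and int: "integrable M f"
  shows "expectation (\<lambda>\<omega>. f \<omega> * indicator (later u) \<omega>) = expectation (\<lambda>\<omega>. f \<omega> * survival (X u \<omega>))"
proof -
  interpret sub: finite_measure_subalgebra M "FX u"
    by unfold_locales (rule subalgebra_FX)
  have [measurable]: "X u \<in> borel_measurable (FX u)" using u by (intro measurable_natural_filtration) auto
  have "AE \<omega> in M. real_cond_exp M (FX u) (indicator (later u)) \<omega> = survival (X u \<omega>)"
  proof (rule sub.real_cond_exp_charact)
    fix A assume A: "A \<in> sets (FX u)"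
    then have [measurable]: "A \<in> events" by (rule FX_subset)
    have "(\<integral>\<omega>\<in>A. indicator (later u) \<omega> \<partial>M) = (\<integral>\<omega>. indicator (A \<inter> later u) \<omega> \<partial>M)"
      unfolding set_lebesgue_integral_def
      by (intro Bochner_Integration.integral_cong) (auto simp: indicator_def)
    also have "\<dots> = (\<integral>\<omega>\<in>A. survival (X u \<omega>) \<partial>M)"
      using prob_later[OF u A] by (simp add: set_lebesgue_integral_def)
    finally show "(\<integral>\<omega>\<in>A. indicator (later u) \<omega> \<partial>M) = (\<integral>\<omega>\<in>A. survival (X u \<omega>) \<partial>M)" .
  next
    show "integrable M (\<lambda>\<omega>. survival (X u \<omega>))"
      using survival_nonneg survival_le_1 by (intro integrable_const_bound[of _ 1]) (auto intro!: AE_I2)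
  qed (auto simp: emeasure_eq_measure)
  then have "expectation (\<lambda>\<omega>. f \<omega> * survival (X u \<omega>)) = expectation (\<lambda>\<omega>. f \<omega> * real_cond_exp M (FX u) (indicator (later u)) \<omega>)"
    using measurable_from_subalg[OF subalgebra_FX f] by (intro integral_cong_AE) auto
  also have "\<dots> = expectation (\<lambda>\<omega>. f \<omega> * indicator (later u) \<omega>)"
    using integrable_mult_indicator[OF later_sets int, of u] f
    by (intro sub.real_cond_exp_intg(2)) (auto simp: mult.commute)
  finally show ?thesis ..
qed

section \<open>Dynkin formulas on the event of a later visit\<close>

lemma integrable_X_linear:
  assumes t: "0 \<le> t" and k[measurable]: "k \<in> borel_measurable borel" and b: "\<And>x. \<bar>k x\<bar> \<le> a + b * \<bar>x\<bar>"
  shows "integrable M (\<lambda>\<omega>. k (X t \<omega>))"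
proof (rule Bochner_Integration.integrable_bound)
  show "integrable M (\<lambda>\<omega>. a + b * \<bar>X t \<omega>\<bar>)" using integrable_X[OF t] by simp
  show "AE \<omega> in M. norm (k (X t \<omega>)) \<le> norm (a + b * \<bar>X t \<omega>\<bar>)"
    using b by (auto intro!: AE_I2 order_trans[OF _ abs_ge_self])
qed simp

text \<open>Given the past at \<open>u\<close>, the indicator of \<open>later u\<close> averages to
  \<open>survival (X u)\<close>. This turns \<open>k\<close> into the smooth product
  \<open>k * survival\<close>, to which the Gaussian formula applies; its generator
  \<open>l * survival\<close> is then turned back into \<open>l\<close> times the indicator. The
  identity \<open>generator\<close> may omit \<open>z\<close> because \<open>X u\<close> avoids it
  almost surely for \<open>u > 0\<close>.\<close>

theorem dynkin_later:
  fixes k l g' g'' :: "real \<Rightarrow> real"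
  assumes g: "\<And>w. ((\<lambda>w. k w * survival w) has_real_derivative g' w) (at w)"
    and g'_cont: "continuous_on UNIV g'"
    and g': "\<And>w. w \<noteq> z \<Longrightarrow> (g' has_real_derivative g'' w) (at w)"
    and g''_meas[measurable]: "g'' \<in> borel_measurable borel" and g''_bound: "\<And>w. \<bar>g'' w\<bar> \<le> K"
    and g'_bound: "\<And>w. \<bar>g' w\<bar> \<le> a + b * \<bar>w\<bar>"
    and k_meas[measurable]: "k \<in> borel_measurable borel" and k_bound: "\<And>w. \<bar>k w\<bar> \<le> ka + kb * w\<^sup>2"
    and l_meas[measurable]: "l \<in> borel_measurable borel" and l_bound: "\<And>w. \<bar>l w\<bar> \<le> la + lb * \<bar>w\<bar>"
    and generator: "\<And>w. w \<noteq> z \<Longrightarrow> g'' w / 2 + lam * g' w = l w * survival w"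
    and st: "0 \<le> s" "s \<le> t" and C: "C \<in> sets (FX s)"
  shows "(\<integral>\<omega>. indicator C \<omega> * (k (X t \<omega>) * indicator (later t) \<omega> - k (X s \<omega>) * indicator (later s) \<omega>
      - (\<integral>u. indicator {s..t} u * (l (X u \<omega>) * indicator (later u) \<omega>) \<partial>lborel)) \<partial>M) = 0"
proof -
  interpret N: prob_space \<N> by (rule prob_space_std_normal)
  interpret LM: pair_sigma_finite lborel M ..
  have C_M[measurable]: "C \<in> events" using C by (rule FX_subset)
  have [measurable]: "g' \<in> borel_measurable borel"
    using g'_cont by (rule borel_measurable_continuous_onI)
  define g where "g w = k w * survival w" for w
  have [measurable]: "g \<in> borel_measurable borel" unfolding g_def by measurable
  define L where "L w = g'' w / 2 + lam * g' w" for w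
  have L[measurable]: "L \<in> borel_measurable borel" unfolding L_def by measurable
  define T where "T = t - s"
  have T: "0 \<le> T" using st by (simp add: T_def)
  define c0 where "c0 = K + lam * \<bar>a\<bar>"
  define c1 where "c1 = lam * \<bar>b\<bar>"
  have c1: "0 \<le> c1" using lam_pos by (simp add: c1_def)
  have L_bound: "\<bar>L w\<bar> \<le> c0 + c1 * \<bar>w\<bar>" for w
  proof -
    have "0 \<le> K" using g''_bound[of 0] abs_ge_zero[of "g'' 0"] by linarith
    moreover have "\<bar>g' w\<bar> \<le> \<bar>a\<bar> + \<bar>b\<bar> * \<bar>w\<bar>"
      by (rule order_trans[OF g'_bound]) (auto intro!: add_mono mult_right_mono)
    then have "lam * \<bar>g' w\<bar> \<le> lam * (\<bar>a\<bar> + \<bar>b\<bar> * \<bar>w\<bar>)" using lam_pos by (intro mult_left_mono) auto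
    moreover have "\<bar>L w\<bar> \<le> \<bar>g'' w\<bar> / 2 + lam * \<bar>g' w\<bar>"
      unfolding L_def using abs_triangle_ineq[of "g'' w / 2" "lam * g' w"] lam_pos by (simp add: abs_mult)
    ultimately have "\<bar>L w\<bar> \<le> K + lam * (\<bar>a\<bar> + \<bar>b\<bar> * \<bar>w\<bar>)" using g''_bound[of w] by linarith
    then show ?thesis by (simp add: c0_def c1_def distrib_left)
  qed
  have int_k: "integrable M (\<lambda>\<omega>. k (X u \<omega>))" if "0 \<le> u" for u
    by (rule integrable_X_quadratic[OF that k_meas k_bound])
  have int_l: "integrable M (\<lambda>\<omega>. l (X u \<omega>))" if "0 \<le> u" for u
    by (rule integrable_X_linear[OF that l_meas l_bound])
  have int_L: "integrable M (\<lambda>\<omega>. L (X u \<omega>))" if "0 \<le> u" for u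
    by (rule integrable_X_linear[OF that L L_bound])
  have int_g: "integrable M (\<lambda>\<omega>. g (X u \<omega>))" if "0 \<le> u" for u
    using survival_nonneg survival_le_1
    by (intro Bochner_Integration.integrable_bound[OF int_k[OF that]])
       (auto intro!: AE_I2 mult_right_le_one_le simp: g_def abs_mult)
  have later: "(\<integral>\<omega>. indicator C \<omega> * (f (X u \<omega>) * indicator (later u) \<omega>) \<partial>M)
      = (\<integral>\<omega>. indicator C \<omega> * (f (X u \<omega>) * survival (X u \<omega>)) \<partial>M)"
    if u: "s \<le> u" and f[measurable]: "f \<in> borel_measurable borel" and int: "integrable M (\<lambda>\<omega>. f (X u \<omega>))"
    for f :: "real \<Rightarrow> real" and u
  proof -
    have [measurable]: "X u \<in> borel_measurable (FX u)" using u st by (intro measurable_natural_filtration) auto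
    have [measurable]: "C \<in> sets (FX u)" using C u by (rule FX_mono)
    have "(\<lambda>\<omega>. indicator C \<omega> * f (X u \<omega>)) \<in> borel_measurable (FX u)" by measurable
    moreover have "integrable M (\<lambda>\<omega>. indicator C \<omega> * f (X u \<omega>))"
      using integrable_mult_indicator[OF C_M int] by simp
    ultimately show ?thesis
      using expectation_later[of u "\<lambda>\<omega>. indicator C \<omega> * f (X u \<omega>)"] u st by (simp add: mult.assoc)
  qed
  \<comment> \<open>The mean of \<open>L\<close> at time \<open>r\<close> for the motion started at
    \<open>x\<close>, that is, the inner integral of Dynkin's formula.\<close>
  define Q where "Q r x = (\<integral>y. L (x + lam * r + sqrt r * y) \<partial>\<N>)" for r x
  have Q_meas[measurable]: "(\<lambda>p. Q (fst p) (snd p)) \<in> borel_measurable (borel \<Otimes>\<^sub>M borel)"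
    unfolding Q_def by measurable
  have [measurable]: "(\<lambda>p. Q (fst p) (X s (snd p))) \<in> borel_measurable (borel \<Otimes>\<^sub>M M)"
  proof -
    have "(\<lambda>p. (fst p, X s (snd p))) \<in> borel \<Otimes>\<^sub>M M \<rightarrow>\<^sub>M borel \<Otimes>\<^sub>M borel" by measurable
    from measurable_compose[OF this Q_meas] show ?thesis by simp
  qed
  define m where "m = (\<integral>y. \<bar>y\<bar> \<partial>\<N>)"
  have int_abs: "integrable \<N> (\<lambda>y. \<bar>y\<bar>)" by (rule integrable_std_normal_linear[where a = 0 and b = 1]) auto
  define q0 where "q0 = c0 + c1 * (lam * T + sqrt T * m)"
  have Q_bound: "\<bar>Q r x\<bar> \<le> q0 + c1 * \<bar>x\<bar>" if r: "0 \<le> r" "r \<le> T" for r x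
  proof -
    have *: "\<bar>L (x + lam * r + sqrt r * y)\<bar> \<le> (c0 + c1 * (\<bar>x\<bar> + lam * T)) + (c1 * sqrt T) * \<bar>y\<bar>" for y
    proof -
      have "\<bar>x + lam * r + sqrt r * y\<bar> \<le> \<bar>x\<bar> + lam * r + sqrt r * \<bar>y\<bar>"
        using r lam_pos abs_triangle_ineq[of "x + lam * r" "sqrt r * y"] abs_triangle_ineq[of x "lam * r"]
        by (simp add: abs_mult)
      also have "\<dots> \<le> \<bar>x\<bar> + lam * T + sqrt T * \<bar>y\<bar>"
        using r lam_pos by (intro add_mono mult_mono) auto
      finally have "c1 * \<bar>x + lam * r + sqrt r * y\<bar> \<le> c1 * (\<bar>x\<bar> + lam * T + sqrt T * \<bar>y\<bar>)"
        using c1 by (rule mult_left_mono)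
      with L_bound[of "x + lam * r + sqrt r * y"] show ?thesis by (simp add: distrib_left)
    qed
    have int: "integrable \<N> (\<lambda>y. L (x + lam * r + sqrt r * y))"
      by (rule integrable_std_normal_linear[OF _ *]) simp
    have "\<bar>Q r x\<bar> \<le> (\<integral>y. \<bar>L (x + lam * r + sqrt r * y)\<bar> \<partial>\<N>)"
      unfolding Q_def by (rule integral_abs_bound)
    also have "\<dots> \<le> (\<integral>y. (c0 + c1 * (\<bar>x\<bar> + lam * T)) + (c1 * sqrt T) * \<bar>y\<bar> \<partial>\<N>)"
      using * int int_abs by (intro integral_mono) auto
    also have "\<dots> = (c0 + c1 * (\<bar>x\<bar> + lam * T)) + (c1 * sqrt T) * m"
      using int_abs by (simp add: m_def N.prob_space[simplified])
    also have "\<dots> = q0 + c1 * \<bar>x\<bar>" by (simp add: q0_def distrib_left mult.assoc)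
    finally show ?thesis .
  qed
  have joint1: "integrable (lborel \<Otimes>\<^sub>M M) (\<lambda>(r, \<omega>). indicator {0..T} r * (indicator C \<omega> * Q r (X s \<omega>)))"
  proof (rule Bochner_Integration.integrable_bound)
    have "integrable lborel (indicat_real {0..T})" by (rule integrable_real_indicator) (use T in auto)
    moreover have "integrable M (\<lambda>\<omega>. q0 + c1 * \<bar>X s \<omega>\<bar>)" using integrable_X[OF st(1)] by simp
    ultimately show "integrable (lborel \<Otimes>\<^sub>M M) (\<lambda>(r, \<omega>). indicat_real {0..T} r * (q0 + c1 * \<bar>X s \<omega>\<bar>))"
      by (rule LM.integrable_product)
    have "(\<lambda>p. indicator {0..T} (fst p) * (indicator C (snd p) * Q (fst p) (X s (snd p)))) \<in> borel_measurable (lborel \<Otimes>\<^sub>M M)"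
      by measurable
    then show "(\<lambda>(r, \<omega>). indicator {0..T} r * (indicator C \<omega> * Q r (X s \<omega>))) \<in> borel_measurable (lborel \<Otimes>\<^sub>M M)"
      by (simp add: split_beta')
    show "AE p in lborel \<Otimes>\<^sub>M M. norm (case p of (r, \<omega>) \<Rightarrow> indicator {0..T} r * (indicator C \<omega> * Q r (X s \<omega>)))
        \<le> norm (case p of (r, \<omega>) \<Rightarrow> indicat_real {0..T} r * (q0 + c1 * \<bar>X s \<omega>\<bar>))"
    proof (rule AE_I2)
      fix p :: "real \<times> 'w"
      obtain r \<omega> where p: "p = (r, \<omega>)" by force
      show "norm (case p of (r, \<omega>) \<Rightarrow> indicator {0..T} r * (indicator C \<omega> * Q r (X s \<omega>)))
        \<le> norm (case p of (r, \<omega>) \<Rightarrow> indicat_real {0..T} r * (q0 + c1 * \<bar>X s \<omega>\<bar>))"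
      proof (cases "r \<in> {0..T} \<and> \<omega> \<in> C")
        case True
        then show ?thesis using Q_bound[of r "X s \<omega>"] p by (auto intro: order_trans[OF _ abs_ge_self])
      qed (auto simp: p indicator_def)
    qed
  qed
  have joint2: "integrable (lborel \<Otimes>\<^sub>M M) (\<lambda>(u, \<omega>). indicator {s..t} u * (indicator C \<omega> * (l (X u \<omega>) * indicator (later u) \<omega>)))"
  proof (rule integrable_time_space[where a = la and b = lb])
    show "\<bar>indicator C \<omega> * (l (X u \<omega>) * indicator (later u) \<omega>)\<bar> \<le> la + lb * \<bar>X u \<omega>\<bar>" for u \<omega>
      using l_bound[of "X u \<omega>"] order_trans[OF abs_ge_zero l_bound[of "X u \<omega>"]]
      by (auto simp: indicator_def)
  qed (use st in measurable)
  define \<Psi> where "\<Psi> u = (\<integral>\<omega>. indicator C \<omega> * (l (X u \<omega>) * indicator (later u) \<omega>) \<partial>M)" for u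
  \<comment> \<open>With \<open>r = 0\<close> excluded, \<open>s + r\<close> is positive even if
    \<open>s = 0\<close>, so \<open>X (s + r)\<close> avoids \<open>z\<close> almost surely; one
    value of \<open>r\<close> is a null set.\<close>
  have \<Psi>: "(\<integral>\<omega>. indicator C \<omega> * Q r (X s \<omega>) \<partial>M) = \<Psi> (s + r)" if r: "0 \<le> r" "r \<noteq> 0" for r
  proof -
    have sr: "0 \<le> s" "s \<le> s + r" "0 \<le> s + r" "0 < s + r" using st r by auto
    have "(\<integral>\<omega>. indicator C \<omega> * Q r (X s \<omega>) \<partial>M) = (\<integral>\<omega>. indicator C \<omega> * L (X (s + r) \<omega>) \<partial>M)"
      using markov[OF sr(1,2) C L int_L[OF sr(3)]] by (simp add: Q_def)
    also have "\<dots> = (\<integral>\<omega>. indicator C \<omega> * (l (X (s + r) \<omega>) * survival (X (s + r) \<omega>)) \<partial>M)"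
      using AE_X_neq[OF sr(4), of z] generator
      by (intro integral_cong_AE) (auto simp: L_def elim!: eventually_mono)
    also have "\<dots> = \<Psi> (s + r)" unfolding \<Psi>_def using later[OF sr(2) l_meas int_l[OF sr(3)]] by simp
    finally show ?thesis .
  qed
  have "(\<integral>\<omega>. indicator C \<omega> * g (X t \<omega>) \<partial>M)
      = (\<integral>\<omega>. indicator C \<omega> * (\<integral>y. g (X s \<omega> + lam * T + sqrt T * y) \<partial>\<N>) \<partial>M)"
    unfolding T_def using st by (intro markov C int_g) auto
  also have "\<dots> = (\<integral>\<omega>. indicator C \<omega> * g (X s \<omega>) + (\<integral>r. indicator {0..T} r * (indicator C \<omega> * Q r (X s \<omega>)) \<partial>lborel) \<partial>M)"
  proof (intro Bochner_Integration.integral_cong refl)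
    fix \<omega>
    have "(\<integral>y. g (X s \<omega> + lam * T + sqrt T * y) \<partial>\<N>) = g (X s \<omega>) + (\<integral>r. indicator {0..T} r * Q r (X s \<omega>) \<partial>lborel)"
      unfolding Q_def L_def
      by (rule dynkin_gaussian(2)[OF _ g'_cont g' g''_meas g''_bound g'_bound T]) (use g in \<open>simp_all add: g_def\<close>)
    then show "indicator C \<omega> * (\<integral>y. g (X s \<omega> + lam * T + sqrt T * y) \<partial>\<N>)
      = indicator C \<omega> * g (X s \<omega>) + (\<integral>r. indicator {0..T} r * (indicator C \<omega> * Q r (X s \<omega>)) \<partial>lborel)"
      by (cases "\<omega> \<in> C") auto
  qed
  also have "\<dots> = (\<integral>\<omega>. indicator C \<omega> * g (X s \<omega>) \<partial>M) + (\<integral>\<omega>. (\<integral>r. indicator {0..T} r * (indicator C \<omega> * Q r (X s \<omega>)) \<partial>lborel) \<partial>M)"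
    using integrable_mult_indicator[OF C_M int_g[OF st(1)]] LM.integrable_snd[OF joint1]
    by (intro Bochner_Integration.integral_add) auto
  also have "(\<integral>\<omega>. (\<integral>r. indicator {0..T} r * (indicator C \<omega> * Q r (X s \<omega>)) \<partial>lborel) \<partial>M)
      = (\<integral>r. (\<integral>\<omega>. indicator {0..T} r * (indicator C \<omega> * Q r (X s \<omega>)) \<partial>M) \<partial>lborel)"
    by (rule LM.Fubini_integral[OF joint1])
  also have "\<dots> = (\<integral>r. indicator {0..T} r * \<Psi> (s + r) \<partial>lborel)"
  proof (rule integral_cong_AE)
    show "(\<lambda>r. \<integral>\<omega>. indicator {0..T} r * (indicator C \<omega> * Q r (X s \<omega>)) \<partial>M) \<in> borel_measurable lborel"
      using LM.integrable_fst[OF joint1] by (rule borel_measurable_integrable)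
    have [measurable]: "\<Psi> \<in> borel_measurable borel" unfolding \<Psi>_def by measurable
    show "(\<lambda>r. indicator {0..T} r * \<Psi> (s + r)) \<in> borel_measurable lborel" by measurable
    show "AE r in lborel. (\<integral>\<omega>. indicator {0..T} r * (indicator C \<omega> * Q r (X s \<omega>)) \<partial>M) = indicator {0..T} r * \<Psi> (s + r)"
      using AE_lborel_singleton[of 0] by eventually_elim (auto simp: indicator_def \<Psi>[simplified indicator_def])
  qed
  \<comment> \<open>Written as \<open>s + 1 * r\<close> to match the affine change of variable that
    shifts time by \<open>s\<close>.\<close>
  also have "\<dots> = (\<integral>r. indicator {s..t} (s + 1 * r) * \<Psi> (s + 1 * r) \<partial>lborel)"
    by (intro Bochner_Integration.integral_cong) (auto simp: indicator_def T_def)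
  also have "\<dots> = (\<integral>u. indicator {s..t} u * \<Psi> u \<partial>lborel)"
    using lborel_integral_real_affine[of 1 "\<lambda>u. indicator {s..t} u * \<Psi> u" s] by simp
  also have "\<dots> = (\<integral>u. (\<integral>\<omega>. indicator {s..t} u * (indicator C \<omega> * (l (X u \<omega>) * indicator (later u) \<omega>)) \<partial>M) \<partial>lborel)"
    by (simp add: \<Psi>_def)
  also have "\<dots> = (\<integral>\<omega>. (\<integral>u. indicator {s..t} u * (indicator C \<omega> * (l (X u \<omega>) * indicator (later u) \<omega>)) \<partial>lborel) \<partial>M)"
    by (rule LM.Fubini_integral[OF joint2, symmetric])
  finally have eq: "(\<integral>\<omega>. indicator C \<omega> * g (X t \<omega>) \<partial>M) = (\<integral>\<omega>. indicator C \<omega> * g (X s \<omega>) \<partial>M)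
    + (\<integral>\<omega>. (\<integral>u. indicator {s..t} u * (indicator C \<omega> * (l (X u \<omega>) * indicator (later u) \<omega>)) \<partial>lborel) \<partial>M)" .
  have int_kl: "integrable M (\<lambda>\<omega>. indicator C \<omega> * (k (X u \<omega>) * indicator (later u) \<omega>))" if "0 \<le> u" for u
    using integrable_mult_indicator[OF C_M integrable_mult_indicator[OF later_sets int_k[OF that]], of u]
    by (simp add: mult.commute[of "k _"])
  have "(\<integral>\<omega>. indicator C \<omega> * (k (X t \<omega>) * indicator (later t) \<omega> - k (X s \<omega>) * indicator (later s) \<omega>
      - (\<integral>u. indicator {s..t} u * (l (X u \<omega>) * indicator (later u) \<omega>) \<partial>lborel)) \<partial>M)
    = (\<integral>\<omega>. indicator C \<omega> * (k (X t \<omega>) * indicator (later t) \<omega>) - indicator C \<omega> * (k (X s \<omega>) * indicator (later s) \<omega>)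
      - (\<integral>u. indicator {s..t} u * (indicator C \<omega> * (l (X u \<omega>) * indicator (later u) \<omega>)) \<partial>lborel) \<partial>M)"
    by (intro Bochner_Integration.integral_cong refl) (auto simp: indicator_def)
  also have "\<dots> = (\<integral>\<omega>. indicator C \<omega> * (k (X t \<omega>) * indicator (later t) \<omega>) \<partial>M) - (\<integral>\<omega>. indicator C \<omega> * (k (X s \<omega>) * indicator (later s) \<omega>) \<partial>M)
      - (\<integral>\<omega>. (\<integral>u. indicator {s..t} u * (indicator C \<omega> * (l (X u \<omega>) * indicator (later u) \<omega>)) \<partial>lborel) \<partial>M)"
    using int_kl[of t] int_kl[of s] LM.integrable_snd[OF joint2] st
    by (subst Bochner_Integration.integral_diff Bochner_Integration.integrable_diff; simp)+
  also have "\<dots> = 0"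
    using later[OF st(2) k_meas int_k] later[OF order_refl k_meas int_k] eq st by (simp add: g_def)
  finally show ?thesis .
qed

end

text \<open>Away from \<open>c\<close> one branch is active on a neighbourhood. At \<open>c\<close>,
  equal values and slopes give the two one-sided difference quotients the same limit.\<close>

lemma has_real_derivative_piecewise:
  fixes f1 f2 :: "real \<Rightarrow> real"
  assumes f1: "(f1 has_real_derivative f1' x) (at x)" and f2: "(f2 has_real_derivative f2' x) (at x)"
    and c: "x = c \<Longrightarrow> f1 c = f2 c \<and> f1' c = f2' c"
  shows "((\<lambda>x. if x \<le> c then f1 x else f2 x) has_real_derivative (if x \<le> c then f1' x else f2' x)) (at x)"
proof -
  consider "x < c" | "c < x" | "x = c" by linarith
  then show ?thesis
  proof cases
    case 1
    have "((\<lambda>x. if x \<le> c then f1 x else f2 x) has_real_derivative f1' x) (at x)"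
      by (rule has_field_derivative_transform_within_open[OF f1, of "{..<c}"]) (use 1 in auto)
    then show ?thesis using 1 by simp
  next
    case 2
    have "((\<lambda>x. if x \<le> c then f1 x else f2 x) has_real_derivative f2' x) (at x)"
      by (rule has_field_derivative_transform_within_open[OF f2, of "{c<..}"]) (use 2 in auto)
    then show ?thesis using 2 by simp
  next
    case 3
    have l1: "((\<lambda>y. (f1 y - f1 c) / (y - c)) \<longlongrightarrow> f1' c) (at c)"
      and l2: "((\<lambda>y. (f2 y - f2 c) / (y - c)) \<longlongrightarrow> f2' c) (at c)"
      using f1 f2 3 by (auto simp: has_field_derivative_iff)
    let ?F = "\<lambda>x. if x \<le> c then f1 x else f2 x"
    have "((\<lambda>y. (?F y - ?F c) / (y - c)) \<longlongrightarrow> f1' c) (at c)"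
    proof (rule filterlim_split_at)
      have "eventually (\<lambda>y. (f1 y - f1 c) / (y - c) = (?F y - ?F c) / (y - c)) (at_left c)"
        by (auto simp: eventually_at_filter)
      moreover have "((\<lambda>y. (f1 y - f1 c) / (y - c)) \<longlongrightarrow> f1' c) (at_left c)"
        using l1 by (simp add: filterlim_at_split)
      ultimately show "((\<lambda>y. (?F y - ?F c) / (y - c)) \<longlongrightarrow> f1' c) (at_left c)"
        using Lim_transform_eventually by fastforce
      have "eventually (\<lambda>y. (f2 y - f2 c) / (y - c) = (?F y - ?F c) / (y - c)) (at_right c)"
        using c 3 by (auto simp: eventually_at_filter)
      moreover have "((\<lambda>y. (f2 y - f2 c) / (y - c)) \<longlongrightarrow> f1' c) (at_right c)"
        using l2 c 3 by (simp add: filterlim_at_split)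
      ultimately show "((\<lambda>y. (?F y - ?F c) / (y - c)) \<longlongrightarrow> f1' c) (at_right c)"
        using Lim_transform_eventually by fastforce
    qed
    then show ?thesis using 3 by (simp add: has_field_derivative_iff)
  qed
qed

section \<open>The linear and the quadratic test function\<close>

context drifted_paths
begin

lemma survival_eq: "survival w = (if w \<le> z then 1 else scale_fun z w)"
  using scale_ge_1_iff[of z w] by (auto simp: survival_def min_def)

lemma DERIV_scale_fun: "(scale_fun c has_real_derivative - 2 * lam * scale_fun c w) (at w)"
  unfolding scale_fun_def[abs_def] by (auto intro!: derivative_eq_intros)

lemma scale_fun_refl [simp]: "scale_fun c c = 1"
  by (simp add: scale_fun_def)

lemma continuous_on_scale_fun: "continuous_on A (scale_fun c)"
  by (intro continuous_at_imp_continuous_on ballI DERIV_isCont[OF DERIV_scale_fun])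

text \<open>With \<open>x = lam * y\<close> these are bounds on \<open>x * exp (- 2 * x)\<close> and
  \<open>x\<^sup>2 * exp (- 2 * x)\<close>, both from \<open>1 + x \<le> exp x\<close>. They control
  the polynomial factors in the derivatives of the test functions above \<open>z\<close>.\<close>

lemma
  assumes "0 \<le> y"
  shows scale_fun_moment_1: "lam * y * scale_fun z (z + y) \<le> 1 / 2"
    and scale_fun_moment_2: "(lam * y)\<^sup>2 * scale_fun z (z + y) \<le> 1"
    and scale_fun_le_1: "scale_fun z (z + y) \<le> 1"
proof -
  let ?x = "lam * y"
  have x: "0 \<le> ?x" using assms lam_pos by simp
  have "exp ?x * exp (- ?x) = 1" by (simp add: exp_minus_inverse)
  moreover have "?x \<le> exp ?x" using exp_ge_add_one_self[of ?x] by linarith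
  then have "?x * exp (- ?x) \<le> exp ?x * exp (- ?x)" by (intro mult_right_mono) auto
  ultimately have 1: "?x * exp (- ?x) \<le> 1" by simp
  have "exp (2 * ?x) * exp (- 2 * ?x) = 1" by (simp add: exp_minus_inverse)
  moreover have "2 * ?x \<le> exp (2 * ?x)" using exp_ge_add_one_self[of "2 * ?x"] by linarith
  then have "(2 * ?x) * exp (- 2 * ?x) \<le> exp (2 * ?x) * exp (- 2 * ?x)" by (intro mult_right_mono) auto
  ultimately have 2: "(2 * ?x) * exp (- 2 * ?x) \<le> 1" by simp
  have s: "scale_fun z (z + y) = exp (- 2 * ?x)" by (simp add: scale_fun_def)
  show "?x * scale_fun z (z + y) \<le> 1 / 2" using 2 by (simp add: s)
  have "exp (- 2 * ?x) = exp (- ?x) * exp (- ?x)" by (simp add: exp_add[symmetric])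
  then have "?x\<^sup>2 * scale_fun z (z + y) = (?x * exp (- ?x))\<^sup>2" by (simp add: s power2_eq_square)
  also have "\<dots> \<le> 1\<^sup>2" using 1 x by (intro power_mono) auto
  finally show "?x\<^sup>2 * scale_fun z (z + y) \<le> 1" by simp
  show "scale_fun z (z + y) \<le> 1" using x by (simp add: s)
qed

lemma dynkin_first_moment:
  assumes st: "0 \<le> s" "s \<le> t" and C: "C \<in> sets (FX s)"
  shows "(\<integral>\<omega>. indicator C \<omega> * ((X t \<omega> - z) * indicator (later t) \<omega> - (X s \<omega> - z) * indicator (later s) \<omega>
      - (\<integral>u. indicator {s..t} u * (lam * sgn (z - X u \<omega>) * indicator (later u) \<omega>) \<partial>lborel)) \<partial>M) = 0"
proof -
  let ?g' = "\<lambda>w. if w \<le> z then 1 else (1 - 2 * lam * (w - z)) * scale_fun z w"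
  let ?g'' = "\<lambda>w. if w \<le> z then 0 else (4 * lam\<^sup>2 * (w - z) - 4 * lam) * scale_fun z w"
  show ?thesis
  \<comment> \<open>Above \<open>z\<close>, with \<open>y = w - z\<close> and
    \<open>e = scale_fun z w\<close>, the second derivative is
    \<open>4 * lam * (lam * y * e) - 4 * lam * e\<close>, bounded by
    \<open>2 * lam + 4 * lam\<close>; the first is \<open>e - 2 * (lam * y * e)\<close>, bounded by
    \<open>1 + 1\<close>. At \<open>z\<close> the slopes agree and only \<open>?g''\<close> jumps,
    from 0 to \<open>- 4 * lam\<close>.\<close>
  proof (rule dynkin_later[where k = "\<lambda>w. w - z" and l = "\<lambda>w. lam * sgn (z - w)" and g' = ?g' and g'' = ?g''
      and K = "6 * lam" and a = 2 and b = 0 and ka = "1 + z" and kb = 1 and la = lam and lb = 0])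
    show "((\<lambda>w. (w - z) * survival w) has_real_derivative ?g' w) (at w)" for w
    proof -
      have "(\<lambda>w. (w - z) * survival w) = (\<lambda>w. if w \<le> z then w - z else (w - z) * scale_fun z w)"
        by (auto simp: survival_eq)
      then show ?thesis
        by (simp only:)
           (rule has_real_derivative_piecewise,
            auto intro!: derivative_eq_intros DERIV_scale_fun simp: scale_fun_def algebra_simps)
    qed
    show "continuous_on UNIV ?g'"
      by (rule continuous_on_cases_le[where h = "\<lambda>w. w"])
         (auto intro!: continuous_intros continuous_on_scale_fun)
    show "(?g' has_real_derivative ?g'' w) (at w)" if "w \<noteq> z" for w
      by (rule has_real_derivative_piecewise)
         (use that in \<open>auto intro!: derivative_eq_intros DERIV_scale_fun simp: algebra_simps power2_eq_square\<close>)
    show "?g'' \<in> borel_measurable borel" by measurable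
    fix w
    show "\<bar>?g'' w\<bar> \<le> 6 * lam" and "\<bar>?g' w\<bar> \<le> 2 + 0 * \<bar>w\<bar>"
    proof -
      have *: "\<bar>?g'' w\<bar> \<le> 6 * lam \<and> \<bar>?g' w\<bar> \<le> 2" if "z < w"
      proof -
        define y where "y = w - z"
        have y: "0 \<le> y" "w = z + y" using that by (auto simp: y_def)
        define e where "e = scale_fun z (z + y)"
        have e: "0 \<le> e" "e \<le> 1" "lam * y * e \<le> 1 / 2"
          using scale_fun_moment_1[OF y(1)] scale_fun_le_1[OF y(1)] scale_pos[of z "z + y"] by (auto simp: e_def)
        have p: "0 \<le> lam * y * e" using y e lam_pos by simp
        have "?g'' w = 4 * lam * (lam * y * e) - 4 * lam * e"
          using that by (simp add: y(2) e_def algebra_simps power2_eq_square)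
        moreover have "0 \<le> lam * (lam * y * e)" "lam * (lam * y * e) \<le> lam * (1 / 2)" "0 \<le> lam * e" "lam * e \<le> lam * 1"
          using p e lam_pos by (auto intro!: mult_left_mono)
        ultimately have "\<bar>?g'' w\<bar> \<le> 6 * lam" by linarith
        moreover have "?g' w = e - 2 * (lam * y * e)"
          using that by (simp add: y(2) e_def algebra_simps)
        ultimately show ?thesis using p e by linarith
      qed
      show "\<bar>?g'' w\<bar> \<le> 6 * lam" using * lam_pos by (cases "w \<le> z") auto
      show "\<bar>?g' w\<bar> \<le> 2 + 0 * \<bar>w\<bar>" using * by (cases "w \<le> z") auto
    qed
    show "\<bar>w - z\<bar> \<le> 1 + z + 1 * w\<^sup>2"
    proof -
      have "\<bar>w - z\<bar> \<le> \<bar>w\<bar> + z" using z_pos by linarith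
      then show ?thesis using abs_le_1_plus_square[of w] by simp
    qed
    show "\<bar>lam * sgn (z - w)\<bar> \<le> lam + 0 * \<bar>w\<bar>" using lam_pos by (simp add: abs_mult abs_sgn_eq)
    show "?g'' w / 2 + lam * ?g' w = lam * sgn (z - w) * survival w" if "w \<noteq> z"
      using that by (auto simp: survival_eq sgn_if algebra_simps power2_eq_square add_divide_distrib diff_divide_distrib)
  qed (use st C in auto)
qed

lemma dynkin_second_moment:
  assumes st: "0 \<le> s" "s \<le> t" and C: "C \<in> sets (FX s)"
  shows "(\<integral>\<omega>. indicator C \<omega> * ((X t \<omega> - z)\<^sup>2 * indicator (later t) \<omega> - (X s \<omega> - z)\<^sup>2 * indicator (later s) \<omega>
      - (\<integral>u. indicator {s..t} u * ((1 - 2 * lam * \<bar>X u \<omega> - z\<bar>) * indicator (later u) \<omega>) \<partial>lborel)) \<partial>M) = 0"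
proof -
  let ?g' = "\<lambda>w. if w \<le> z then 2 * (w - z) else (2 * (w - z) - 2 * lam * (w - z)\<^sup>2) * scale_fun z w"
  let ?g'' = "\<lambda>w. if w \<le> z then 2 else (2 - 8 * lam * (w - z) + 4 * lam\<^sup>2 * (w - z)\<^sup>2) * scale_fun z w"
  show ?thesis
  \<comment> \<open>The exponential bounds give \<open>10 = 2 + 8 / 2 + 4\<close>. Above
    \<open>z\<close> they bound \<open>lam * \<bar>?g' w\<bar>\<close> by
    \<open>2 / 2 + 2 = 3\<close>, hence the term \<open>3 / lam\<close>;
    \<open>2 * z + 2 * \<bar>w\<bar>\<close> covers the branch below \<open>z\<close>.\<close>
  proof (rule dynkin_later[where k = "\<lambda>w. (w - z)\<^sup>2" and l = "\<lambda>w. 1 - 2 * lam * \<bar>w - z\<bar>" and g' = ?g' and g'' = ?g''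
      and K = 10 and a = "2 * z + 3 / lam" and b = 2 and ka = "2 * z\<^sup>2" and kb = 2 and la = "1 + 2 * lam * z" and lb = "2 * lam"])
    show "((\<lambda>w. (w - z)\<^sup>2 * survival w) has_real_derivative ?g' w) (at w)" for w
    proof -
      have "(\<lambda>w. (w - z)\<^sup>2 * survival w) = (\<lambda>w. if w \<le> z then (w - z)\<^sup>2 else (w - z)\<^sup>2 * scale_fun z w)"
        by (auto simp: survival_eq)
      then show ?thesis
        by (simp only:)
           (rule has_real_derivative_piecewise,
            auto intro!: derivative_eq_intros DERIV_scale_fun simp: scale_fun_def algebra_simps power2_eq_square)
    qed
    show "continuous_on UNIV ?g'"
      by (rule continuous_on_cases_le[where h = "\<lambda>w. w"])
         (auto intro!: continuous_intros continuous_on_scale_fun)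
    show "(?g' has_real_derivative ?g'' w) (at w)" if "w \<noteq> z" for w
      by (rule has_real_derivative_piecewise)
         (use that in \<open>auto intro!: derivative_eq_intros DERIV_scale_fun simp: algebra_simps power2_eq_square\<close>)
    show "?g'' \<in> borel_measurable borel" by measurable
    fix w
    show "\<bar>?g'' w\<bar> \<le> 10" and "\<bar>?g' w\<bar> \<le> 2 * z + 3 / lam + 2 * \<bar>w\<bar>"
    proof -
      have *: "\<bar>?g'' w\<bar> \<le> 10 \<and> \<bar>?g' w\<bar> \<le> 3 / lam" if "z < w"
      proof -
        define y where "y = w - z"
        have y: "0 \<le> y" "w = z + y" using that by (auto simp: y_def)
        define e where "e = scale_fun z (z + y)"
        have e: "0 \<le> e" "e \<le> 1" "lam * y * e \<le> 1 / 2" "(lam * y)\<^sup>2 * e \<le> 1"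
          using scale_fun_moment_1[OF y(1)] scale_fun_moment_2[OF y(1)] scale_fun_le_1[OF y(1)] scale_pos[of z "z + y"]
          by (auto simp: e_def)
        have p: "0 \<le> lam * y * e" "0 \<le> (lam * y)\<^sup>2 * e" using y e lam_pos by simp_all
        have "?g'' w = 2 * e - 8 * (lam * y * e) + 4 * ((lam * y)\<^sup>2 * e)"
          using that by (simp add: y(2) e_def algebra_simps power2_eq_square)
        then have "\<bar>?g'' w\<bar> \<le> 10" using p e by linarith
        moreover have "lam * ?g' w = 2 * (lam * y * e) - 2 * ((lam * y)\<^sup>2 * e)"
          using that by (simp add: y(2) e_def algebra_simps power2_eq_square)
        then have "\<bar>lam * ?g' w\<bar> \<le> 3" using p e by linarith
        then have "\<bar>?g' w\<bar> \<le> 3 / lam" using lam_pos by (simp add: abs_mult field_simps)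
        ultimately show ?thesis by simp
      qed
      show "\<bar>?g'' w\<bar> \<le> 10" using * by (cases "w \<le> z") auto
      show "\<bar>?g' w\<bar> \<le> 2 * z + 3 / lam + 2 * \<bar>w\<bar>"
      proof (cases "w \<le> z")
        case True
        then have "\<bar>?g' w\<bar> \<le> 2 * z + 2 * \<bar>w\<bar>" using z_pos by (auto simp: abs_if)
        also have "\<dots> \<le> 2 * z + 3 / lam + 2 * \<bar>w\<bar>" using lam_pos by simp
        finally show ?thesis .
      next
        case False
        then have "\<bar>?g' w\<bar> \<le> 3 / lam" using * by simp
        also have "\<dots> \<le> 2 * z + 3 / lam + 2 * \<bar>w\<bar>" using z_pos by simp
        finally show ?thesis .
      qed
    qed
    show "\<bar>(w - z)\<^sup>2\<bar> \<le> 2 * z\<^sup>2 + 2 * w\<^sup>2"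
    proof -
      have "0 \<le> (w + z)\<^sup>2" by simp
      then have "(w - z)\<^sup>2 \<le> 2 * z\<^sup>2 + 2 * w\<^sup>2" by (simp add: power2_eq_square algebra_simps)
      then show ?thesis by (simp only: abs_power2)
    qed
    show "\<bar>1 - 2 * lam * \<bar>w - z\<bar>\<bar> \<le> 1 + 2 * lam * z + 2 * lam * \<bar>w\<bar>"
    proof -
      have "\<bar>w - z\<bar> \<le> \<bar>w\<bar> + z" using z_pos by linarith
      then have "lam * \<bar>w - z\<bar> \<le> lam * (\<bar>w\<bar> + z)" using lam_pos by (intro mult_left_mono) auto
      moreover have "0 \<le> lam * \<bar>w - z\<bar>" using lam_pos by simp
      ultimately have "\<bar>1 - 2 * (lam * \<bar>w - z\<bar>)\<bar> \<le> 1 + 2 * (lam * (\<bar>w\<bar> + z))" by linarith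
      then show ?thesis by (simp add: algebra_simps)
    qed
    show "?g'' w / 2 + lam * ?g' w = (1 - 2 * lam * \<bar>w - z\<bar>) * survival w" if "w \<noteq> z"
      using that by (auto simp: survival_eq abs_if algebra_simps power2_eq_square add_divide_distrib diff_divide_distrib)
  qed (use st C in auto)
qed

end

section \<open>Martingales and time integrals\<close>

lemma martingaleI:
  assumes "prob_space M" and filt: "filtration (space M) F" and sub: "\<And>t. subalgebra M (F t)"
    and ad: "adapted F X" and int: "\<And>t. 0 \<le> t \<Longrightarrow> integrable M (X t)"
    and incr: "\<And>s t A. 0 \<le> s \<Longrightarrow> s \<le> t \<Longrightarrow> A \<in> sets (F s) \<Longrightarrow> (\<integral>\<omega>. indicator A \<omega> * (X t \<omega> - X s \<omega>) \<partial>M) = 0"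
  shows "martingale M F X"
  unfolding martingale_def
proof (intro conjI allI impI filt sub ad)
  interpret prob_space M by fact
  show "integrable M (X t)" if "0 \<le> t" for t by (rule int[OF that])
  fix s t :: real assume st: "0 \<le> s \<and> s \<le> t"
  interpret s: finite_measure_subalgebra M "F s" by unfold_locales (rule sub)
  show "AE \<omega> in M. real_cond_exp M (F s) (X t) \<omega> = X s \<omega>"
  proof (rule s.real_cond_exp_charact)
    fix A assume A: "A \<in> sets (F s)"
    then have A_M: "A \<in> sets M" using sub[of s] by (auto simp: subalgebra_def)
    have "integrable M (\<lambda>\<omega>. indicator A \<omega> * X t \<omega>)" "integrable M (\<lambda>\<omega>. indicator A \<omega> * X s \<omega>)"
      using integrable_mult_indicator[OF A_M int] st by auto
    moreover from incr[OF _ _ A] st have "(\<integral>\<omega>. indicator A \<omega> * X t \<omega> - indicator A \<omega> * X s \<omega> \<partial>M) = 0"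
      by (simp add: right_diff_distrib)
    ultimately show "(\<integral>\<omega>\<in>A. X t \<omega> \<partial>M) = (\<integral>\<omega>\<in>A. X s \<omega> \<partial>M)" by (simp add: set_lebesgue_integral_def)
  qed (use int st ad in \<open>auto simp: adapted_def\<close>)
qed

text \<open>Bounded factors known at time \<open>s\<close> can be pulled into the conditional
  expectation. The weights in view are the drift up to \<open>s\<close> and the drift rate at
  \<open>s\<close>, times an indicator.\<close>

lemma martingale_orthogonal:
  assumes "prob_space M" and m: "martingale M F X" and st: "0 \<le> s" "s \<le> t"
    and f[measurable]: "f \<in> borel_measurable (F s)" and f_bound: "\<And>\<omega>. \<omega> \<in> space M \<Longrightarrow> \<bar>f \<omega>\<bar> \<le> K"
  shows "(\<integral>\<omega>. f \<omega> * (X t \<omega> - X s \<omega>) \<partial>M) = (0 :: real)"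
proof -
  interpret prob_space M by fact
  have sub: "subalgebra M (F s)" and int: "integrable M (X t)" "integrable M (X s)" and ad: "X s \<in> borel_measurable (F s)"
    and ce: "AE \<omega> in M. real_cond_exp M (F s) (X t) \<omega> = X s \<omega>"
    using m st by (auto simp: martingale_def adapted_def)
  interpret s: finite_measure_subalgebra M "F s" by unfold_locales (rule sub)
  have [measurable]: "f \<in> borel_measurable M" by (rule measurable_from_subalg[OF sub f])
  have prod: "integrable M (\<lambda>\<omega>. f \<omega> * Y \<omega>)" if Y: "integrable M Y" for Y :: "_ \<Rightarrow> real"
  proof (rule Bochner_Integration.integrable_bound)
    show "integrable M (\<lambda>\<omega>. K * \<bar>Y \<omega>\<bar>)" using Y by simp
    show "AE \<omega> in M. norm (f \<omega> * Y \<omega>) \<le> norm (K * \<bar>Y \<omega>\<bar>)"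
    proof (rule AE_I2)
      fix \<omega> assume "\<omega> \<in> space M"
      then have "\<bar>f \<omega>\<bar> * \<bar>Y \<omega>\<bar> \<le> K * \<bar>Y \<omega>\<bar>" using f_bound by (intro mult_right_mono) auto
      then show "norm (f \<omega> * Y \<omega>) \<le> norm (K * \<bar>Y \<omega>\<bar>)" using abs_ge_self[of "K * \<bar>Y \<omega>\<bar>"] by (simp add: abs_mult)
    qed
  qed (use Y in measurable)
  have "(\<integral>\<omega>. f \<omega> * X t \<omega> \<partial>M) = (\<integral>\<omega>. f \<omega> * real_cond_exp M (F s) (X t) \<omega> \<partial>M)"
    using prod[OF int(1)] int by (intro s.real_cond_exp_intg(2)[symmetric]) auto
  also have "\<dots> = (\<integral>\<omega>. f \<omega> * X s \<omega> \<partial>M)"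
    using ce int by (intro integral_cong_AE) (auto elim: eventually_mono)
  finally show ?thesis using prod[OF int(1)] prod[OF int(2)] by (simp add: right_diff_distrib)
qed

lemma integrable_indicator_bounded:
  fixes \<phi> :: "real \<Rightarrow> real"
  assumes [measurable]: "\<phi> \<in> borel_measurable borel" and b: "\<And>u. u \<in> {s..t} \<Longrightarrow> \<bar>\<phi> u\<bar> \<le> K"
  shows "integrable lborel (\<lambda>u. indicator {s..t} u * \<phi> u)"
proof (rule Bochner_Integration.integrable_bound)
  show "integrable lborel (\<lambda>u. K * indicat_real {s..t} u)"
    by (intro integrable_mult_right integrable_real_indicator) (auto simp: emeasure_lborel_Icc_eq)
  show "AE u in lborel. norm (indicator {s..t} u * \<phi> u) \<le> norm (K * indicat_real {s..t} u)"
    using b by (intro AE_I2) (auto simp: indicator_def intro: order_trans[OF _ abs_ge_self])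
qed simp

lemma integral_indicator_split:
  fixes \<phi> :: "real \<Rightarrow> real"
  assumes [measurable]: "\<phi> \<in> borel_measurable borel" and b: "\<And>u. u \<in> {0..t} \<Longrightarrow> \<bar>\<phi> u\<bar> \<le> K"
    and st: "0 \<le> s" "s \<le> t"
  shows "(\<integral>u. indicator {0..t} u * \<phi> u \<partial>lborel)
    = (\<integral>u. indicator {0..s} u * \<phi> u \<partial>lborel) + (\<integral>u. indicator {s..t} u * \<phi> u \<partial>lborel)"
proof -
  have "(\<integral>u. indicator {0..t} u * \<phi> u \<partial>lborel) = (\<integral>u. indicator {0..s} u * \<phi> u + indicator {s..t} u * \<phi> u \<partial>lborel)"
    using st by (intro integral_cong_AE AE_mp[OF AE_lborel_singleton[of s] AE_I2]) (auto simp: indicator_def)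
  also have "\<dots> = (\<integral>u. indicator {0..s} u * \<phi> u \<partial>lborel) + (\<integral>u. indicator {s..t} u * \<phi> u \<partial>lborel)"
    using b st by (intro Bochner_Integration.integral_add integrable_indicator_bounded[where K = K]) auto
  finally show ?thesis .
qed

lemma integral_indicator_lipschitz:
  fixes \<phi> :: "real \<Rightarrow> real"
  assumes [measurable]: "\<phi> \<in> borel_measurable borel" and b: "\<And>u. \<bar>\<phi> u\<bar> \<le> K"
  shows "\<bar>(\<integral>u. indicator {0..t} u * \<phi> u \<partial>lborel) - (\<integral>u. indicator {0..s} u * \<phi> u \<partial>lborel)\<bar> \<le> K * \<bar>t - s\<bar>"
proof -
  have K: "0 \<le> K" using b[of 0] by linarith
  have *: "\<bar>(\<integral>u. indicator {0..t} u * \<phi> u \<partial>lborel) - (\<integral>u. indicator {0..s} u * \<phi> u \<partial>lborel)\<bar> \<le> K * (t - s)"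
    if st: "s \<le> t" for s t
  proof -
    have "(\<integral>u. indicator {0..t} u * \<phi> u \<partial>lborel) - (\<integral>u. indicator {0..s} u * \<phi> u \<partial>lborel)
        = (\<integral>u. indicator {0..t} u * \<phi> u - indicator {0..s} u * \<phi> u \<partial>lborel)"
      using b by (intro Bochner_Integration.integral_diff[symmetric] integrable_indicator_bounded[where K = K]) auto
    also have "\<bar>\<dots>\<bar> \<le> (\<integral>u. \<bar>indicator {0..t} u * \<phi> u - indicator {0..s} u * \<phi> u\<bar> \<partial>lborel)"
      by (rule integral_abs_bound)
    also have "\<dots> \<le> (\<integral>u. K * indicat_real {s..t} u \<partial>lborel)"
    proof (rule integral_mono)
      show "integrable lborel (\<lambda>u. \<bar>indicator {0..t} u * \<phi> u - indicator {0..s} u * \<phi> u\<bar>)"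
        using b by (intro integrable_abs Bochner_Integration.integrable_diff integrable_indicator_bounded[where K = K]) auto
      show "integrable lborel (\<lambda>u. K * indicat_real {s..t} u)"
        by (intro integrable_mult_right integrable_real_indicator) (auto simp: emeasure_lborel_Icc_eq)
      show "\<bar>indicator {0..t} u * \<phi> u - indicator {0..s} u * \<phi> u\<bar> \<le> K * indicat_real {s..t} u" for u
        using b[of u] K st by (auto simp: indicator_def)
    qed
    also have "\<dots> = K * (t - s)" using st by simp
    finally show ?thesis .
  qed
  show ?thesis using *[of s t] *[of t s] by (cases "s \<le> t") (auto simp: abs_minus_commute)
qed

lemma continuous_on_integral_indicator:
  fixes \<phi> :: "real \<Rightarrow> real"
  assumes "\<phi> \<in> borel_measurable borel" and "\<And>u. \<bar>\<phi> u\<bar> \<le> K"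
  shows "continuous_on UNIV (\<lambda>t. \<integral>u. indicator {0..t} u * \<phi> u \<partial>lborel)"
proof -
  have "0 \<le> K" using assms(2)[of 0] by linarith
  then have "K-lipschitz_on UNIV (\<lambda>t. \<integral>u. indicator {0..t} u * \<phi> u \<partial>lborel)"
    using integral_indicator_lipschitz[OF assms] by (intro lipschitz_onI) (auto simp: dist_real_def)
  then show ?thesis by (rule lipschitz_on_continuous_on)
qed

text \<open>Since \<open>\<phi>\<close> is merely measurable, the primitive need not be
  differentiable everywhere; Fubini replaces the chain rule. The square is an integral over a
  product, and its two triangles contribute equally by symmetry.\<close>

lemma integral_indicator_square:
  fixes \<phi> :: "real \<Rightarrow> real"
  assumes [measurable]: "\<phi> \<in> borel_measurable borel" and b: "\<And>u. \<bar>\<phi> u\<bar> \<le> K"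
  shows "(\<integral>u. indicator {0..t} u * \<phi> u \<partial>lborel)\<^sup>2
    = 2 * (\<integral>u. indicator {0..t} u * ((\<integral>v. indicator {0..u} v * \<phi> v \<partial>lborel) * \<phi> u) \<partial>lborel)"
proof -
  define f where "f u = indicator {0..t} u * \<phi> u" for u
  have f: "integrable lborel f" unfolding f_def by (rule integrable_indicator_bounded[where K = K]) (use b in auto)
  have [measurable]: "f \<in> borel_measurable borel" using f by auto
  have ff: "integrable (lborel \<Otimes>\<^sub>M lborel) (\<lambda>(u, v). f u * f v)" by (rule lborel_pair.integrable_product[OF f f])
  define lo hi where "lo p = indicator {p. snd p \<le> fst p} p * (f (fst p) * f (snd p))"
    and "hi p = indicator {p. fst p \<le> snd p} p * (f (fst p) * f (snd p))" for p :: "real \<times> real"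
  have [measurable]: "{p :: real \<times> real. snd p \<le> fst p} \<in> sets (borel \<Otimes>\<^sub>M borel)"
    "{p :: real \<times> real. fst p \<le> snd p} \<in> sets (borel \<Otimes>\<^sub>M borel)"
    using borel_measurable_le[of snd "borel \<Otimes>\<^sub>M borel" fst] borel_measurable_le[of fst "borel \<Otimes>\<^sub>M borel" snd]
    by (auto simp: space_pair_measure)
  have lo: "integrable (lborel \<Otimes>\<^sub>M lborel) lo" and hi: "integrable (lborel \<Otimes>\<^sub>M lborel) hi"
    using ff unfolding lo_def hi_def
    by (auto intro!: Bochner_Integration.integrable_bound[OF ff] AE_I2 simp: indicator_def split_beta')
  define \<Phi> where "\<Phi> u = (\<integral>v. indicator {0..u} v * \<phi> v \<partial>lborel)" for u
  have inner: "(\<integral>v. indicator {v. v \<le> u} v * (f u * f v) \<partial>lborel) = indicator {0..t} u * (\<Phi> u * \<phi> u)" for u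
  proof -
    have "(\<integral>v. indicator {v. v \<le> u} v * (f u * f v) \<partial>lborel) = (\<integral>v. f u * (indicator {0..u} v * \<phi> v) \<partial>lborel)"
      by (intro Bochner_Integration.integral_cong) (auto simp: f_def indicator_def)
    then show ?thesis by (simp add: \<Phi>_def f_def)
  qed
  have lo_eq: "lo (u, v) = indicator {v. v \<le> u} v * (f u * f v)" for u v
    by (simp add: lo_def indicator_def)
  \<comment> \<open>\<open>hi\<close> is \<open>lo\<close> with the coordinates exchanged, so
    \<open>inner\<close> evaluates both.\<close>
  have hi_eq: "hi (u, v) = indicator {u. u \<le> v} u * (f v * f u)" for u v
    by (simp add: hi_def indicator_def)
  have eq: "(\<integral>p. lo p \<partial>(lborel \<Otimes>\<^sub>M lborel)) = (\<integral>u. indicator {0..t} u * (\<Phi> u * \<phi> u) \<partial>lborel)"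
    unfolding lborel_pair.integral_fst'[OF lo, symmetric] lo_eq inner ..
  have "(\<integral>p. hi p \<partial>(lborel \<Otimes>\<^sub>M lborel)) = (\<integral>v. (\<integral>u. hi (u, v) \<partial>lborel) \<partial>lborel)"
    using lborel_pair.integral_snd[of "\<lambda>u v. hi (u, v)"] hi by simp
  also have "\<dots> = (\<integral>u. indicator {0..t} u * (\<Phi> u * \<phi> u) \<partial>lborel)"
    unfolding hi_eq inner ..
  finally have eq': "(\<integral>p. hi p \<partial>(lborel \<Otimes>\<^sub>M lborel)) = (\<integral>u. indicator {0..t} u * (\<Phi> u * \<phi> u) \<partial>lborel)" .
  have "(\<integral>u. f u \<partial>lborel)\<^sup>2 = (\<integral>u. (\<integral>v. f u * f v \<partial>lborel) \<partial>lborel)"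
    by (simp add: power2_eq_square)
  also have "\<dots> = (\<integral>u. (\<integral>v. lo (u, v) + hi (u, v) \<partial>lborel) \<partial>lborel)"
  proof (rule Bochner_Integration.integral_cong[OF refl], rule integral_cong_AE)
    fix u
    \<comment> \<open>The diagonal is counted in both triangles, but for fixed \<open>u\<close> it
      is a single point.\<close>
    show "AE v in lborel. f u * f v = lo (u, v) + hi (u, v)"
      by (rule AE_mp[OF AE_lborel_singleton[of u] AE_I2]) (auto simp: lo_def hi_def indicator_def)
  qed (auto simp: lo_def hi_def)
  also have "\<dots> = (\<integral>p. lo p + hi p \<partial>(lborel \<Otimes>\<^sub>M lborel))"
    using lborel_pair.integral_fst'[OF Bochner_Integration.integrable_add[OF lo hi]] by simp
  also have "\<dots> = 2 * (\<integral>u. indicator {0..t} u * (\<Phi> u * \<phi> u) \<partial>lborel)"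
    using lo hi eq eq' by simp
  finally show ?thesis by (simp add: f_def \<Phi>_def)
qed

section \<open>Martingales of the stopped process\<close>

text \<open>Preimages under \<open>f\<close> and \<open>g\<close> differ by two null sets, and these
  already lie in \<open>F\<close>. This transfers adaptedness between almost surely equal
  processes.\<close>

lemma measurable_AE_null_sets:
  fixes f g :: "'w \<Rightarrow> real"
  assumes sub: "subalgebra M F" and null: "null_sets M \<subseteq> sets F"
    and f: "f \<in> borel_measurable M" and g: "g \<in> borel_measurable F" and eq: "AE \<omega> in M. f \<omega> = g \<omega>"
  shows "f \<in> borel_measurable F"
proof (rule measurableI)
  have sp: "space F = space M" and sets: "sets F \<subseteq> sets M" using sub by (auto simp: subalgebra_def)
  have g_M[measurable]: "g \<in> borel_measurable M" by (rule measurable_from_subalg[OF sub g])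
  note f[measurable]
  fix E :: "real set" assume [measurable]: "E \<in> sets borel"
  let ?D1 = "{\<omega> \<in> space M. f \<omega> \<in> E \<and> g \<omega> \<notin> E}" and ?D2 = "{\<omega> \<in> space M. f \<omega> \<notin> E \<and> g \<omega> \<in> E}"
  have D: "?D1 \<in> sets M" "?D2 \<in> sets M" by measurable
  have "AE \<omega> in M. \<omega> \<notin> ?D1" "AE \<omega> in M. \<omega> \<notin> ?D2" using eq by (auto elim!: eventually_mono)
  then have "?D1 \<in> null_sets M" "?D2 \<in> null_sets M"
    using AE_iff_null_sets[OF D(1)] AE_iff_null_sets[OF D(2)] by auto
  then have "?D1 \<in> sets F" "?D2 \<in> sets F" using null by auto
  moreover have "g -` E \<inter> space F \<in> sets F" by (rule measurable_sets[OF g]) simp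
  moreover have "f -` E \<inter> space F = (g -` E \<inter> space F - ?D2) \<union> ?D1" unfolding sp by auto
  ultimately show "f -` E \<inter> space F \<in> sets F" by auto
qed auto

context drifted_paths
begin

abbreviation "F\<xi> \<equiv> natural_filtration M \<xi>"

lemma subalgebra_F: "subalgebra M (F\<xi> t)"
  by (rule subalgebra_natural_filtration) simp

lemma F_subset: "A \<in> sets (F\<xi> t) \<Longrightarrow> A \<in> events"
  using subalgebra_F[of t] by (auto simp: subalgebra_def)

lemma xi_adapted: "0 \<le> s \<Longrightarrow> s \<le> t \<Longrightarrow> \<xi> s \<in> borel_measurable (F\<xi> t)"
  by (rule measurable_natural_filtration)

text \<open>The integrand lives on \<open>later s\<close>, where \<open>A\<close> may be exchanged
  for an event \<open>C\<close> of the filtration of \<open>X\<close> with the same trace. Thus a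
  mean zero statement proved for \<open>X\<close> becomes one for the filtration of
  \<open>\<xi>\<close>.\<close>

lemma trace_integral_zero:
  assumes s: "0 \<le> s" and A: "A \<in> sets (F\<xi> s)"
    and f: "\<And>\<omega>. \<omega> \<in> space M \<Longrightarrow> \<omega> \<notin> later s \<Longrightarrow> f \<omega> = 0"
    and int: "\<And>C. C \<in> sets (FX s) \<Longrightarrow> (\<integral>\<omega>. indicator C \<omega> * f \<omega> \<partial>M) = 0"
  shows "(\<integral>\<omega>. indicator A \<omega> * f \<omega> \<partial>M) = (0 :: real)"
proof -
  obtain C where C: "C \<in> sets (FX s)" "A \<inter> later s = C \<inter> later s"
    using natural_filtration_xi_trace[OF s A] by blast
  have "indicator A \<omega> * f \<omega> = indicator C \<omega> * f \<omega>" if "\<omega> \<in> space M" for \<omega>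
    using C(2) f[OF that] by (cases "\<omega> \<in> later s") (auto simp: indicator_def)
  then have "(\<integral>\<omega>. indicator A \<omega> * f \<omega> \<partial>M) = (\<integral>\<omega>. indicator C \<omega> * f \<omega> \<partial>M)"
    by (intro Bochner_Integration.integral_cong refl)
  then show ?thesis using int[OF C(1)] by simp
qed

lemma xi_path_measurable: "\<omega> \<in> space M \<Longrightarrow> (\<lambda>u. \<xi> u \<omega>) \<in> borel_measurable borel"
  by (rule borel_measurable_continuous_onI[OF xi_cont])

lemma later_path_measurable: "\<omega> \<in> space M \<Longrightarrow> (\<lambda>u. indicat_real (later u) \<omega>) \<in> borel_measurable borel"
  using measurable_compose[OF measurable_Pair2' later_pair_measurable] by simp

lemma adapted_integral:
  fixes h :: "real \<Rightarrow> real"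
  assumes t: "0 \<le> t" and [measurable]: "h \<in> borel_measurable borel"
  shows "(\<lambda>\<omega>. \<integral>u. indicator {0..t} u * h (\<xi> u \<omega>) \<partial>lborel) \<in> borel_measurable (F\<xi> t)"
proof -
  \<comment> \<open>Clamping time to \<open>{0..t}\<close> makes every coordinate measurable at time
    \<open>t\<close> without changing the integrand; continuity then gives joint
    measurability.\<close>
  define Y where "Y u = \<xi> (max 0 (min u t))" for u
  have "(\<lambda>(u, \<omega>). Y u \<omega>) \<in> borel_measurable (borel \<Otimes>\<^sub>M F\<xi> t)"
  proof (rule pair_measurable_continuous_process)
    show "Y u \<in> borel_measurable (F\<xi> t)" for u unfolding Y_def using t by (intro xi_adapted) auto
    show "continuous_on UNIV (\<lambda>u. Y u \<omega>)" if "\<omega> \<in> space (F\<xi> t)" for \<omega>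
      unfolding Y_def using that
      by (intro continuous_on_compose2[OF xi_cont] continuous_intros) auto
  qed
  then have Y: "(\<lambda>p. Y (snd p) (fst p)) \<in> borel_measurable (F\<xi> t \<Otimes>\<^sub>M lborel)"
    using measurable_compose[OF measurable_pair_swap', of "\<lambda>(u, \<omega>). Y u \<omega>"]
    by (simp add: split_beta' cong: measurable_cong_sets)
  have hY: "(\<lambda>p. h (Y (snd p) (fst p))) \<in> borel_measurable (F\<xi> t \<Otimes>\<^sub>M lborel)"
    using measurable_compose[OF Y \<open>h \<in> _\<close>] by simp
  have ind: "(\<lambda>p. indicat_real {0..t} (snd p)) \<in> borel_measurable (F\<xi> t \<Otimes>\<^sub>M lborel)"
    by measurable
  have "(\<lambda>p. indicator {0..t} (snd p) * h (Y (snd p) (fst p))) \<in> borel_measurable (F\<xi> t \<Otimes>\<^sub>M lborel)"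
    using ind hY by (rule borel_measurable_times)
  then have Y': "case_prod (\<lambda>\<omega> u. indicator {0..t} u * h (Y u \<omega>)) \<in> borel_measurable (F\<xi> t \<Otimes>\<^sub>M lborel)"
    by (simp add: split_beta')
  have "(\<lambda>\<omega>. \<integral>u. indicator {0..t} u * h (Y u \<omega>) \<partial>lborel) \<in> borel_measurable (F\<xi> t)"
    by (rule lborel.borel_measurable_lebesgue_integral[OF Y'])
  moreover have "indicator {0..t} u * h (Y u \<omega>) = indicator {0..t} u * h (\<xi> u \<omega>)" for u \<omega>
    by (auto simp: Y_def indicator_def)
  ultimately show ?thesis by simp
qed

text \<open>Off \<open>later r\<close> the stopped process equals \<open>z\<close>; on it, it equals
  \<open>X r\<close>, which differs from \<open>z\<close> almost surely. So the event is
  \<open>\<xi> r \<noteq> z\<close> up to a null set, and the augmentation absorbs the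
  difference.\<close>

lemma later_F: "0 \<le> r \<Longrightarrow> later r \<in> sets (F\<xi> r)"
proof -
  assume r: "0 \<le> r"
  have "AE \<omega> in M. X r \<omega> \<noteq> z"
  proof (cases "r = 0")
    case True
    then show ?thesis using z_pos by (intro AE_I2) (simp add: X_0)
  qed (use r AE_X_neq in auto)
  then have "AE \<omega> in M. \<omega> \<notin> later r \<inter> {\<omega> \<in> space M. X r \<omega> = z}" by eventually_elim simp
  moreover have "later r \<inter> {\<omega> \<in> space M. X r \<omega> = z} \<in> events" by measurable
  ultimately have "later r \<inter> {\<omega> \<in> space M. X r \<omega> = z} \<in> null_sets M"
    using AE_iff_null_sets by blast
  then have 1: "later r \<inter> {\<omega> \<in> space M. X r \<omega> = z} \<in> sets (F\<xi> r)" using null_sets_natural_filtration by blast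
  have 2: "\<xi> r -` (- {z}) \<inter> space (F\<xi> r) \<in> sets (F\<xi> r)"
    by (rule measurable_sets[OF xi_adapted]) (use r in auto)
  have eq: "later r = (\<xi> r -` (- {z}) \<inter> space (F\<xi> r)) \<union> (later r \<inter> {\<omega> \<in> space M. X r \<omega> = z})"
  proof (rule set_eqI)
    fix \<omega>
    show "\<omega> \<in> later r \<longleftrightarrow> \<omega> \<in> (\<xi> r -` (- {z}) \<inter> space (F\<xi> r)) \<union> (later r \<inter> {\<omega> \<in> space M. X r \<omega> = z})"
      using r sets.sets_into_space[OF later_sets, of r] by (cases "\<omega> \<in> space M"; cases "\<omega> \<in> later r") (auto simp: xi_eq)
  qed
  show ?thesis by (subst eq) (rule sets.Un[OF 2 1])
qed

lemma stop_at_le_iff: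
  assumes \<omega>: "\<omega> \<in> space M" and r: "0 \<le> r" "r < t"
  shows "stop_at t (\<sigma> \<omega>) \<le> r \<longleftrightarrow> \<omega> \<notin> later r"
proof (cases "\<omega> \<in> later r")
  case True
  show ?thesis
  proof (cases "\<omega> \<in> later t")
    case True
    then show ?thesis using stop_at_later[OF True] r \<open>\<omega> \<in> later r\<close> by simp
  next
    case False
    obtain s where s: "0 < s" "s \<le> t" "X s \<omega> = z" "\<sigma> \<omega> = ennreal s"
      using sigma_attained[OF \<omega> _ False] r by auto
    moreover have "r < s" using less_sigma_iff[OF \<omega> r(1)] \<open>\<omega> \<in> later r\<close> s r by (simp add: ennreal_less_iff)
    ultimately show ?thesis using \<open>\<omega> \<in> later r\<close> by (simp add: stop_at_eq)
  qed
next
  case False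
  obtain s where "0 < s" "s \<le> r" "\<sigma> \<omega> = ennreal s" using sigma_attained[OF \<omega> r(1) False] by blast
  then show ?thesis using False r by (simp add: stop_at_eq min_def)
qed

text \<open>A sublevel set at \<open>0 \<le> r < t\<close> is the complement of
  \<open>later r\<close>, known already at time \<open>r\<close>. This is the stopping time property
  of \<open>\<sigma>\<close> for the filtration of \<open>\<xi>\<close>.\<close>

lemma stop_at_adapted: "0 \<le> t \<Longrightarrow> (\<lambda>\<omega>. stop_at t (\<sigma> \<omega>)) \<in> borel_measurable (F\<xi> t)"
proof (rule borel_measurableI_le)
  fix r assume t: "0 \<le> t"
  have le: "stop_at t (\<sigma> \<omega>) \<le> t" for \<omega> using t by (simp add: stop_at_eq)
  consider "r < 0" | "t \<le> r" | "0 \<le> r" "r < t" by linarith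
  then show "{\<omega> \<in> space (F\<xi> t). stop_at t (\<sigma> \<omega>) \<le> r} \<in> sets (F\<xi> t)"
  proof cases
    case 1
    then have eq: "{\<omega> \<in> space (F\<xi> t). stop_at t (\<sigma> \<omega>) \<le> r} = {}"
      using stop_at_nonneg[of t] by (auto simp: not_le intro: less_le_trans)
    show ?thesis unfolding eq by (rule sets.empty_sets)
  next
    case 2
    then have "{\<omega> \<in> space (F\<xi> t). stop_at t (\<sigma> \<omega>) \<le> r} = space (F\<xi> t)" using le by (auto intro: order_trans)
    then show ?thesis using sets.top[of "F\<xi> t"] by simp
  next
    case 3
    then have eq: "{\<omega> \<in> space (F\<xi> t). stop_at t (\<sigma> \<omega>) \<le> r} = space (F\<xi> t) - later r"
      by (auto simp: stop_at_le_iff)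
    have "later r \<in> sets (F\<xi> t)"
      using later_F[OF 3(1)] natural_filtration_mono[of r t M \<xi>] 3 by auto
    then show ?thesis unfolding eq by (rule sets.compl_sets)
  qed
qed

section \<open>The drift and the two compensated processes\<close>

definition rate :: "real \<Rightarrow> 'w \<Rightarrow> real"
  where "rate u \<omega> = lam * sgn (z - \<xi> u \<omega>)"

definition drift :: "real \<Rightarrow> 'w \<Rightarrow> real"
  where "drift t \<omega> = (\<integral>u. indicator {0..t} u * rate u \<omega> \<partial>lborel)"

definition distance_integral :: "real \<Rightarrow> 'w \<Rightarrow> real"
  where "distance_integral t \<omega> = (\<integral>u. indicator {0..t} u * \<bar>\<xi> u \<omega> - z\<bar> \<partial>lborel)"

text \<open>Shifted by \<open>z\<close> so that the part \<open>\<xi> t \<omega> - z\<close>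
  vanishes from \<open>\<sigma>\<close> on; the process therefore starts at
  \<open>- z\<close>.\<close>

definition mart :: "real \<Rightarrow> 'w \<Rightarrow> real"
  where "mart t \<omega> = \<xi> t \<omega> - z - drift t \<omega>"

text \<open>The compensator of the square collects \<open>2 * (\<xi> u \<omega> - z) * rate u
  \<omega> = - 2 * lam * \<bar>\<xi> u \<omega> - z\<bar>\<close> and the clock running until
  \<open>\<sigma>\<close>.\<close>

definition mart2 :: "real \<Rightarrow> 'w \<Rightarrow> real"
  where "mart2 t \<omega> = (\<xi> t \<omega> - z)\<^sup>2 + 2 * lam * distance_integral t \<omega> - stop_at t (\<sigma> \<omega>)"

lemma rate_bound: "\<bar>rate u \<omega>\<bar> \<le> lam"
  using lam_pos by (simp add: rate_def abs_mult abs_sgn_eq)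

lemma rate_path_measurable: "\<omega> \<in> space M \<Longrightarrow> (\<lambda>u. rate u \<omega>) \<in> borel_measurable borel"
  unfolding rate_def using xi_path_measurable by measurable

lemma rate_adapted: "0 \<le> u \<Longrightarrow> rate u \<in> borel_measurable (F\<xi> u)"
  unfolding rate_def using xi_adapted[of u u] by measurable

lemma rate_pair_measurable [measurable]: "(\<lambda>(u, \<omega>). rate u \<omega>) \<in> borel_measurable (borel \<Otimes>\<^sub>M M)"
  unfolding rate_def by measurable

lemma drift_adapted: "0 \<le> t \<Longrightarrow> drift t \<in> borel_measurable (F\<xi> t)"
  using adapted_integral[of t "\<lambda>x. lam * sgn (z - x)"] by (simp add: drift_def[abs_def] rate_def)

lemma drift_cont: "\<omega> \<in> space M \<Longrightarrow> continuous_on UNIV (\<lambda>t. drift t \<omega>)"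
  unfolding drift_def by (rule continuous_on_integral_indicator[OF rate_path_measurable rate_bound])

lemma drift_lipschitz: "\<omega> \<in> space M \<Longrightarrow> \<bar>drift t \<omega> - drift s \<omega>\<bar> \<le> lam * \<bar>t - s\<bar>"
  unfolding drift_def by (rule integral_indicator_lipschitz[OF rate_path_measurable rate_bound])

lemma drift_0: "t \<le> 0 \<Longrightarrow> drift t \<omega> = 0"
proof -
  assume t: "t \<le> 0"
  have "AE u in lborel. indicator {0..t} u * rate u \<omega> = 0"
    by (rule AE_mp[OF AE_lborel_singleton[of 0] AE_I2]) (use t in \<open>auto simp: indicator_def\<close>)
  then show ?thesis unfolding drift_def by (rule integral_eq_zero_AE)
qed

lemma drift_bound: "\<omega> \<in> space M \<Longrightarrow> 0 \<le> t \<Longrightarrow> \<bar>drift t \<omega>\<bar> \<le> lam * t"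
  using drift_lipschitz[of \<omega> t 0] by (simp add: drift_0)

lemma drift_measurable [measurable]: "drift t \<in> borel_measurable M"
proof (cases "0 \<le> t")
  case True
  then show ?thesis by (intro measurable_from_subalg[OF subalgebra_F drift_adapted])
next
  case False
  then have "drift t = (\<lambda>_. 0)" by (intro ext drift_0) simp
  then show ?thesis by simp
qed

lemma drift_pair_measurable [measurable]: "(\<lambda>(t, \<omega>). drift t \<omega>) \<in> borel_measurable (borel \<Otimes>\<^sub>M M)"
  by (rule pair_measurable_continuous_process) (auto simp: drift_cont)

lemma mart_pair_measurable [measurable]: "(\<lambda>(t, \<omega>). mart t \<omega>) \<in> borel_measurable (borel \<Otimes>\<^sub>M M)"
  unfolding mart_def by measurable

lemma abs_xi_le: "\<omega> \<in> space M \<Longrightarrow> 0 \<le> u \<Longrightarrow> \<bar>\<xi> u \<omega> - z\<bar> \<le> z + 1 * \<bar>X u \<omega>\<bar>"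
  using z_pos by (auto simp: xi_eq)

lemma abs_xi_bounded:
  assumes "\<omega> \<in> space M"
  obtains K where "\<And>u. u \<in> {0..t} \<Longrightarrow> \<bar>\<xi> u \<omega> - z\<bar> \<le> K"
proof -
  have "compact ((\<lambda>u. \<xi> u \<omega> - z) ` {0..t})"
    by (intro compact_continuous_image continuous_intros continuous_on_subset[OF xi_cont[OF assms]]) auto
  then have "bounded ((\<lambda>u. \<xi> u \<omega> - z) ` {0..t})" by (rule compact_imp_bounded)
  then obtain K where "\<forall>u\<in>{0..t}. \<bar>\<xi> u \<omega> - z\<bar> \<le> K" by (auto simp: bounded_iff)
  then show thesis using that[of K] by simp
qed

text \<open>After \<open>\<sigma>\<close> the process rests at \<open>z\<close>, where
  \<open>sgn 0 = 0\<close>, so the indicator of \<open>later u\<close> may be inserted into the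
  drift. The result has the shape of the first Dynkin formula.\<close>

lemma mart_increment:
  assumes st: "0 \<le> s" "s \<le> t" and \<omega>: "\<omega> \<in> space M"
  shows "mart t \<omega> - mart s \<omega> = (X t \<omega> - z) * indicator (later t) \<omega> - (X s \<omega> - z) * indicator (later s) \<omega>
    - (\<integral>u. indicator {s..t} u * (lam * sgn (z - X u \<omega>) * indicator (later u) \<omega>) \<partial>lborel)"
proof -
  have "drift t \<omega> = drift s \<omega> + (\<integral>u. indicator {s..t} u * rate u \<omega> \<partial>lborel)"
    unfolding drift_def
    using st rate_bound rate_path_measurable[OF \<omega>] by (intro integral_indicator_split) auto
  also have "(\<integral>u. indicator {s..t} u * rate u \<omega> \<partial>lborel)
      = (\<integral>u. indicator {s..t} u * (lam * sgn (z - X u \<omega>) * indicator (later u) \<omega>) \<partial>lborel)"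
    using st \<omega> by (intro Bochner_Integration.integral_cong refl) (auto simp: indicator_def rate_def xi_eq)
  finally show ?thesis using st \<omega> by (simp add: mart_def xi_eq)
qed

text \<open>The distance to \<open>z\<close> vanishes after \<open>\<sigma>\<close> and the clock is
  the integral of the indicator of \<open>later u\<close>; both merge into the time integral of the
  second Dynkin formula.\<close>

lemma mart2_increment:
  assumes st: "0 \<le> s" "s \<le> t" and \<omega>: "\<omega> \<in> space M"
  shows "mart2 t \<omega> - mart2 s \<omega> = (X t \<omega> - z)\<^sup>2 * indicator (later t) \<omega> - (X s \<omega> - z)\<^sup>2 * indicator (later s) \<omega>
    - (\<integral>u. indicator {s..t} u * ((1 - 2 * lam * \<bar>X u \<omega> - z\<bar>) * indicator (later u) \<omega>) \<partial>lborel)"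
proof -
  note [measurable] = xi_path_measurable[OF \<omega>] later_path_measurable[OF \<omega>]
  obtain K where K: "\<And>u. u \<in> {0..t} \<Longrightarrow> \<bar>\<xi> u \<omega> - z\<bar> \<le> K" using abs_xi_bounded[OF \<omega>, of t] by blast
  have 1: "distance_integral t \<omega> = distance_integral s \<omega> + (\<integral>u. indicator {s..t} u * \<bar>\<xi> u \<omega> - z\<bar> \<partial>lborel)"
    unfolding distance_integral_def by (rule integral_indicator_split[where K = K]) (use st K in auto)
  have 2: "stop_at t (\<sigma> \<omega>) = stop_at s (\<sigma> \<omega>) + (\<integral>u. indicator {s..t} u * indicat_real (later u) \<omega> \<partial>lborel)"
    using st \<omega> by (simp only: stop_at_eq_integral, subst integral_indicator_split[where K = 1 and s = s]) auto
  have int1: "integrable lborel (\<lambda>u. indicator {s..t} u * \<bar>\<xi> u \<omega> - z\<bar>)"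
    by (rule integrable_indicator_bounded[where K = K]) (use st K in auto)
  have int2: "integrable lborel (\<lambda>u. indicator {s..t} u * indicat_real (later u) \<omega>)"
    by (rule integrable_indicator_bounded[where K = 1]) auto
  have "(\<integral>u. indicator {s..t} u * ((1 - 2 * lam * \<bar>X u \<omega> - z\<bar>) * indicator (later u) \<omega>) \<partial>lborel)
      = (\<integral>u. indicator {s..t} u * indicat_real (later u) \<omega> - 2 * lam * (indicator {s..t} u * \<bar>\<xi> u \<omega> - z\<bar>) \<partial>lborel)"
    using st \<omega> by (intro Bochner_Integration.integral_cong refl) (auto simp: indicator_def xi_eq)
  also have "\<dots> = (\<integral>u. indicator {s..t} u * indicat_real (later u) \<omega> \<partial>lborel)
      - 2 * lam * (\<integral>u. indicator {s..t} u * \<bar>\<xi> u \<omega> - z\<bar> \<partial>lborel)"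
    using int1 int2 by simp
  also have "\<dots> = (stop_at t (\<sigma> \<omega>) - stop_at s (\<sigma> \<omega>)) - 2 * lam * (distance_integral t \<omega> - distance_integral s \<omega>)"
    using 1 2 by simp
  finally show ?thesis using st \<omega> by (simp add: mart2_def xi_eq algebra_simps)
qed

lemma mart_increment_zero:
  assumes st: "0 \<le> s" "s \<le> t" and A: "A \<in> sets (F\<xi> s)"
  shows "(\<integral>\<omega>. indicator A \<omega> * (mart t \<omega> - mart s \<omega>) \<partial>M) = 0"
proof (rule trace_integral_zero[OF st(1) A])
  fix \<omega> assume \<omega>: "\<omega> \<in> space M" "\<omega> \<notin> later s"
  then have n: "\<omega> \<notin> later u" if "s \<le> u" for u using later_antimono[OF that] by blast
  have "(\<integral>u. indicator {s..t} u * (lam * sgn (z - X u \<omega>) * indicator (later u) \<omega>) \<partial>lborel) = (\<integral>u. (0 :: real) \<partial>(lborel :: real measure))"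
    using n by (intro Bochner_Integration.integral_cong refl) (auto simp: indicator_def)
  then show "mart t \<omega> - mart s \<omega> = 0"
    using n st by (simp add: mart_increment[OF st \<omega>(1)])
next
  fix C assume "C \<in> sets (FX s)"
  from dynkin_first_moment[OF st this] show "(\<integral>\<omega>. indicator C \<omega> * (mart t \<omega> - mart s \<omega>) \<partial>M) = 0"
    by (subst Bochner_Integration.integral_cong[OF refl]) (auto simp: mart_increment[OF st])
qed

lemma mart2_increment_zero:
  assumes st: "0 \<le> s" "s \<le> t" and A: "A \<in> sets (F\<xi> s)"
  shows "(\<integral>\<omega>. indicator A \<omega> * (mart2 t \<omega> - mart2 s \<omega>) \<partial>M) = 0"
proof (rule trace_integral_zero[OF st(1) A])
  fix \<omega> assume \<omega>: "\<omega> \<in> space M" "\<omega> \<notin> later s"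
  then have n: "\<omega> \<notin> later u" if "s \<le> u" for u using later_antimono[OF that] by blast
  have "(\<integral>u. indicator {s..t} u * ((1 - 2 * lam * \<bar>X u \<omega> - z\<bar>) * indicator (later u) \<omega>) \<partial>lborel) = (\<integral>u. (0 :: real) \<partial>(lborel :: real measure))"
    using n by (intro Bochner_Integration.integral_cong refl) (auto simp: indicator_def)
  then show "mart2 t \<omega> - mart2 s \<omega> = 0"
    using n st by (simp add: mart2_increment[OF st \<omega>(1)])
next
  fix C assume "C \<in> sets (FX s)"
  from dynkin_second_moment[OF st this] show "(\<integral>\<omega>. indicator C \<omega> * (mart2 t \<omega> - mart2 s \<omega>) \<partial>M) = 0"
    by (subst Bochner_Integration.integral_cong[OF refl]) (auto simp: mart2_increment[OF st])
qed

lemma integrable_xi_square: "0 \<le> t \<Longrightarrow> integrable M (\<lambda>\<omega>. (\<xi> t \<omega> - z)\<^sup>2)"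
proof -
  assume t: "0 \<le> t"
  have "integrable M (\<lambda>\<omega>. (X t \<omega> - z)\<^sup>2)"
  proof (rule integrable_X_quadratic[OF t])
    fix x :: real
    have "0 \<le> (x + z)\<^sup>2" by simp
    then have "(x - z)\<^sup>2 \<le> 2 * z\<^sup>2 + 2 * x\<^sup>2" by (simp add: power2_eq_square algebra_simps)
    then show "\<bar>(x - z)\<^sup>2\<bar> \<le> 2 * z\<^sup>2 + 2 * x\<^sup>2" by (simp only: abs_power2)
  qed simp
  then show ?thesis
    by (rule Bochner_Integration.integrable_bound) (auto intro!: AE_I2 simp: xi_eq t)
qed

lemma integrable_mart: "0 \<le> t \<Longrightarrow> integrable M (mart t)"
proof (rule Bochner_Integration.integrable_bound)
  assume t: "0 \<le> t"
  show "integrable M (\<lambda>\<omega>. (z + lam * t) + \<bar>X t \<omega>\<bar>)" using integrable_X[OF t] by simp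
  show "AE \<omega> in M. norm (mart t \<omega>) \<le> norm ((z + lam * t) + \<bar>X t \<omega>\<bar>)"
  proof (rule AE_I2)
    fix \<omega> assume "\<omega> \<in> space M"
    then show "norm (mart t \<omega>) \<le> norm ((z + lam * t) + \<bar>X t \<omega>\<bar>)"
      using abs_xi_le[of \<omega> t] drift_bound[of \<omega> t] t unfolding mart_def real_norm_def by linarith
  qed
qed simp

lemma distance_integral_integrable: "0 \<le> t \<Longrightarrow> integrable M (distance_integral t)"
proof -
  interpret LM: pair_sigma_finite lborel M ..
  have "integrable (lborel \<Otimes>\<^sub>M M) (\<lambda>(u, \<omega>). indicator {0..t} u * \<bar>\<xi> u \<omega> - z\<bar>)"
    by (rule integrable_time_space[where a = z and b = 1]) (use abs_xi_le in auto)
  from LM.integrable_snd[OF this] show ?thesis by (simp add: distance_integral_def[abs_def])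
qed

lemma mart_adapted: "0 \<le> t \<Longrightarrow> mart t \<in> borel_measurable (F\<xi> t)"
  unfolding mart_def[abs_def]
  by (intro borel_measurable_diff borel_measurable_const xi_adapted drift_adapted order_refl)

theorem martingale_mart: "martingale M F\<xi> mart"
  by (rule martingaleI)
     (simp_all add: prob_space_axioms filtration_natural_filtration subalgebra_F integrable_mart
       mart_increment_zero adapted_def mart_adapted)

text \<open>Integration by parts makes this the stochastic integral of \<open>drift\<close> against
  \<open>mart\<close>, expressed by pathwise Lebesgue integrals only.\<close>

definition cross :: "real \<Rightarrow> 'w \<Rightarrow> real"
  where "cross t \<omega> = mart t \<omega> * drift t \<omega> - (\<integral>u. indicator {0..t} u * (mart u \<omega> * rate u \<omega>) \<partial>lborel)"

lemma mart_path_bounded: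
  assumes \<omega>: "\<omega> \<in> space M"
  obtains K where "\<And>u. u \<in> {0..t} \<Longrightarrow> \<bar>mart u \<omega>\<bar> \<le> K"
proof -
  obtain K where K: "\<And>u. u \<in> {0..t} \<Longrightarrow> \<bar>\<xi> u \<omega> - z\<bar> \<le> K" using abs_xi_bounded[OF \<omega>, of t] by blast
  show thesis
  proof (rule that[of "K + lam * t"])
    fix u assume u: "u \<in> {0..t}"
    then have "lam * u \<le> lam * t" using lam_pos by simp
    then show "\<bar>mart u \<omega>\<bar> \<le> K + lam * t"
      using K[OF u] drift_bound[OF \<omega>, of u] u unfolding mart_def by auto
  qed
qed

lemma mart_path_measurable: "\<omega> \<in> space M \<Longrightarrow> (\<lambda>u. mart u \<omega>) \<in> borel_measurable borel"
  unfolding mart_def using xi_path_measurable borel_measurable_continuous_onI[OF drift_cont] by measurable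

lemma mart_rate_path_bounded:
  assumes \<omega>: "\<omega> \<in> space M"
  obtains K where "\<And>u. u \<in> {0..t} \<Longrightarrow> \<bar>mart u \<omega> * rate u \<omega>\<bar> \<le> K"
proof -
  obtain K where K: "\<And>u. u \<in> {0..t} \<Longrightarrow> \<bar>mart u \<omega>\<bar> \<le> K" using mart_path_bounded[OF \<omega>, of t] by blast
  show thesis
  proof (rule that[of "K * lam"])
    fix u assume u: "u \<in> {0..t}"
    show "\<bar>mart u \<omega> * rate u \<omega>\<bar> \<le> K * lam"
      unfolding abs_mult using K[OF u] rate_bound lam_pos by (intro mult_mono) (auto intro: order_trans[OF abs_ge_zero])
  qed
qed

text \<open>The increment of \<open>drift\<close> is the integral of \<open>rate\<close>, so
  \<open>mart t\<close> can be moved under that integral and paired with \<open>- mart u\<close>;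
  only increments of \<open>mart\<close> into the future of \<open>u\<close> remain.\<close>

lemma cross_increment:
  assumes st: "0 \<le> s" "s \<le> t" and \<omega>: "\<omega> \<in> space M"
  shows "cross t \<omega> - cross s \<omega> = drift s \<omega> * (mart t \<omega> - mart s \<omega>)
    + (\<integral>u. indicator {s..t} u * (rate u \<omega> * (mart t \<omega> - mart u \<omega>)) \<partial>lborel)"
proof -
  note [measurable] = rate_path_measurable[OF \<omega>] mart_path_measurable[OF \<omega>]
  obtain K where K: "\<And>u. u \<in> {0..t} \<Longrightarrow> \<bar>mart u \<omega> * rate u \<omega>\<bar> \<le> K" using mart_rate_path_bounded[OF \<omega>, of t] by blast
  have 1: "drift t \<omega> = drift s \<omega> + (\<integral>u. indicator {s..t} u * rate u \<omega> \<partial>lborel)"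
    unfolding drift_def using st rate_bound by (intro integral_indicator_split) auto
  have 2: "(\<integral>u. indicator {0..t} u * (mart u \<omega> * rate u \<omega>) \<partial>lborel)
      = (\<integral>u. indicator {0..s} u * (mart u \<omega> * rate u \<omega>) \<partial>lborel) + (\<integral>u. indicator {s..t} u * (mart u \<omega> * rate u \<omega>) \<partial>lborel)"
    by (rule integral_indicator_split[where K = K]) (use st K in auto)
  have int1: "integrable lborel (\<lambda>u. indicator {s..t} u * rate u \<omega>)"
    using rate_bound by (intro integrable_indicator_bounded) auto
  have int2: "integrable lborel (\<lambda>u. indicator {s..t} u * (mart u \<omega> * rate u \<omega>))"
    by (rule integrable_indicator_bounded[where K = K]) (use st K in auto)
  have "(\<integral>u. indicator {s..t} u * (rate u \<omega> * (mart t \<omega> - mart u \<omega>)) \<partial>lborel)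
      = (\<integral>u. mart t \<omega> * (indicator {s..t} u * rate u \<omega>) - indicator {s..t} u * (mart u \<omega> * rate u \<omega>) \<partial>lborel)"
    by (intro Bochner_Integration.integral_cong refl) (simp add: algebra_simps)
  also have "\<dots> = mart t \<omega> * (\<integral>u. indicator {s..t} u * rate u \<omega> \<partial>lborel) - (\<integral>u. indicator {s..t} u * (mart u \<omega> * rate u \<omega>) \<partial>lborel)"
    using int1 int2 by simp
  finally show ?thesis using 1 2 by (simp add: cross_def algebra_simps)
qed

text \<open>Integration by parts: only the time integral of increments of the martingale after
  time \<open>u\<close>, weighted by the bounded rate at time \<open>u\<close>, remains, and each of these has mean zero.\<close>

lemma cross_increment_zero:
  assumes st: "0 \<le> s" "s \<le> t" and A: "A \<in> sets (F\<xi> s)"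
  shows "(\<integral>\<omega>. indicator A \<omega> * (cross t \<omega> - cross s \<omega>) \<partial>M) = 0"
proof -
  interpret LM: pair_sigma_finite lborel M ..
  have A_M[measurable]: "A \<in> events" using A by (rule F_subset)
  have t: "0 \<le> t" using st by simp
  let ?G = "\<lambda>u \<omega>. indicator A \<omega> * rate u \<omega> * (mart t \<omega> - mart u \<omega>)"
  \<comment> \<open>Since the rate is bounded by \<open>lam\<close>, the integrand is dominated by
    \<open>lam\<close> times an increment of \<open>mart\<close>, and both parts of that increment
    are integrable in time and space.\<close>
  have joint: "integrable (lborel \<Otimes>\<^sub>M M) (\<lambda>(u, \<omega>). indicator {s..t} u * ?G u \<omega>)"
  proof -
    have "integrable lborel (indicat_real {s..t})" by (rule integrable_real_indicator) (auto simp: emeasure_lborel_Icc_eq)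
    then have "integrable (lborel \<Otimes>\<^sub>M M) (\<lambda>(u, \<omega>). indicat_real {s..t} u * mart t \<omega>)"
      by (rule LM.integrable_product[OF _ integrable_mart[OF t]])
    moreover have "integrable (lborel \<Otimes>\<^sub>M M) (\<lambda>(u, \<omega>). indicator {s..t} u * mart u \<omega>)"
    proof (rule integrable_time_space[where a = "z + lam * t" and b = 1])
      fix u \<omega> assume u: "s \<le> u" "u \<le> t" and \<omega>: "\<omega> \<in> space M"
      have "lam * u \<le> lam * t" using u lam_pos by simp
      then show "\<bar>mart u \<omega>\<bar> \<le> z + lam * t + 1 * \<bar>X u \<omega>\<bar>"
        using abs_xi_le[OF \<omega>, of u] drift_bound[OF \<omega>, of u] u st unfolding mart_def by linarith
    qed (use st in auto)
    ultimately have "integrable (lborel \<Otimes>\<^sub>M M) (\<lambda>p. lam * ((case p of (u, \<omega>) \<Rightarrow> indicat_real {s..t} u * mart t \<omega>)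
        - (case p of (u, \<omega>) \<Rightarrow> indicator {s..t} u * mart u \<omega>)))"
      by (intro integrable_mult_right Bochner_Integration.integrable_diff)
    then show ?thesis
    proof (rule Bochner_Integration.integrable_bound)
      show "AE p in lborel \<Otimes>\<^sub>M M. norm (case p of (u, \<omega>) \<Rightarrow> indicator {s..t} u * ?G u \<omega>)
        \<le> norm (lam * ((case p of (u, \<omega>) \<Rightarrow> indicat_real {s..t} u * mart t \<omega>) - (case p of (u, \<omega>) \<Rightarrow> indicator {s..t} u * mart u \<omega>)))"
      proof (rule AE_I2)
        fix p :: "real \<times> 'w"
        obtain u \<omega> where p: "p = (u, \<omega>)" by force
        have "\<bar>rate u \<omega>\<bar> * \<bar>mart t \<omega> - mart u \<omega>\<bar> \<le> lam * \<bar>mart t \<omega> - mart u \<omega>\<bar>"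
          by (intro mult_right_mono rate_bound) auto
        then show "norm (case p of (u, \<omega>) \<Rightarrow> indicator {s..t} u * ?G u \<omega>)
        \<le> norm (lam * ((case p of (u, \<omega>) \<Rightarrow> indicat_real {s..t} u * mart t \<omega>) - (case p of (u, \<omega>) \<Rightarrow> indicator {s..t} u * mart u \<omega>)))"
          using lam_pos by (auto simp: p indicator_def abs_mult)
      qed
    qed measurable
  qed
  have 1: "(\<integral>\<omega>. indicator A \<omega> * drift s \<omega> * (mart t \<omega> - mart s \<omega>) \<partial>M) = 0"
  proof (rule martingale_orthogonal[OF prob_space_axioms martingale_mart st])
    show "(\<lambda>\<omega>. indicator A \<omega> * drift s \<omega>) \<in> borel_measurable (F\<xi> s)"
      using A drift_adapted[OF st(1)] by measurable
    show "\<bar>indicator A \<omega> * drift s \<omega>\<bar> \<le> lam * s" if "\<omega> \<in> space M" for \<omega>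
      using drift_bound[OF that st(1)] lam_pos st by (auto simp: indicator_def)
  qed
  have 2: "(\<integral>\<omega>. ?G u \<omega> \<partial>M) = 0" if u: "s \<le> u" "u \<le> t" for u
  proof (rule martingale_orthogonal[OF prob_space_axioms martingale_mart order_trans[OF st(1) u(1)] u(2)])
    have "A \<in> sets (F\<xi> u)" using A natural_filtration_mono[OF u(1), of M \<xi>] by auto
    then show "(\<lambda>\<omega>. indicator A \<omega> * rate u \<omega>) \<in> borel_measurable (F\<xi> u)"
      using rate_adapted[OF order_trans[OF st(1) u(1)]] by measurable
    show "\<bar>indicator A \<omega> * rate u \<omega>\<bar> \<le> lam" for \<omega>
      using rate_bound[of u \<omega>] lam_pos by (auto simp: indicator_def)
  qed
  have int1: "integrable M (\<lambda>\<omega>. indicator A \<omega> * drift s \<omega> * (mart t \<omega> - mart s \<omega>))"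
  proof (rule Bochner_Integration.integrable_bound)
    show "integrable M (\<lambda>\<omega>. (lam * s) * (mart t \<omega> - mart s \<omega>))"
      using integrable_mart[OF t] integrable_mart[OF st(1)] by simp
    show "AE \<omega> in M. norm (indicator A \<omega> * drift s \<omega> * (mart t \<omega> - mart s \<omega>)) \<le> norm ((lam * s) * (mart t \<omega> - mart s \<omega>))"
      using drift_bound[OF _ st(1)] lam_pos st
      by (intro AE_I2) (auto simp: indicator_def abs_mult intro!: mult_right_mono)
  qed measurable
  have "(\<integral>\<omega>. indicator A \<omega> * (cross t \<omega> - cross s \<omega>) \<partial>M)
      = (\<integral>\<omega>. indicator A \<omega> * drift s \<omega> * (mart t \<omega> - mart s \<omega>) + (\<integral>u. indicator {s..t} u * ?G u \<omega> \<partial>lborel) \<partial>M)"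
  proof (rule Bochner_Integration.integral_cong[OF refl])
    fix \<omega> assume \<omega>: "\<omega> \<in> space M"
    show "indicator A \<omega> * (cross t \<omega> - cross s \<omega>)
      = indicator A \<omega> * drift s \<omega> * (mart t \<omega> - mart s \<omega>) + (\<integral>u. indicator {s..t} u * ?G u \<omega> \<partial>lborel)"
      unfolding cross_increment[OF st \<omega>] by (cases "\<omega> \<in> A") auto
  qed
  also have "\<dots> = (\<integral>\<omega>. (\<integral>u. indicator {s..t} u * ?G u \<omega> \<partial>lborel) \<partial>M)"
    using int1 1 LM.integrable_snd[OF joint] by (subst Bochner_Integration.integral_add) auto
  also have "\<dots> = (\<integral>u. (\<integral>\<omega>. indicator {s..t} u * ?G u \<omega> \<partial>M) \<partial>lborel)"
    by (rule LM.Fubini_integral[OF joint])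
  also have "\<dots> = (\<integral>u. (0 :: real) \<partial>(lborel :: real measure))"
    using 2 by (intro Bochner_Integration.integral_cong refl) (auto simp: indicator_def)
  finally show ?thesis by simp
qed

end

section \<open>Transfer to the given Brownian motion\<close>

lemma stop_at_le: "0 \<le> t \<Longrightarrow> stop_at t c \<le> t"
  by (simp add: stop_at_eq)

context drifted_paths
begin

text \<open>With \<open>y = \<xi> - z\<close> one has
  \<open>y * rate = - lam * \<bar>y\<bar>\<close>, and the integral of \<open>drift * rate\<close>
  is half of \<open>drift\<^sup>2\<close>. So \<open>cross\<close> equals
  \<open>mart * drift + lam * distance_integral + drift\<^sup>2 / 2\<close>, and expanding
  \<open>(y - drift)\<^sup>2\<close> leaves the identity.\<close>

lemma mart_square_eq:
  assumes \<omega>: "\<omega> \<in> space M"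
  shows "(mart t \<omega>)\<^sup>2 - stop_at t (\<sigma> \<omega>) = mart2 t \<omega> - 2 * cross t \<omega>"
proof -
  note [measurable] = rate_path_measurable[OF \<omega>] xi_path_measurable[OF \<omega>]
    borel_measurable_continuous_onI[OF drift_cont[OF \<omega>]]
  obtain K where K: "\<And>u. u \<in> {0..t} \<Longrightarrow> \<bar>\<xi> u \<omega> - z\<bar> \<le> K" using abs_xi_bounded[OF \<omega>, of t] by blast
  have sq: "(drift t \<omega>)\<^sup>2 = 2 * (\<integral>u. indicator {0..t} u * (drift u \<omega> * rate u \<omega>) \<partial>lborel)"
    unfolding drift_def by (rule integral_indicator_square[where K = lam]) (use rate_bound in auto)
  have int1: "integrable lborel (\<lambda>u. indicator {0..t} u * \<bar>\<xi> u \<omega> - z\<bar>)"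
    by (rule integrable_indicator_bounded[where K = K]) (use K in auto)
  have int2: "integrable lborel (\<lambda>u. indicator {0..t} u * (drift u \<omega> * rate u \<omega>))"
  proof (rule integrable_indicator_bounded[where K = "(lam * t) * lam"])
    fix u assume u: "u \<in> {0..t}"
    then have "lam * u \<le> lam * t" using lam_pos by simp
    then have "\<bar>drift u \<omega>\<bar> \<le> lam * t" using drift_bound[OF \<omega>, of u] u by simp
    then show "\<bar>drift u \<omega> * rate u \<omega>\<bar> \<le> (lam * t) * lam"
      unfolding abs_mult using rate_bound[of u \<omega>] lam_pos
      by (intro mult_mono) (auto intro: order_trans[OF abs_ge_zero])
  qed measurable
  have eq: "mart u \<omega> * rate u \<omega> = - lam * \<bar>\<xi> u \<omega> - z\<bar> - drift u \<omega> * rate u \<omega>" for u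
    by (simp add: mart_def rate_def sgn_if abs_if algebra_simps)
  have "(\<integral>u. indicator {0..t} u * (mart u \<omega> * rate u \<omega>) \<partial>lborel)
      = (\<integral>u. - lam * (indicator {0..t} u * \<bar>\<xi> u \<omega> - z\<bar>) - indicator {0..t} u * (drift u \<omega> * rate u \<omega>) \<partial>lborel)"
    by (intro Bochner_Integration.integral_cong refl) (auto simp: indicator_def eq)
  also have "\<dots> = - lam * distance_integral t \<omega> - (\<integral>u. indicator {0..t} u * (drift u \<omega> * rate u \<omega>) \<partial>lborel)"
    using int1 int2 by (simp add: distance_integral_def)
  finally have "cross t \<omega> = mart t \<omega> * drift t \<omega> + lam * distance_integral t \<omega> + (drift t \<omega>)\<^sup>2 / 2"
    using sq by (simp add: cross_def)
  then show ?thesis by (simp add: mart2_def mart_def power2_eq_square algebra_simps)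
qed

definition b\<xi> :: "real \<Rightarrow> 'w \<Rightarrow> real"
  where "b\<xi> t \<omega> = \<xi> t \<omega> - drift t \<omega>"

lemma b_eq: "b\<xi> t \<omega> = mart t \<omega> + z"
  by (simp add: b\<xi>_def mart_def)

lemma b_cont: "\<omega> \<in> space M \<Longrightarrow> continuous_on UNIV (\<lambda>t. b\<xi> t \<omega>)"
  unfolding b\<xi>_def by (intro continuous_on_diff xi_cont drift_cont)

lemma b_adapted: "0 \<le> t \<Longrightarrow> b\<xi> t \<in> borel_measurable (F\<xi> t)"
  unfolding b\<xi>_def[abs_def] by (intro borel_measurable_diff xi_adapted drift_adapted order_refl)

lemma b_0: "\<omega> \<in> space M \<Longrightarrow> b\<xi> 0 \<omega> = 0"
  by (simp add: b\<xi>_def xi_0 drift_0)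

theorem martingale_b: "martingale M F\<xi> b\<xi>"
proof (rule martingaleI)
  show "adapted F\<xi> b\<xi>" unfolding adapted_def using b_adapted by simp
  show "integrable M (b\<xi> t)" if "0 \<le> t" for t
    unfolding b_eq[abs_def] using integrable_mart[OF that] by simp
  show "(\<integral>\<omega>. indicator A \<omega> * (b\<xi> t \<omega> - b\<xi> s \<omega>) \<partial>M) = 0" if "0 \<le> s" "s \<le> t" "A \<in> sets (F\<xi> s)" for s t A
    using mart_increment_zero[OF that] by (simp add: b_eq)
qed (auto intro: prob_space_axioms filtration_natural_filtration subalgebra_F)

lemma integrable_mart2: "0 \<le> t \<Longrightarrow> integrable M (mart2 t)"
proof -
  assume t: "0 \<le> t"
  have [measurable]: "(\<lambda>\<omega>. stop_at t (\<sigma> \<omega>)) \<in> borel_measurable M"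
    by (rule measurable_from_subalg[OF subalgebra_F stop_at_adapted[OF t]])
  have "integrable M (\<lambda>\<omega>. stop_at t (\<sigma> \<omega>))"
    by (rule integrable_const_bound[of _ t]) (auto intro!: AE_I2 simp: stop_at_nonneg stop_at_le t)
  then show ?thesis
    unfolding mart2_def[abs_def] using integrable_xi_square[OF t] distance_integral_integrable[OF t] by simp
qed

lemma integrable_mart_square: "0 \<le> t \<Longrightarrow> integrable M (\<lambda>\<omega>. (mart t \<omega>)\<^sup>2)"
proof (rule Bochner_Integration.integrable_bound)
  assume t: "0 \<le> t"
  show "integrable M (\<lambda>\<omega>. 2 * (\<xi> t \<omega> - z)\<^sup>2 + 2 * (lam * t)\<^sup>2)"
    using integrable_xi_square[OF t] by simp
  show "AE \<omega> in M. norm ((mart t \<omega>)\<^sup>2) \<le> norm (2 * (\<xi> t \<omega> - z)\<^sup>2 + 2 * (lam * t)\<^sup>2)"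
  proof (rule AE_I2)
    fix \<omega> assume "\<omega> \<in> space M"
    then have "\<bar>drift t \<omega>\<bar>\<^sup>2 \<le> (lam * t)\<^sup>2" using drift_bound t by (intro power_mono) auto
    moreover have "0 \<le> ((\<xi> t \<omega> - z) + drift t \<omega>)\<^sup>2" by simp
    then have "(mart t \<omega>)\<^sup>2 \<le> 2 * (\<xi> t \<omega> - z)\<^sup>2 + 2 * (drift t \<omega>)\<^sup>2"
      unfolding mart_def by (simp add: power2_eq_square algebra_simps)
    ultimately have "(mart t \<omega>)\<^sup>2 \<le> 2 * (\<xi> t \<omega> - z)\<^sup>2 + 2 * (lam * t)\<^sup>2" by simp
    then show "norm ((mart t \<omega>)\<^sup>2) \<le> norm (2 * (\<xi> t \<omega> - z)\<^sup>2 + 2 * (lam * t)\<^sup>2)" by simp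
  qed
qed simp

theorem martingale_b_square: "martingale M F\<xi> (\<lambda>t \<omega>. (b\<xi> t \<omega>)\<^sup>2 - stop_at t (\<sigma> \<omega>))"
proof (rule martingaleI)
  have stop_meas: "(\<lambda>\<omega>. stop_at t (\<sigma> \<omega>)) \<in> borel_measurable M" if "0 \<le> t" for t
    by (rule measurable_from_subalg[OF subalgebra_F stop_at_adapted[OF that]])
  have int_stop: "integrable M (\<lambda>\<omega>. stop_at t (\<sigma> \<omega>))" if "0 \<le> t" for t
    by (rule integrable_const_bound[of _ t])
       (auto intro!: AE_I2 simp: stop_at_nonneg stop_at_le that stop_meas)
  \<comment> \<open>Integrability is read off from \<open>mart_square_eq\<close>, solved for
    \<open>cross\<close>, instead of estimating the product of \<open>mart\<close> and
    \<open>drift\<close>.\<close>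
  have int_cross: "integrable M (cross t)" if t: "0 \<le> t" for t
  proof -
    have "integrable M (\<lambda>\<omega>. (mart2 t \<omega> - ((mart t \<omega>)\<^sup>2 - stop_at t (\<sigma> \<omega>))) / 2)"
      using integrable_mart2[OF t] integrable_mart_square[OF t] int_stop[OF t] by simp
    then show ?thesis
      by (rule Bochner_Integration.integrable_cong[THEN iffD1, OF refl, rotated]) (simp add: mart_square_eq)
  qed
  show "adapted F\<xi> (\<lambda>t \<omega>. (b\<xi> t \<omega>)\<^sup>2 - stop_at t (\<sigma> \<omega>))"
    unfolding adapted_def by (intro allI impI borel_measurable_diff borel_measurable_power b_adapted stop_at_adapted)
  show "integrable M (\<lambda>\<omega>. (b\<xi> t \<omega>)\<^sup>2 - stop_at t (\<sigma> \<omega>))" if "0 \<le> t" for t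
    using integrable_mart_square[OF that] integrable_mart[OF that] int_stop[OF that]
    by (simp add: b_eq power2_sum)
  show "(\<integral>\<omega>. indicator A \<omega> * (((b\<xi> t \<omega>)\<^sup>2 - stop_at t (\<sigma> \<omega>)) - ((b\<xi> s \<omega>)\<^sup>2 - stop_at s (\<sigma> \<omega>))) \<partial>M) = 0"
    if st: "0 \<le> s" "s \<le> t" and A: "A \<in> sets (F\<xi> s)" for s t A
  proof -
    have t: "0 \<le> t" using st by simp
    have A_M: "A \<in> events" using A by (rule F_subset)
    \<comment> \<open>Undoing the shift by \<open>z\<close> adds a multiple of the martingale
      \<open>mart\<close> and a constant, so all increments still have mean zero.\<close>
    have b2: "(b\<xi> u \<omega>)\<^sup>2 - stop_at u (\<sigma> \<omega>) = mart2 u \<omega> - 2 * cross u \<omega> + 2 * z * mart u \<omega> + z\<^sup>2" if "\<omega> \<in> space M" for u \<omega>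
      using mart_square_eq[OF that, of u] by (simp add: b_eq power2_sum)
    have int: "integrable M (\<lambda>\<omega>. indicator A \<omega> * (mart2 t \<omega> - mart2 s \<omega>))"
      "integrable M (\<lambda>\<omega>. indicator A \<omega> * (cross t \<omega> - cross s \<omega>))"
      "integrable M (\<lambda>\<omega>. indicator A \<omega> * (mart t \<omega> - mart s \<omega>))"
      using integrable_mult_indicator[OF A_M Bochner_Integration.integrable_diff[OF integrable_mart2[OF t] integrable_mart2[OF st(1)]]]
        integrable_mult_indicator[OF A_M Bochner_Integration.integrable_diff[OF int_cross[OF t] int_cross[OF st(1)]]]
        integrable_mult_indicator[OF A_M Bochner_Integration.integrable_diff[OF integrable_mart[OF t] integrable_mart[OF st(1)]]]
      by simp_all
    have "(\<integral>\<omega>. indicator A \<omega> * (((b\<xi> t \<omega>)\<^sup>2 - stop_at t (\<sigma> \<omega>)) - ((b\<xi> s \<omega>)\<^sup>2 - stop_at s (\<sigma> \<omega>))) \<partial>M)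
      = (\<integral>\<omega>. indicator A \<omega> * (mart2 t \<omega> - mart2 s \<omega>) - 2 * (indicator A \<omega> * (cross t \<omega> - cross s \<omega>))
          + 2 * z * (indicator A \<omega> * (mart t \<omega> - mart s \<omega>)) \<partial>M)"
      by (intro Bochner_Integration.integral_cong refl) (simp add: b2 algebra_simps)
    also have "\<dots> = 0"
      using int mart2_increment_zero[OF st A] cross_increment_zero[OF st A] mart_increment_zero[OF st A] by simp
    finally show ?thesis .
  qed
qed (auto intro: prob_space_axioms filtration_natural_filtration subalgebra_F)

text \<open>Between \<open>\<sigma>\<close> and \<open>t\<close> the process equals \<open>z\<close>
  and \<open>sgn 0 = 0\<close>, so cutting the integral at \<open>\<sigma>\<close> changes
  nothing.\<close>

lemma drift_eq_stopped:
  assumes \<omega>: "\<omega> \<in> space M" and t: "0 \<le> t"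
  shows "drift t \<omega> = lam * (LBINT s:{0..stop_at t (\<sigma> \<omega>)}. sgn (z - \<xi> s \<omega>))"
proof -
  have "indicator {0..t} u * rate u \<omega> = lam * (indicator {0..stop_at t (\<sigma> \<omega>)} u *\<^sub>R sgn (z - \<xi> u \<omega>))" for u
  proof (cases "\<omega> \<in> later t")
    case True
    then show ?thesis using stop_at_later[OF True t] by (simp add: rate_def)
  next
    case False
    obtain s where s: "0 < s" "s \<le> t" "X s \<omega> = z" "\<sigma> \<omega> = ennreal s" using sigma_attained[OF \<omega> t False] by blast
    have st: "stop_at t (\<sigma> \<omega>) = s" using s t by (simp add: stop_at_eq)
    show ?thesis
    proof (cases "u \<in> {s<..t}")
      case True
      then have "\<omega> \<notin> later u" using less_sigma_iff[OF \<omega>, of u] s by (auto simp: ennreal_less_iff)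
      then show ?thesis using True s \<omega> by (simp add: st rate_def xi_eq)
    qed (use s(1,2) in \<open>auto simp: st rate_def indicator_def\<close>)
  qed
  then show ?thesis by (simp add: drift_def set_lebesgue_integral_def)
qed

end

section \<open>Transfer between almost surely equal processes\<close>

lemma (in complete_measure) borel_measurable_AE_eq:
  fixes f g :: "'a \<Rightarrow> real"
  assumes g: "g \<in> borel_measurable M" and eq: "AE \<omega> in M. f \<omega> = g \<omega>"
  shows "f \<in> borel_measurable M"
proof (rule measurableI)
  from eq obtain N where N: "N \<in> null_sets M" "\<And>\<omega>. \<omega> \<in> space M - N \<Longrightarrow> f \<omega> = g \<omega>" by (rule AE_E3) blast
  fix E :: "real set" assume [measurable]: "E \<in> sets borel"
  note g[measurable]
  have eq: "f -` E \<inter> space M = ((g -` E \<inter> space M) - N) \<union> (f -` E \<inter> space M \<inter> N)"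
    using N(2) by auto
  have 1: "f -` E \<inter> space M \<inter> N \<in> sets M" by (rule complete[OF _ N(1)]) auto
  have 2: "(g -` E \<inter> space M) - N \<in> sets M" using N(1) by (intro sets.Diff measurable_sets[OF g]) auto
  show "f -` E \<inter> space M \<in> sets M" by (subst eq) (rule sets.Un[OF 2 1])
qed simp

text \<open>Both filtrations contain all null sets, so each coordinate of one process is measurable
  for the filtration of the other. The equality is exact, hence martingale properties can be moved
  by rewriting.\<close>

lemma natural_filtration_cong_AE:
  assumes X: "\<And>t. 0 \<le> t \<Longrightarrow> X t \<in> borel_measurable M" and Y: "\<And>t. 0 \<le> t \<Longrightarrow> Y t \<in> borel_measurable M"
    and eq: "\<And>t. 0 \<le> t \<Longrightarrow> AE \<omega> in M. X t \<omega> = Y t \<omega>"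
  shows "natural_filtration M X = natural_filtration M Y"
proof
  have *: "sigma_sets (space M) ({X s -` A \<inter> space M |s A. 0 \<le> s \<and> s \<le> t \<and> A \<in> sets borel} \<union> null_sets M)
    \<subseteq> sigma_sets (space M) ({Y s -` A \<inter> space M |s A. 0 \<le> s \<and> s \<le> t \<and> A \<in> sets borel} \<union> null_sets M)"
    if X: "\<And>t. 0 \<le> t \<Longrightarrow> X t \<in> borel_measurable M" and Y: "\<And>t. 0 \<le> t \<Longrightarrow> Y t \<in> borel_measurable M"
      and eq: "\<And>t. 0 \<le> t \<Longrightarrow> AE \<omega> in M. X t \<omega> = Y t \<omega>"
    for X Y :: "real \<Rightarrow> 'a \<Rightarrow> real" and t
  proof (rule sigma_sets_mono, intro Un_least subsetI)
    fix a assume "a \<in> {X s -` A \<inter> space M |s A. 0 \<le> s \<and> s \<le> t \<and> A \<in> sets borel}"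
    then obtain s A where a: "a = X s -` A \<inter> space M" "0 \<le> s" "s \<le> t" "A \<in> sets borel" by blast
    have "X s \<in> borel_measurable (natural_filtration M Y t)"
    proof (rule measurable_AE_null_sets)
      show "subalgebra M (natural_filtration M Y t)" by (rule subalgebra_natural_filtration) (rule Y)
      show "Y s \<in> borel_measurable (natural_filtration M Y t)" by (rule measurable_natural_filtration) fact+
    qed (rule null_sets_natural_filtration X[OF a(2)] eq[OF a(2)])+
    from measurable_sets[OF this a(4)] show "a \<in> sigma_sets (space M) ({Y s -` A \<inter> space M |s A. 0 \<le> s \<and> s \<le> t \<and> A \<in> sets borel} \<union> null_sets M)"
      by (simp add: a(1) sets_natural_filtration)
  qed (auto intro: sigma_sets.Basic)
  fix t
  have eq': "AE \<omega> in M. Y t \<omega> = X t \<omega>" if "0 \<le> t" for t using eq[OF that] by eventually_elim simp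
  show "natural_filtration M X t = natural_filtration M Y t"
    unfolding natural_filtration_def
    by (intro sigma_eqI antisym *[OF X Y eq] *[OF Y X eq']) (auto dest: sets.sets_into_space null_setsD2)
qed

lemma martingale_cong_AE:
  assumes "prob_space M" "complete_measure M" and Y: "martingale M F Y"
    and null: "\<And>t. null_sets M \<subseteq> sets (F t)" and eq: "\<And>t. 0 \<le> t \<Longrightarrow> AE \<omega> in M. X t \<omega> = Y t \<omega>"
  shows "martingale M F X"
proof -
  interpret prob_space M by fact
  interpret complete_measure M by fact
  have sub: "subalgebra M (F t)" for t using Y by (auto simp: martingale_def)
  have Y_F: "Y t \<in> borel_measurable (F t)" if "0 \<le> t" for t using Y that by (auto simp: martingale_def adapted_def)
  have Y_M: "Y t \<in> borel_measurable M" if "0 \<le> t" for t by (rule measurable_from_subalg[OF sub Y_F[OF that]])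
  have X_M: "X t \<in> borel_measurable M" if "0 \<le> t" for t by (rule borel_measurable_AE_eq[OF Y_M[OF that] eq[OF that]])
  show ?thesis
    unfolding martingale_def
  proof (intro conjI allI impI sub)
    show "filtration (space M) F" using Y by (simp add: martingale_def)
    show "adapted F X"
      unfolding adapted_def using measurable_AE_null_sets[OF sub null X_M Y_F eq] by blast
    show "integrable M (X t)" if "0 \<le> t" for t
      using Y that by (subst integrable_cong_AE[OF X_M Y_M eq]) (auto simp: martingale_def)
    fix s t :: real assume st: "0 \<le> s \<and> s \<le> t"
    interpret s: finite_measure_subalgebra M "F s" by unfold_locales (rule sub)
    have "AE \<omega> in M. real_cond_exp M (F s) (X t) \<omega> = real_cond_exp M (F s) (Y t) \<omega>"
      using st by (intro s.real_cond_exp_cong eq X_M Y_M) auto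
    moreover have "AE \<omega> in M. real_cond_exp M (F s) (Y t) \<omega> = Y s \<omega>" using Y st by (auto simp: martingale_def)
    moreover have "AE \<omega> in M. X s \<omega> = Y s \<omega>" using eq st by auto
    ultimately show "AE \<omega> in M. real_cond_exp M (F s) (X t) \<omega> = X s \<omega>" by eventually_elim simp
  qed
qed

text \<open>The constant times \<open>n\<close> localise. Stopped there, increments after
  \<open>n\<close> vanish and earlier ones are increments of \<open>X\<close> itself.\<close>

lemma martingale_imp_local_martingale:
  assumes M: "prob_space M" and X: "martingale M F X"
  shows "local_martingale M F X"
proof -
  interpret prob_space M by fact
  have filt: "filtration (space M) F" and sub: "\<And>t. subalgebra M (F t)" and ad: "adapted F X"
    and int: "\<And>t. 0 \<le> t \<Longrightarrow> integrable M (X t)"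
    using X by (auto simp: martingale_def)
  have X_F: "X s \<in> borel_measurable (F t)" if "0 \<le> s" "s \<le> t" for s t
  proof -
    have "X s \<in> borel_measurable (F s)" using ad that by (simp add: adapted_def)
    moreover have "subalgebra (F t) (F s)"
      using filtration.sets_F_mono[OF filt that(2)] filtration.space_F[OF filt] by (simp add: subalgebra_def)
    ultimately show ?thesis by (rule measurable_from_subalg[rotated])
  qed
  have "martingale M F (\<lambda>t \<omega>. X (min t (real n)) \<omega> - X 0 \<omega>)" for n
  proof (rule martingaleI[OF M filt sub])
    show "adapted F (\<lambda>t \<omega>. X (min t (real n)) \<omega> - X 0 \<omega>)"
      unfolding adapted_def by (intro allI impI borel_measurable_diff X_F) auto
    show "integrable M (\<lambda>\<omega>. X (min t (real n)) \<omega> - X 0 \<omega>)" if "0 \<le> t" for t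
      using that by (intro Bochner_Integration.integrable_diff int) auto
    fix s t A assume st: "0 \<le> s" "s \<le> t" and A: "A \<in> sets (F s)"
    show "(\<integral>\<omega>. indicator A \<omega> * ((X (min t (real n)) \<omega> - X 0 \<omega>) - (X (min s (real n)) \<omega> - X 0 \<omega>)) \<partial>M) = 0"
    proof (cases "real n \<le> s")
      case True
      then have "min t (real n) = real n" "min s (real n) = real n" using st by simp_all
      then show ?thesis by simp
    next
      case False
      then have "(\<integral>\<omega>. indicator A \<omega> * (X (min t (real n)) \<omega> - X s \<omega>) \<partial>M) = 0"
        using st A by (intro martingale_orthogonal[OF M X, where K = 1]) (auto simp: indicator_def)
      then show ?thesis using False by (simp add: min_def)
    qed
  qed
  then show ?thesis
    unfolding local_martingale_def using ad
    by (intro conjI exI[of _ "\<lambda>n _. real n"])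
       (auto intro: stopping_time_const filterlim_real_sequentially simp: incseq_def)
qed

lemma ae_continuous_imp_ae_cadlag:
  assumes "ae_continuous M X"
  shows "ae_cadlag M X"
  using assms unfolding ae_continuous_def ae_cadlag_def
proof eventually_elim
  case (elim \<omega>)
  show ?case
  proof (intro conjI allI impI)
    fix t :: real assume t: "0 \<le> t"
    then have "continuous (at t within {0..}) (\<lambda>s. X s \<omega>)" using elim by (simp add: continuous_on_eq_continuous_within)
    then show "continuous (at_right t) (\<lambda>s. X s \<omega>)" by (rule continuous_within_subset) (use t in auto)
  next
    fix t :: real assume t: "0 < t"
    have "continuous_on {0<..} (\<lambda>s. X s \<omega>)" by (rule continuous_on_subset[OF elim]) auto
    then have "isCont (\<lambda>s. X s \<omega>) t" using t by (simp add: continuous_on_eq_continuous_at)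
    then show "\<exists>l. ((\<lambda>s. X s \<omega>) \<longlongrightarrow> l) (at_left t)" by (auto simp: isCont_def filterlim_at_split)
  qed
qed

text \<open>Along any partition the Lipschitz bounds telescope, which gives the constant
  \<open>K * T\<close>.\<close>

lemma bounded_variation_upto_lipschitz:
  assumes "0 \<le> K" and f: "\<And>s t. 0 \<le> s \<Longrightarrow> s \<le> t \<Longrightarrow> \<bar>f t - f s\<bar> \<le> K * (t - s)"
  shows "bounded_variation_upto f T"
  unfolding bounded_variation_upto_def
proof (intro exI[of _ "K * T"] allI impI)
  fix n :: nat and t assume t: "0 \<le> t 0 \<and> (\<forall>i<n. t i \<le> t (Suc i)) \<and> t n \<le> T"
  have nonneg: "0 \<le> t i" if "i \<le> n" for i
    using that
  proof (induction i)
    case (Suc i)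
    then show ?case using t by (meson Suc_le_lessD less_imp_le order_trans)
  qed (use t in simp)
  have "(\<Sum>i<n. \<bar>f (t (Suc i)) - f (t i)\<bar>) \<le> (\<Sum>i<n. K * (t (Suc i) - t i))"
    using t nonneg by (intro sum_mono f) auto
  also have "\<dots> = K * (t n - t 0)"
    by (simp add: sum_distrib_left[symmetric] sum_lessThan_telescope)
  also have "\<dots> \<le> K * T" using t assms(1) by (intro mult_left_mono) auto
  finally show "(\<Sum>i<n. \<bar>f (t (Suc i)) - f (t i)\<bar>) \<le> K * T" .
qed

theorem theorem3p2:
  fixes M :: "'w measure" and B :: "real \<Rightarrow> 'w \<Rightarrow> real" and lam z :: real
  assumes "prob_space M" and "complete_measure M"
    and "standard_brownian_motion M B"
    and "0 < lam" and "0 < z"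
  defines "\<sigma> \<equiv> last_passage (drifted B lam) z"
    and "\<xi> \<equiv> stopped_at_last_passage (drifted B lam) z"
  shows "semimartingale M (natural_filtration M \<xi>) \<xi> \<and>
    (\<exists>b. stopped_brownian_motion M (natural_filtration M \<xi>) \<sigma> b \<and>
      (\<forall>t\<ge>0. \<forall>\<omega>\<in>space M.
        \<xi> t \<omega> = b t \<omega> + lam * (LBINT s:{0..stop_at t (\<sigma> \<omega>)}. sgn (z - \<xi> s \<omega>))))"
proof -
  obtain X where X: "drifted_paths M X lam z" and XB: "AE \<omega> in M. \<forall>t\<ge>0. X t \<omega> = drifted B lam t \<omega>"
    using drifted_paths_modification[OF assms(1,3-5)] by blast
  interpret D: drifted_paths M X lam z by (rule X)
  interpret C: complete_measure M by fact
  \<comment> \<open>Off one null set the paths agree at all nonnegative times, hence so do their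
    visits to \<open>z\<close>. For \<open>\<xi>\<close> all real \<open>t\<close> are covered, as
    \<open>stop_at\<close> is never negative.\<close>
  have good: "AE \<omega> in M. \<sigma> \<omega> = D.\<sigma> \<omega> \<and> (\<forall>t. \<xi> t \<omega> = D.\<xi> t \<omega>)"
    using XB
  proof eventually_elim
    case (elim \<omega>)
    then have "{t. 0 < t \<and> drifted B lam t \<omega> = z} = {t. 0 < t \<and> X t \<omega> = z}" by auto
    then have \<sigma>: "\<sigma> \<omega> = D.\<sigma> \<omega>" by (simp add: \<sigma>_def D.\<sigma>_def last_passage_def)
    moreover have "\<xi> t \<omega> = D.\<xi> t \<omega>" for t
      using elim \<sigma> stop_at_nonneg unfolding \<xi>_def D.\<xi>_def stopped_at_last_passage_def \<sigma>_def D.\<sigma>_def by simp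
    ultimately show ?case by simp
  qed
  have \<xi>_AE: "AE \<omega> in M. \<xi> t \<omega> = D.\<xi> t \<omega>" for t using good by eventually_elim simp
  have F: "natural_filtration M \<xi> = D.F\<xi>"
    by (rule natural_filtration_cong_AE[OF C.borel_measurable_AE_eq[OF D.xi_measurable \<xi>_AE] D.xi_measurable \<xi>_AE])
  define A where "A t \<omega> = lam * (LBINT s:{0..stop_at t (\<sigma> \<omega>)}. sgn (z - \<xi> s \<omega>))" for t \<omega>
  \<comment> \<open>Defined from the given process by subtraction, so that the decomposition holds
    at every point of the space; only its martingale properties come from the regular
    version.\<close>
  define b where "b t \<omega> = \<xi> t \<omega> - A t \<omega>" for t \<omega>
  have A_AE: "AE \<omega> in M. \<forall>t\<ge>0. A t \<omega> = D.drift t \<omega>"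
    using good AE_space by eventually_elim (simp add: A_def D.drift_eq_stopped)
  have b_AE: "AE \<omega> in M. \<forall>t\<ge>0. b t \<omega> = D.b\<xi> t \<omega>"
    using A_AE good by eventually_elim (simp add: b_def D.b\<xi>_def)
  have null: "null_sets M \<subseteq> sets (D.F\<xi> t)" for t by (rule null_sets_natural_filtration)
  have adaptedI: "adapted D.F\<xi> Y"
    if Z: "\<And>t. 0 \<le> t \<Longrightarrow> Z t \<in> borel_measurable (D.F\<xi> t)" and eq: "AE \<omega> in M. \<forall>t\<ge>0. Y t \<omega> = Z t \<omega>" for Y Z
    unfolding adapted_def
  proof (intro allI impI)
    fix t :: real assume t: "0 \<le> t"
    have eq': "AE \<omega> in M. Y t \<omega> = Z t \<omega>" using eq by eventually_elim (use t in simp)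
    show "Y t \<in> borel_measurable (D.F\<xi> t)"
      by (rule measurable_AE_null_sets[OF D.subalgebra_F null _ Z[OF t] eq'])
         (rule C.borel_measurable_AE_eq[OF measurable_from_subalg[OF D.subalgebra_F Z[OF t]] eq'])
  qed
  have contI: "ae_continuous M Y"
    if "\<And>\<omega>. \<omega> \<in> space M \<Longrightarrow> continuous_on UNIV (\<lambda>t. Z t \<omega>)" "AE \<omega> in M. \<forall>t\<ge>0. Y t \<omega> = Z t \<omega>" for Y Z
    unfolding ae_continuous_def using that(2) AE_space
  proof eventually_elim
    case (elim \<omega>)
    have "continuous_on {0..} (\<lambda>t. Z t \<omega>)" by (rule continuous_on_subset[OF that(1)[OF elim(2)]]) simp
    then show ?case by (rule continuous_on_cong[THEN iffD1, rotated 2]) (use elim in auto)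
  qed
  have mart_b: "martingale M D.F\<xi> b"
    by (rule martingale_cong_AE[OF assms(1,2) D.martingale_b null])
       (use b_AE in \<open>auto elim!: eventually_mono\<close>)
  have mart_b2: "martingale M D.F\<xi> (\<lambda>t \<omega>. (b t \<omega>)\<^sup>2 - stop_at t (\<sigma> \<omega>))"
  proof (rule martingale_cong_AE[OF assms(1,2) D.martingale_b_square null])
    show "AE \<omega> in M. (b t \<omega>)\<^sup>2 - stop_at t (\<sigma> \<omega>) = (D.b\<xi> t \<omega>)\<^sup>2 - stop_at t (D.\<sigma> \<omega>)" if "0 \<le> t" for t
      using b_AE good by eventually_elim (use that in simp)
  qed
  note local_b = martingale_imp_local_martingale[OF assms(1) mart_b]
  have cont_b: "ae_continuous M b" by (rule contI[OF D.b_cont b_AE])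
  have stop_AE: "AE \<omega> in M. \<forall>t\<ge>0. stop_at t (\<sigma> \<omega>) = stop_at t (D.\<sigma> \<omega>)"
    using good by eventually_elim simp
  have "finite_variation_process M D.F\<xi> A"
    unfolding finite_variation_process_def
  proof (intro conjI)
    show "adapted D.F\<xi> A" by (rule adaptedI[OF D.drift_adapted A_AE])
    show "ae_cadlag M A" by (rule ae_continuous_imp_ae_cadlag[OF contI[OF D.drift_cont A_AE]])
    show "AE \<omega> in M. \<forall>T\<ge>0. bounded_variation_upto (\<lambda>t. A t \<omega>) T"
      using A_AE AE_space
    proof eventually_elim
      case (elim \<omega>)
      then have "\<bar>A t \<omega> - A s \<omega>\<bar> \<le> lam * (t - s)" if "0 \<le> s" "s \<le> t" for s t
        using D.drift_lipschitz[OF elim(2), of t s] that by simp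
      then show ?case using D.lam_pos by (intro allI impI bounded_variation_upto_lipschitz[of lam]) auto
    qed
  qed
  moreover have "adapted D.F\<xi> \<xi>"
    unfolding F[symmetric] adapted_def by (simp add: measurable_natural_filtration)
  moreover have "AE \<omega> in M. \<forall>t\<ge>0. \<xi> t \<omega> = b t \<omega> + A t \<omega>" by (simp add: b_def)
  ultimately have "semimartingale M D.F\<xi> \<xi>"
    unfolding semimartingale_def using local_b ae_continuous_imp_ae_cadlag[OF cont_b] by blast
  moreover have "stopped_brownian_motion M D.F\<xi> \<sigma> b"
    unfolding stopped_brownian_motion_def quadratic_variation_def
  proof (intro conjI mart_b cont_b local_b martingale_imp_local_martingale[OF assms(1) mart_b2])
    show "AE \<omega> in M. b 0 \<omega> = 0" using b_AE AE_space by eventually_elim (simp add: D.b_0)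
    show "adapted D.F\<xi> (\<lambda>t \<omega>. stop_at t (\<sigma> \<omega>))" by (rule adaptedI[OF D.stop_at_adapted stop_AE])
    show "ae_continuous M (\<lambda>t \<omega>. stop_at t (\<sigma> \<omega>))" by (rule contI[OF continuous_on_stop_at stop_AE])
    show "AE \<omega> in M. stop_at 0 (\<sigma> \<omega>) = 0 \<and> mono_on {0..} (\<lambda>t. stop_at t (\<sigma> \<omega>))"
      by (intro AE_I2) (auto simp: stop_at_def mono_on_def intro: stop_at_mono[unfolded stop_at_def])
  qed
  moreover have "\<forall>t\<ge>0. \<forall>\<omega>\<in>space M. \<xi> t \<omega> = b t \<omega> + lam * (LBINT s:{0..stop_at t (\<sigma> \<omega>)}. sgn (z - \<xi> s \<omega>))"
    by (simp add: b_def A_def)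
  ultimately show ?thesis unfolding F by blast
qed

end
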